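(* Let $\kappa_i\in\frac12\mathbb N$ and $t_{\kappa_i}=\frac{1-4\kappa_i^2}{4}$. For $r,t\in\mathbb C$ consider on $\mathbb H$ the differential equation $$y''(z)=\pi^2\left(rE_4(z)+t\frac{E_4(z)^4}{E_6(z)^2}\right)y(z).$$ (a) Assume $\kappa_i\in\frac12+\mathbb Z_{\ge0}$. Then the equation has local exponents $\frac12\pm\kappa_i$ at $i$ and is apparent if and only if $t=t_{\kappa_i}$ ($r\in\mathbb C$ being arbitrary). (b) Assume $\kappa_i\in\mathbb N$. Then there exists a polynomial $P(x)\in\mathbb Q[x]$ of degree $\kappa_i$ such that the equation with $t=t_{\kappa_i}$ is apparent if and only if $r$ is a root of $P(x)$. Moreover, these values of $r$ are given by $$r+t_{\kappa_i}=-\left(\ell\pm\frac13\right)^2,\qquad \begin{cases}\ell=0,2,4,\ldots,\kappa_i-1,&\text{if }\kappa_i\text{ is odd},\\ \ell=1,3,5,\ldots,\kappa_i-1,&\text{if }\kappa_i\text{ is even}.\end{cases}$$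
   Context: $\mathbb H$ is the upper half-plane, $\mathbb N=\{1,2,\dots\}$, $i=\sqrt{-1}$, $q=e^{2\pi iz}$, $'=d/dz$, $E_4=1+240\sum_{m\ge1}\frac{m^3q^m}{1-q^m}$, $E_6=1-504\sum_{m\ge1}\frac{m^5q^m}{1-q^m}$. The equation $y''=Qy$ is called apparent if at every pole of $Q$ in $\mathbb H$ the local exponents are $\frac12\pm\kappa$ with $\kappa\in\frac12\mathbb Z_{\ge0}$ and no solution has a logarithmic singularity there. *)

theory Defs
  imports "HOL-Complex_Analysis.Complex_Analysis"
begin

definition upper_half_plane :: "complex set" (\<open>\<H>\<close>) where
  "\<H> = {z. Im z > 0}"

definition nome :: "complex \<Rightarrow> complex" where
  "nome z = exp (2 * of_real pi * \<i> * z)"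

definition E4 :: "complex \<Rightarrow> complex" where
  "E4 z = 1 + 240 * (\<Sum>n. let m = Suc n in of_nat m ^ 3 * nome z ^ m / (1 - nome z ^ m))"

definition E6 :: "complex \<Rightarrow> complex" where
  "E6 z = 1 - 504 * (\<Sum>n. let m = Suc n in of_nat m ^ 5 * nome z ^ m / (1 - nome z ^ m))"

text \<open>The indicial polynomial at \<open>z0\<close> of \<open>y'' = Q y\<close> is \<open>X (X - 1) - c\<close>, where
  \<open>c\<close> is the limit of \<open>(z - z0)^2 Q(z)\<close> at \<open>z0\<close>.  The existence of a finite limit says that \<open>z0\<close>
  is a regular singular point or, if \<open>Q\<close> is bounded near \<open>z0\<close>, an ordinary point; in the latter
  case the exponents are \<open>0\<close> and \<open>1\<close>.\<close>

definition has_local_exponents :: "(complex \<Rightarrow> complex) \<Rightarrow> complex \<Rightarrow> complex \<Rightarrow> complex \<Rightarrow> bool" where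
  "has_local_exponents Q z0 a b \<longleftrightarrow>
     isolated_singularity_at Q z0 \<and>
     (\<exists>c. ((\<lambda>z. (z - z0)^2 * Q z) \<longlongrightarrow> c) (at z0) \<and>
          [:0, 1:] * [:-1, 1:] - [:c:] = [:-a, 1:] * [:-b, 1:])"

text \<open>Solutions near a pole are multivalued; a branch is taken on a disc slit along the ray on which
  the principal branches of \<open>Ln (z - z0)\<close> and \<open>(z - z0) powr a\<close> jump.  A local solution on
  another simply connected part of the punctured disc continues analytically to one of these.\<close>

definition slit_ball :: "complex \<Rightarrow> real \<Rightarrow> complex set" where
  "slit_ball z0 e = {z \<in> ball z0 e. z - z0 \<notin> \<real>\<^sub>\<le>\<^sub>0}"

definition local_solution ::
    "(complex \<Rightarrow> complex) \<Rightarrow> complex \<Rightarrow> real \<Rightarrow> (complex \<Rightarrow> complex) \<Rightarrow> bool" where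
  "local_solution Q z0 e y \<longleftrightarrow>
     e > 0 \<and> Q holomorphic_on ball z0 e - {z0} \<and> y holomorphic_on slit_ball z0 e \<and>
     (\<forall>z\<in>slit_ball z0 e. (deriv ^^ 2) y z = Q z * y z)"

text \<open>By Frobenius' method every local solution at a regular singular point whose exponents differ
  by an integer has the form below with \<open>f\<close> and \<open>g\<close> holomorphic at \<open>z0\<close>.  The singularity is
  logarithmic if the coefficient \<open>g\<close> of the logarithm does not vanish identically; \<open>g\<close> is
  determined by \<open>y\<close> and \<open>a\<close>, and whether it vanishes does not depend on \<open>a\<close>.\<close>

definition has_log_singularity :: "(complex \<Rightarrow> complex) \<Rightarrow> complex \<Rightarrow> real \<Rightarrow> bool" where
  "has_log_singularity y z0 e \<longleftrightarrow>
     (\<exists>a f g. f holomorphic_on ball z0 e \<and> g holomorphic_on ball z0 e \<and>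
        (\<exists>z\<in>ball z0 e. g z \<noteq> 0) \<and>
        (\<forall>z\<in>slit_ball z0 e. y z = (z - z0) powr a * (f z + g z * Ln (z - z0))))"

definition apparent :: "(complex \<Rightarrow> complex) \<Rightarrow> bool" where
  "apparent Q \<longleftrightarrow>
     (\<forall>z0\<in>\<H>. is_pole Q z0 \<longrightarrow>
        (\<exists>n::nat. let \<kappa> = of_nat n / 2 in has_local_exponents Q z0 (1/2 - \<kappa>) (1/2 + \<kappa>)) \<and>
        (\<nexists>y e. local_solution Q z0 e y \<and> has_log_singularity y z0 e))"

definition potential :: "complex \<Rightarrow> complex \<Rightarrow> complex \<Rightarrow> complex" where
  "potential r t z = of_real pi ^ 2 * (r * E4 z + t * (E4 z ^ 4 / E6 z ^ 2))"

definition t_of :: "real \<Rightarrow> complex" where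
  "t_of \<kappa> = of_real ((1 - 4 * \<kappa>^2) / 4)"

end

theory Submission
  imports Defs "HOL-Real_Asymp.Real_Asymp"
begin

text \<open>At a zero of \<open>E6\<close> the function \<open>s = E6 / E4 powr (3/2)\<close> is a local coordinate.  By Ramanujan's
  differential equations for \<open>E2\<close>, \<open>E4\<close>, \<open>E6\<close>, the substitution \<open>y = E4 powr (-1/4) * (1 - s^2) powr \<gamma> * v\<close>
  with \<open>r + t = - 4 \<gamma>^2\<close> turns the equation into a hypergeometric equation for \<open>v\<close> in the
  variable \<open>s^2\<close>, the same at every zero of \<open>E6\<close>.  Its Frobenius series obey a two-term recurrence
  in even powers of \<open>s\<close>.  For half-integral \<open>\<kappa>\<close> the exponent difference \<open>2 \<kappa>\<close> is odd, so the
  recurrence is never obstructed.  For integral \<open>\<kappa>\<close> there is no logarithm if and only if the product of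
  the first \<open>\<kappa>\<close> numerators of the recurrence vanishes, and these are linear factors in \<open>\<gamma>\<close>.
  The equation has a pole at \<open>\<i>\<close> because \<open>E6 \<i> = 0\<close>, which follows from the symmetry of the
  Gaussian integers.\<close>

section \<open>Lambert series and Ramanujan's differential equations\<close>

text \<open>Every constant of the hypergeometric equation is a local exponent. At the cusp 1 - s^2 =
  (E4^3 - E6^2) / E4^3 behaves like 1728 q and the potential tends to \<pi>^2 (r + t), so y behaves
  like q^\<gamma> with r + t = -4 \<gamma>^2. At a zero of E4 the equation is regular, with
  exponents 0 and 1, while s grows with order 3/2; this produces the parameters 2 \<gamma> + 1/6 and
  2 \<gamma> + 5/6 at s = \<infinity>, whose distance 2/3 is the source of the shifts by 1/3 in the
  values of r. The power E4^(-1/4) has the weight -1 of solutions, which makes E2 drop out. The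
  shape of the analytic part comes from the notion of a logarithmic singularity: its exponent is
  arbitrary and its solutions live on a slit disc. Two Frobenius solutions without logarithm do not
  by themselves exclude that some combination has another representation with \<open>Ln\<close>;
  comparing boundary values on the two sides of the slit does. Conversely, an obstructed recurrence
  has to yield an actual logarithmic solution, which reduction of order provides.\<close>

lemma summable_of_nat_power_powser:
  fixes x :: "'a::{real_normed_field,banach}"
  assumes "norm x < 1"
  shows "summable (\<lambda>n. of_nat n ^ k * x ^ n)"
  using assms
proof (induction k arbitrary: x)
  case 0
  then show ?case by (simp add: summable_geometric)
next
  case (Suc k)
  have "summable (\<lambda>n. diffs (\<lambda>n. of_nat n ^ k) n * x ^ n)"
    by (rule termdiff_converges[OF Suc.prems Suc.IH])
  from summable_mult[OF this, of x]
  have "summable (\<lambda>n. of_nat (Suc n) ^ Suc k * x ^ Suc n)"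
    by (simp add: diffs_def algebra_simps)
  then show ?case by (subst (asm) summable_Suc_iff)
qed

lemma of_nat_power_powser_norm_summable_on:
  fixes x :: "'a::{real_normed_field,banach}"
  assumes "norm x < 1"
  shows "(\<lambda>n. norm (of_nat n ^ k * x ^ n)) summable_on A"
proof -
  have "summable (\<lambda>n. norm (of_nat n ^ k * x ^ n))"
    using summable_of_nat_power_powser[of "norm x" k] assms
    by (simp add: norm_mult norm_power)
  then have "(\<lambda>n. norm (of_nat n ^ k * x ^ n)) summable_on UNIV"
    by (intro norm_summable_imp_summable_on) simp
  then show ?thesis
    using summable_on_subset_banach by blast
qed

lemma has_sum_Suc_iff: "((\<lambda>n. f (Suc n)) has_sum x) UNIV \<longleftrightarrow> (f has_sum x) {1..}"
  by (rule has_sum_reindex_bij_betw[OF bij_betwI[where g = "\<lambda>n. n - 1"]]) auto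

section \<open>Lambert summands\<close>

definition lam :: "complex \<Rightarrow> nat \<Rightarrow> complex" where
  "lam q n = q ^ n / (1 - q ^ n)"

lemma one_minus_power_nonzero:
  fixes q :: complex
  assumes "norm q < 1" "n \<ge> 1"
  shows "1 - q ^ n \<noteq> 0"
proof
  assume "1 - q ^ n = 0"
  then have "norm q ^ n = 1"
    by (metis eq_iff_diff_eq_0 norm_one norm_power)
  then show False using assms power_strict_mono[of "norm q" 1 n] by simp
qed

lemma norm_one_minus_power_ge:
  fixes q :: complex
  assumes "norm q < 1" "n \<ge> 1"
  shows "norm (1 - q ^ n) \<ge> 1 - norm q"
proof -
  have "norm q ^ n \<le> norm q"
    using assms by (metis less_eq_real_def norm_ge_zero power_decreasing power_one_right)
  moreover have "norm (1 - q ^ n) \<ge> 1 - norm (q ^ n)"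
    by (metis norm_one norm_triangle_ineq2)
  ultimately show ?thesis by (simp add: norm_power)
qed

lemma norm_lam_le:
  assumes "norm q < 1" "n \<ge> 1"
  shows "norm (lam q n) \<le> norm q ^ n / (1 - norm q)"
  using norm_one_minus_power_ge[OF assms] assms
  by (auto simp: lam_def norm_divide norm_power intro!: divide_left_mono mult_pos_pos)

text \<open>This identity turns the product of two Lambert series into sums of the same kind.\<close>

lemma lam_mult:
  assumes "norm q < 1" "a \<ge> 1" "b \<ge> 1"
  shows "lam q a * lam q b = lam q (a + b) * (1 + lam q a + lam q b)"
proof -
  have "1 - q ^ a \<noteq> 0" "1 - q ^ b \<noteq> 0" "1 - q ^ (a + b) \<noteq> 0"
    using assms by (intro one_minus_power_nonzero; simp)+
  then show ?thesis
    unfolding lam_def power_add by (simp add: divide_simps) (simp add: algebra_simps)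
qed

section \<open>Absolutely convergent double sums with polynomial weights\<close>

text \<open>The bound factorises into a power for \<open>a\<close> and one for \<open>b\<close>, so
  that weighted double sums are dominated by products of one-variable series; \<open>Suc\<close>
  keeps it positive at 0.\<close>

definition poly_bounded :: "(nat \<Rightarrow> nat \<Rightarrow> complex) \<Rightarrow> bool" where
  "poly_bounded g \<longleftrightarrow> (\<exists>K k. \<forall>a b. norm (g a b) \<le> K * (real (Suc a) ^ k * real (Suc b) ^ k))"

lemma poly_boundedD:
  assumes "poly_bounded g"
  shows "\<exists>K k. K \<ge> 0 \<and> (\<forall>a b. norm (g a b) \<le> K * (real (Suc a) ^ k * real (Suc b) ^ k))"
proof -
  from assms obtain K k where *: "\<And>a b. norm (g a b) \<le> K * (real (Suc a) ^ k * real (Suc b) ^ k)"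
    unfolding poly_bounded_def by blast
  have "K \<ge> 0" using order_trans[OF norm_ge_zero *[of 0 0]] by simp
  with * show ?thesis by blast
qed

lemma poly_bounded_const: "poly_bounded (\<lambda>a b. c)"
  unfolding poly_bounded_def by (rule exI[of _ "norm c"], rule exI[of _ 0]) simp

lemma poly_bounded_fst: "poly_bounded (\<lambda>a b. of_nat a)"
  unfolding poly_bounded_def
proof (intro exI[of _ 1] allI)
  fix a b :: nat
  have "real a * 1 \<le> (1 + real a) * (1 + real b)"
    by (intro mult_mono) auto
  then show "norm (of_nat a :: complex) \<le> 1 * (real (Suc a) ^ 1 * real (Suc b) ^ 1)" by simp
qed

lemma poly_bounded_snd: "poly_bounded (\<lambda>a b. of_nat b)"
  unfolding poly_bounded_def
proof (intro exI[of _ 1] allI)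
  fix a b :: nat
  have "1 * real b \<le> (1 + real a) * (1 + real b)"
    by (intro mult_mono) auto
  then show "norm (of_nat b :: complex) \<le> 1 * (real (Suc a) ^ 1 * real (Suc b) ^ 1)" by simp
qed

lemma poly_bounded_mult:
  assumes "poly_bounded f" "poly_bounded g"
  shows "poly_bounded (\<lambda>a b. f a b * g a b)"
proof -
  obtain K k where f: "K \<ge> 0" "\<And>a b. norm (f a b) \<le> K * (real (Suc a) ^ k * real (Suc b) ^ k)"
    using poly_boundedD[OF assms(1)] by blast
  obtain L l where g: "L \<ge> 0" "\<And>a b. norm (g a b) \<le> L * (real (Suc a) ^ l * real (Suc b) ^ l)"
    using poly_boundedD[OF assms(2)] by blast
  show ?thesis unfolding poly_bounded_def
  proof (intro exI allI)
    fix a b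
    have "norm (f a b * g a b) \<le> (K * (real (Suc a) ^ k * real (Suc b) ^ k)) * (L * (real (Suc a) ^ l * real (Suc b) ^ l))"
      unfolding norm_mult using f g by (intro mult_mono) auto
    also have "\<dots> = (K * L) * (real (Suc a) ^ (k + l) * real (Suc b) ^ (k + l))"
      by (simp only: power_add mult_ac)
    finally show "norm (f a b * g a b) \<le> (K * L) * (real (Suc a) ^ (k + l) * real (Suc b) ^ (k + l))" .
  qed
qed

lemma poly_bounded_add:
  assumes "poly_bounded f" "poly_bounded g"
  shows "poly_bounded (\<lambda>a b. f a b + g a b)"
proof -
  obtain K k where f: "K \<ge> 0" "\<And>a b. norm (f a b) \<le> K * (real (Suc a) ^ k * real (Suc b) ^ k)"
    using poly_boundedD[OF assms(1)] by blast
  obtain L l where g: "L \<ge> 0" "\<And>a b. norm (g a b) \<le> L * (real (Suc a) ^ l * real (Suc b) ^ l)"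
    using poly_boundedD[OF assms(2)] by blast
  show ?thesis unfolding poly_bounded_def
  proof (intro exI allI)
    fix a b
    let ?m = "k + l"
    have "norm (f a b) \<le> K * (real (Suc a) ^ ?m * real (Suc b) ^ ?m)"
      by (rule order_trans[OF f(2)], intro mult_left_mono mult_mono power_increasing) (use f in auto)
    moreover have "norm (g a b) \<le> L * (real (Suc a) ^ ?m * real (Suc b) ^ ?m)"
      by (rule order_trans[OF g(2)], intro mult_left_mono mult_mono power_increasing) (use g in auto)
    ultimately show "norm (f a b + g a b) \<le> (K + L) * (real (Suc a) ^ ?m * real (Suc b) ^ ?m)"
      using norm_triangle_ineq[of "f a b" "g a b"] unfolding distrib_right by linarith
  qed
qed

lemma poly_bounded_diff:
  assumes "poly_bounded f" "poly_bounded g"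
  shows "poly_bounded (\<lambda>a b. f a b - g a b)"
  using poly_bounded_add[OF assms(1) poly_bounded_mult[OF poly_bounded_const[of "-1"] assms(2)]] by simp

lemma poly_bounded_power: "poly_bounded f \<Longrightarrow> poly_bounded (\<lambda>a b. f a b ^ n)"
  by (induction n) (simp_all add: poly_bounded_const poly_bounded_mult)

lemmas poly_bounded_intros = poly_bounded_const poly_bounded_fst poly_bounded_snd poly_bounded_mult
  poly_bounded_add poly_bounded_diff poly_bounded_power

abbreviation pos_pairs :: "(nat \<times> nat) set" where
  "pos_pairs \<equiv> {1..} \<times> {1..}"

lemma summable_on_pos_pairs_product:
  fixes h :: "nat \<Rightarrow> real"
  assumes "h summable_on {1..}" "\<And>n. h n \<ge> 0"
  shows "(\<lambda>(a, b). h a * h b) summable_on pos_pairs"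
proof (rule summable_on_SigmaI)
  fix a :: nat assume "a \<in> {1..}"
  show "((\<lambda>b. case (a, b) of (a, b) \<Rightarrow> h a * h b) has_sum (h a * infsum h {1..})) {1..}"
    using has_sum_cmult_right[OF has_sum_infsum[OF assms(1)], of "h a"] by simp
  show "(case (a, b) of (a, b) \<Rightarrow> h a * h b) \<ge> 0" for b
    using assms(2) by simp
next
  show "(\<lambda>a. h a * infsum h {1..}) summable_on {1..}"
    using assms(1) by (rule summable_on_cmult_left)
qed

text \<open>The majorant is a product of two series with terms \<open>n ^ k * \<rho> ^ n\<close>;
  \<rho> takes the place of \<open>norm q\<close>.\<close>

lemma norm_summable_on_pos_pairs:
  fixes f :: "nat \<times> nat \<Rightarrow> complex"
  assumes "poly_bounded g" "0 \<le> \<rho>" "\<rho> < 1" "C \<ge> 0"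
    and bound: "\<And>a b. a \<ge> 1 \<Longrightarrow> b \<ge> 1 \<Longrightarrow> norm (f (a, b)) \<le> C * norm (g a b) * (\<rho> ^ a * \<rho> ^ b)"
  shows "(\<lambda>x. norm (f x)) summable_on pos_pairs"
proof -
  obtain K k where K: "K \<ge> 0" "\<And>a b. norm (g a b) \<le> K * (real (Suc a) ^ k * real (Suc b) ^ k)"
    using poly_boundedD[OF assms(1)] by blast
  define h where "h = (\<lambda>n::nat. real n ^ k * \<rho> ^ n)"
  have h0: "h n \<ge> 0" for n using assms by (simp add: h_def)
  have h: "h summable_on {1..}"
    using of_nat_power_powser_norm_summable_on[of \<rho> k "{1..}"] assms
    by (simp add: h_def abs_mult power_abs)
  have "(\<lambda>(a, b). h a * h b) summable_on pos_pairs"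
    by (rule summable_on_pos_pairs_product[OF h h0])
  then have S: "(\<lambda>(a, b). (C * K * (2 ^ k * 2 ^ k)) * (h a * h b)) summable_on pos_pairs"
    using summable_on_cmult_right[of "\<lambda>(a, b). h a * h b" pos_pairs "C * K * (2 ^ k * 2 ^ k)"]
    by (simp add: case_prod_unfold)
  show ?thesis
  proof (rule Infinite_Sum.abs_summable_on_comparison_test'[OF S])
    fix x assume "x \<in> pos_pairs"
    then obtain a b where x: "x = (a, b)" "a \<ge> 1" "b \<ge> 1" by auto
    have "norm (f x) \<le> C * norm (g a b) * (\<rho> ^ a * \<rho> ^ b)"
      using bound x by simp
    also have "\<dots> \<le> C * (K * (real (Suc a) ^ k * real (Suc b) ^ k)) * (\<rho> ^ a * \<rho> ^ b)"
      using assms K by (intro mult_right_mono mult_left_mono) auto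
    \<comment> \<open>For positive \<open>a\<close> one has \<open>Suc a \<le> 2 * a\<close>, at the
      cost of a factor \<open>2 ^ k\<close> in each variable.\<close>
    also have "\<dots> \<le> C * (K * ((2 * real a) ^ k * (2 * real b) ^ k)) * (\<rho> ^ a * \<rho> ^ b)"
      using assms K x by (intro mult_right_mono mult_left_mono mult_mono power_mono) auto
    also have "\<dots> = (C * K * (2 ^ k * 2 ^ k)) * (h a * h b)"
      unfolding h_def power_mult_distrib by simp
    finally show "norm (f x) \<le> (case x of (a, b) \<Rightarrow> (C * K * (2 ^ k * 2 ^ k)) * (h a * h b))"
      using x by simp
  qed
qed

lemma norm_summable_on_pos:
  fixes f :: "nat \<Rightarrow> complex"
  assumes "norm q < 1" "C \<ge> 0" "\<And>n. n \<ge> 1 \<Longrightarrow> norm (f n) \<le> C * (real n ^ k * norm q ^ n)"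
  shows "(\<lambda>x. norm (f x)) summable_on {1..}"
proof (rule Infinite_Sum.abs_summable_on_comparison_test')
  show "(\<lambda>n. C * (real n ^ k * norm q ^ n)) summable_on {1..}"
    using of_nat_power_powser_norm_summable_on[of "norm q" k "{1..}"] assms
    by (intro summable_on_cmult_right) (simp add: abs_mult power_abs)
qed (use assms in auto)

section \<open>Lambert series and their products\<close>

text \<open>The generating function of the divisor sums: the coefficient of \<open>q ^ n\<close> is
  the sum of \<open>d ^ j\<close> over the divisors \<open>d\<close> of \<open>n\<close>.\<close>

definition Phi :: "nat \<Rightarrow> complex \<Rightarrow> complex" where
  "Phi j q = (\<Sum>\<^sub>\<infinity>n\<in>{1..}. of_nat n ^ j * lam q n)"

lemma Phi_norm_summable:
  assumes "norm q < 1"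
  shows "(\<lambda>n. norm (of_nat n ^ j * lam q n)) summable_on {1..}"
proof (rule norm_summable_on_pos[OF assms])
  fix n :: nat assume n: "n \<ge> 1"
  show "norm (of_nat n ^ j * lam q n) \<le> (1 / (1 - norm q)) * (real n ^ j * norm q ^ n)"
    using mult_left_mono[OF norm_lam_le[OF assms n], of "real n ^ j"]
    by (simp add: norm_mult norm_power)
qed (use assms in auto)

lemma Phi_summable:
  "norm q < 1 \<Longrightarrow> (\<lambda>n. of_nat n ^ j * lam q n) summable_on {1..}"
  by (rule Infinite_Sum.abs_summable_summable[OF Phi_norm_summable])

text \<open>The squares come from differentiation: q d/dq maps \<open>lam q n\<close> to
  \<open>n * (lam q n + lam q n ^ 2)\<close>.\<close>

lemma lam_square_summable:
  assumes "norm q < 1"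
  shows "(\<lambda>n. of_nat n ^ j * lam q n ^ 2) summable_on {1..}"
proof (rule abs_summable_summable, rule norm_summable_on_pos[OF assms])
  fix n :: nat assume n: "n \<ge> 1"
  have "norm (lam q n) ^ 2 \<le> (norm q ^ n / (1 - norm q)) ^ 2"
    by (intro power_mono norm_lam_le assms n) auto
  also have "\<dots> \<le> (1 / (1 - norm q))^2 * norm q ^ n"
  proof -
    have "(norm q ^ n)^2 \<le> norm q ^ n * 1"
      unfolding power2_eq_square using assms by (intro mult_left_mono) (auto simp: power_le_one)
    then show ?thesis unfolding power_divide by (simp add: divide_right_mono)
  qed
  finally have "real n ^ j * norm (lam q n) ^ 2 \<le> real n ^ j * ((1 / (1 - norm q))^2 * norm q ^ n)"
    by (intro mult_left_mono) auto
  then show "norm (of_nat n ^ j * lam q n ^ 2) \<le> (1 / (1 - norm q))^2 * (real n ^ j * norm q ^ n)"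
    by (simp add: norm_mult norm_power mult_ac)
qed auto

lemma norm_lam_pair_le:
  assumes "norm q < 1" "a \<ge> 1" "b \<ge> 1"
  shows "norm (lam q a * lam q b) \<le> (1 / (1 - norm q))^2 * (norm q ^ a * norm q ^ b)"
    and "norm (lam q (a + b)) \<le> (1 / (1 - norm q)) * (norm q ^ a * norm q ^ b)"
    and "norm (lam q (a + b) * lam q a) \<le> (1 / (1 - norm q))^2 * (norm q ^ a * norm q ^ b)"
proof -
  have "norm (lam q a * lam q b) \<le> (norm q ^ a / (1 - norm q)) * (norm q ^ b / (1 - norm q))"
    unfolding norm_mult using assms by (intro mult_mono norm_lam_le) auto
  then show "norm (lam q a * lam q b) \<le> (1 / (1 - norm q))^2 * (norm q ^ a * norm q ^ b)"
    by (simp add: power2_eq_square)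
  show *: "norm (lam q (a + b)) \<le> (1 / (1 - norm q)) * (norm q ^ a * norm q ^ b)"
    using norm_lam_le[of q "a + b"] assms by (simp add: power_add)
  have "norm (lam q a) \<le> norm q ^ a / (1 - norm q)"
    using assms by (intro norm_lam_le)
  also have "\<dots> \<le> 1 / (1 - norm q)"
    using assms by (intro divide_right_mono) (auto simp: power_le_one)
  finally have "norm (lam q a) \<le> 1 / (1 - norm q)" .
  then have "norm (lam q (a + b) * lam q a) \<le> ((1 / (1 - norm q)) * (norm q ^ a * norm q ^ b)) * (1 / (1 - norm q))"
    unfolding norm_mult using * assms by (intro mult_mono) auto
  then show "norm (lam q (a + b) * lam q a) \<le> (1 / (1 - norm q))^2 * (norm q ^ a * norm q ^ b)"
    by (simp add: power2_eq_square)
qed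

lemma pair_sums_summable:
  assumes "norm q < 1" "poly_bounded g"
  shows "(\<lambda>(a, b). g a b * (lam q a * lam q b)) summable_on pos_pairs"
    and "(\<lambda>(a, b). g a b * lam q (a + b)) summable_on pos_pairs"
    and "(\<lambda>(a, b). g a b * (lam q (a + b) * lam q a)) summable_on pos_pairs"
proof -
  have *: "norm (g a b * x) \<le> C * norm (g a b) * (norm q ^ a * norm q ^ b)"
    if "norm x \<le> C * (norm q ^ a * norm q ^ b)" for a b x C
    using mult_left_mono[OF that, of "norm (g a b)"] by (simp add: norm_mult mult_ac)
  note ** = abs_summable_summable[OF norm_summable_on_pos_pairs[OF assms(2) norm_ge_zero assms(1)]]
  show "(\<lambda>(a, b). g a b * (lam q a * lam q b)) summable_on pos_pairs"
    by (rule **[of "(1 / (1 - norm q))^2"]) (use assms in \<open>auto intro!: * norm_lam_pair_le\<close>)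
  show "(\<lambda>(a, b). g a b * lam q (a + b)) summable_on pos_pairs"
    by (rule **[of "1 / (1 - norm q)"])
       (use assms in \<open>auto intro!: *[of _ "1 / (1 - norm q)", simplified] norm_lam_pair_le(2)[simplified]\<close>)
  show "(\<lambda>(a, b). g a b * (lam q (a + b) * lam q a)) summable_on pos_pairs"
    by (rule **[of "(1 / (1 - norm q))^2"]) (use assms in \<open>auto intro!: * norm_lam_pair_le\<close>)
qed

lemma infsum_pos_pairs_product:
  fixes f g :: "nat \<Rightarrow> complex"
  assumes "(\<lambda>(a, b). f a * g b) summable_on pos_pairs"
  shows "(\<Sum>\<^sub>\<infinity>(a, b)\<in>pos_pairs. f a * g b) = infsum f {1..} * infsum g {1..}"
proof -
  have "(\<Sum>\<^sub>\<infinity>(a, b)\<in>pos_pairs. f a * g b) = (\<Sum>\<^sub>\<infinity>a\<in>{1..}. \<Sum>\<^sub>\<infinity>b\<in>{1..}. f a * g b)"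
    using infsum_Sigma'_banach[OF assms] by simp
  also have "\<dots> = infsum f {1..} * infsum g {1..}"
    by (simp add: infsum_cmult_right' infsum_cmult_left')
  finally show ?thesis .
qed

lemma Phi_mult:
  assumes "norm q < 1"
  shows "(\<Sum>\<^sub>\<infinity>(a, b)\<in>pos_pairs. of_nat a ^ i * of_nat b ^ j * (lam q a * lam q b)) = Phi i q * Phi j q"
proof -
  have "poly_bounded (\<lambda>a b. of_nat a ^ i * of_nat b ^ j)" by (intro poly_bounded_intros)
  from pair_sums_summable(1)[OF assms this]
  have "(\<lambda>(a, b). (of_nat a ^ i * lam q a) * (of_nat b ^ j * lam q b)) summable_on pos_pairs"
    by (simp add: mult_ac)
  from infsum_pos_pairs_product[OF this] show ?thesis
    unfolding Phi_def by (simp add: mult_ac)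
qed

text \<open>Pairs are grouped by their sum \<open>c\<close>, with \<open>a\<close> running from 1 to
  \<open>c - 1\<close>; the group of \<open>c = 1\<close> is empty.\<close>

lemma infsum_pos_pairs_sum:
  fixes f :: "nat \<Rightarrow> complex" and g :: "nat \<Rightarrow> nat \<Rightarrow> complex"
  assumes "(\<lambda>(a, b). g a b * f (a + b)) summable_on pos_pairs"
  shows "(\<Sum>\<^sub>\<infinity>(a, b)\<in>pos_pairs. g a b * f (a + b)) = (\<Sum>\<^sub>\<infinity>c\<in>{1..}. (\<Sum>a\<in>{1..<c}. g a (c - a)) * f c)"
proof -
  define T where "T = Sigma {1::nat..} (\<lambda>c. {1..<c})"
  have bij: "bij_betw (\<lambda>(c, a). (a, c - a)) T pos_pairs"
    by (rule bij_betwI[where g = "\<lambda>(a, b). (a + b, a)"]) (auto simp: T_def)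
  have "(\<lambda>(c, a). g a (c - a) * f (a + (c - a))) summable_on T"
    using assms summable_on_reindex_bij_betw[OF bij, of "\<lambda>(a, b). g a b * f (a + b)"]
    by (simp add: case_prod_unfold)
  then have S: "(\<lambda>(c, a). g a (c - a) * f c) summable_on T"
    by (rule summable_on_cong[THEN iffD1, rotated]) (auto simp: T_def)
  have "(\<Sum>\<^sub>\<infinity>(a, b)\<in>pos_pairs. g a b * f (a + b)) = (\<Sum>\<^sub>\<infinity>(c, a)\<in>T. g a (c - a) * f (a + (c - a)))"
    using infsum_reindex_bij_betw[OF bij, of "\<lambda>(a, b). g a b * f (a + b)"]
    by (simp add: case_prod_unfold)
  also have "\<dots> = (\<Sum>\<^sub>\<infinity>(c, a)\<in>T. g a (c - a) * f c)"
    by (intro infsum_cong) (auto simp: T_def)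
  also have "\<dots> = (\<Sum>\<^sub>\<infinity>c\<in>{1..}. \<Sum>\<^sub>\<infinity>a\<in>{1..<c}. g a (c - a) * f c)"
    using infsum_Sigma'_banach[OF S[unfolded T_def]] by (simp add: T_def)
  also have "\<dots> = (\<Sum>\<^sub>\<infinity>c\<in>{1..}. (\<Sum>a\<in>{1..<c}. g a (c - a)) * f c)"
    by (simp add: sum_distrib_right)
  finally show ?thesis .
qed

text \<open>Since \<open>g a b = p a (a + b)\<close>, the substitution \<open>c = a + b\<close> turns the sums of
  \<open>g a b * lam q (a + b) * lam q a\<close> and of its mirror image into the two off-diagonal
  halves of the sum of \<open>p a c * lam q a * lam q c\<close>.\<close>

lemma lambert_product_identity:
  fixes g p :: "nat \<Rightarrow> nat \<Rightarrow> complex"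
  assumes q: "norm q < 1" and bounded: "poly_bounded g" "poly_bounded p"
    and g_sym: "\<And>a b. g a b = g b a" and p_sym: "\<And>a b. p a b = p b a"
    and gp: "\<And>a b. g a b = p a (a + b)"
    and diag: "\<And>a. p a a = of_nat a ^ k"
  shows "(\<Sum>\<^sub>\<infinity>(a, b)\<in>pos_pairs. (g a b - p a b) * (lam q a * lam q b)) =
    (\<Sum>\<^sub>\<infinity>c\<in>{1..}. (\<Sum>a\<in>{1..<c}. g a (c - a)) * lam q c) - (\<Sum>\<^sub>\<infinity>a\<in>{1..}. of_nat a ^ k * lam q a ^ 2)"
proof -
  note S = pair_sums_summable[OF q bounded(1)]
  note S1 = pair_sums_summable(1)[OF q bounded(2)]
  define h where "h = (\<lambda>(a, b). p a b * (lam q a * lam q b))"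
  define U where "U = {(a, c). 1 \<le> a \<and> a < (c::nat)}"
  define U' where "U' = {(c, a). 1 \<le> a \<and> a < (c::nat)}"
  define \<Delta> where "\<Delta> = (\<lambda>a. (a, a)) ` {1::nat..}"
  have dec: "pos_pairs = (U \<union> U') \<union> \<Delta>"
    by (auto simp: U_def U'_def \<Delta>_def)
  have disj: "(U \<union> U') \<inter> \<Delta> = {}" "U \<inter> U' = {}"
    by (auto simp: U_def U'_def \<Delta>_def)
  have hS: "h summable_on A" if "A \<subseteq> pos_pairs" for A
    using S1 that summable_on_subset_banach unfolding h_def by blast
  have sub: "U \<subseteq> pos_pairs" "U' \<subseteq> pos_pairs" "\<Delta> \<subseteq> pos_pairs" "U \<union> U' \<subseteq> pos_pairs"
    using dec by blast+
  have bijU: "bij_betw (\<lambda>(a, b). (a, a + b)) pos_pairs U"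
    by (rule bij_betwI[where g = "\<lambda>(a, c). (a, c - a)"]) (auto simp: U_def)
  have bijsw: "bij_betw (\<lambda>(a, b). (b, a)) U U'"
    by (rule bij_betwI[where g = "\<lambda>(a, b). (b, a)"]) (auto simp: U_def U'_def)
  have bijswp: "bij_betw (\<lambda>(a, b). (b, a)) pos_pairs pos_pairs"
    by (rule bij_betwI[where g = "\<lambda>(a, b). (b, a)"]) auto
  have E1: "(\<Sum>\<^sub>\<infinity>(a, b)\<in>pos_pairs. g a b * (lam q (a + b) * lam q a)) = infsum h U"
    using infsum_reindex_bij_betw[OF bijU, of h]
    by (simp add: h_def case_prod_unfold gp mult_ac)
  have hsw: "h (b, a) = h (a, b)" for a b by (simp add: h_def p_sym mult_ac)
  have E2: "infsum h U' = infsum h U"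
    using infsum_reindex_bij_betw[OF bijsw, of h] hsw
    by (simp add: case_prod_unfold)
  have S4: "(\<lambda>(a, b). g a b * (lam q (a + b) * lam q b)) summable_on pos_pairs"
    using S(3) summable_on_reindex_bij_betw[OF bijswp, of "\<lambda>(a, b). g a b * (lam q (a + b) * lam q a)"]
    by (simp add: case_prod_unfold g_sym add.commute)
  have E3: "(\<Sum>\<^sub>\<infinity>(a, b)\<in>pos_pairs. g a b * (lam q (a + b) * lam q b)) = infsum h U"
    using E1 infsum_reindex_bij_betw[OF bijswp, of "\<lambda>(a, b). g a b * (lam q (a + b) * lam q a)"]
    by (simp add: case_prod_unfold g_sym add.commute)
  have E4: "infsum h \<Delta> = (\<Sum>\<^sub>\<infinity>a\<in>{1..}. of_nat a ^ k * lam q a ^ 2)"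
    unfolding \<Delta>_def by (subst infsum_reindex) (auto simp: inj_on_def h_def diag o_def power2_eq_square)
  have E5: "infsum h pos_pairs = 2 * infsum h U + infsum h \<Delta>"
    unfolding dec using hS[OF sub(1)] hS[OF sub(2)] hS[OF sub(3)] hS[OF sub(4)] disj E2
    by (simp add: infsum_Un_disjoint)
  have "(\<Sum>\<^sub>\<infinity>(a, b)\<in>pos_pairs. g a b * (lam q a * lam q b)) =
     (\<Sum>\<^sub>\<infinity>(a, b)\<in>pos_pairs. (g a b * lam q (a + b) + g a b * (lam q (a + b) * lam q a)) + g a b * (lam q (a + b) * lam q b))"
  proof (rule infsum_cong)
    fix x assume "x \<in> pos_pairs"
    then obtain a b :: nat where x: "x = (a, b)" "a \<ge> 1" "b \<ge> 1" by auto
    then have "lam q a * lam q b = lam q (a + b) * (1 + lam q a + lam q b)"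
      by (intro lam_mult[OF q]) auto
    then show "(case x of (a, b) \<Rightarrow> g a b * (lam q a * lam q b)) = (case x of (a, b) \<Rightarrow>
        (g a b * lam q (a + b) + g a b * (lam q (a + b) * lam q a)) + g a b * (lam q (a + b) * lam q b))"
      unfolding x(1) prod.case by (simp only: ring_distribs mult_1_right)
  qed
  also have "\<dots> = ((\<Sum>\<^sub>\<infinity>(a, b)\<in>pos_pairs. g a b * lam q (a + b)) + infsum h U) + infsum h U"
    unfolding E1[symmetric]
    using infsum_add[OF S(2) S(3)] infsum_add[OF summable_on_add[OF S(2) S(3)] S4] E1 E3
    by (simp add: case_prod_unfold)
  \<comment> \<open>The off-diagonal part of the sum over \<open>p\<close> is also
    \<open>2 * infsum h U\<close>, so the subtraction leaves only the diagonal, where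
    \<open>lam q a\<close> is squared.\<close>
  finally have "(\<Sum>\<^sub>\<infinity>(a, b)\<in>pos_pairs. g a b * (lam q a * lam q b)) - infsum h pos_pairs =
      (\<Sum>\<^sub>\<infinity>(a, b)\<in>pos_pairs. g a b * lam q (a + b)) - infsum h \<Delta>"
    unfolding E5 by simp
  moreover have "(\<Sum>\<^sub>\<infinity>(a, b)\<in>pos_pairs. (g a b - p a b) * (lam q a * lam q b)) =
     (\<Sum>\<^sub>\<infinity>(a, b)\<in>pos_pairs. g a b * (lam q a * lam q b)) - infsum h pos_pairs"
    using infsum_add[OF S(1) summable_on_uminus[THEN iffD2, OF S1]]
    by (simp add: h_def case_prod_unfold left_diff_distrib infsum_uminus)
  ultimately show ?thesis
    unfolding E4 infsum_pos_pairs_sum[OF S(2)] by simp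
qed

section \<open>The Euler operator q d/dq on Lambert series\<close>

lemma has_field_derivative_lam:
  assumes "norm q < 1" "n \<ge> 1"
  shows "((\<lambda>q. lam q n) has_field_derivative (of_nat n * q ^ (n - 1) / (1 - q ^ n)^2)) (at q)"
  unfolding lam_def
  using one_minus_power_nonzero[OF assms]
  by (auto intro!: derivative_eq_intros simp: power2_eq_square field_simps)

lemma lam_derivative_times:
  assumes "norm q < 1" "n \<ge> 1"
  shows "q * (of_nat n * q ^ (n - 1) / (1 - q ^ n)^2) = of_nat n * (lam q n + lam q n ^ 2)"
proof -
  have "q * q ^ (n - 1) = q ^ n" using assms by (metis power_eq_if not_one_le_zero)
  then have "q * (of_nat n * q ^ (n - 1) / (1 - q ^ n)^2) = of_nat n * q ^ n / (1 - q ^ n)^2"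
    by (simp add: mult_ac)
  also have "\<dots> = of_nat n * (lam q n + lam q n ^ 2)"
    unfolding lam_def using one_minus_power_nonzero[OF assms]
    by (simp add: divide_simps power2_eq_square) (simp add: algebra_simps)
  finally show ?thesis .
qed

lemma Phi_sums:
  assumes "norm q < 1"
  shows "(\<lambda>n. of_nat (Suc n) ^ j * lam q (Suc n)) sums Phi j q"
proof -
  have "((\<lambda>n. of_nat n ^ j * lam q n) has_sum Phi j q) {1..}"
    unfolding Phi_def using Phi_summable[OF assms] by (rule has_sum_infsum)
  then have "((\<lambda>n. of_nat (Suc n) ^ j * lam q (Suc n)) has_sum Phi j q) UNIV"
    using has_sum_Suc_iff[of "\<lambda>n. of_nat n ^ j * lam q n"] by simp
  then show ?thesis by (rule has_sum_imp_sums)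
qed

text \<open>Termwise differentiation, by uniform majorants on a disc of radius
  \<open>\<rho>\<close>. The derivative series carries no factor \<open>q\<close>, so that it can be
  evaluated at \<open>q = 0\<close> too.\<close>

lemma Phi_derivative_sums:
  assumes q: "norm q < 1"
  shows "\<exists>D. (Phi j has_field_derivative D) (at q) \<and>
    (\<lambda>n. of_nat (Suc n) ^ j * (of_nat (Suc n) * q ^ n / (1 - q ^ Suc n)^2)) sums D"
proof -
  obtain \<rho> where \<rho>: "norm q < \<rho>" "\<rho> < 1" using dense[OF q] by blast
  have \<rho>0: "\<rho> > 0" using \<rho> norm_ge_zero[of q] by linarith
  define f where "f = (\<lambda>n q. of_nat (Suc n) ^ j * lam q (Suc n))"
  define f' where "f' = (\<lambda>n q. of_nat (Suc n) ^ j * (of_nat (Suc n) * q ^ n / (1 - q ^ Suc n)^2) :: complex)"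
  have "\<exists>g g'. \<forall>x\<in>ball 0 \<rho>. ((\<lambda>n. f n x) sums g x) \<and> ((\<lambda>n. f' n x) sums g' x) \<and>
     (g has_field_derivative g' x) (at x)"
  proof (rule series_and_derivative_comparison_complex)
    show "open (ball 0 \<rho> :: complex set)" by simp
    show "\<exists>d h. 0 < d \<and> summable h \<and> range h \<subseteq> \<real>\<^sub>\<ge>\<^sub>0 \<and>
        (\<forall>\<^sub>F n in sequentially. \<forall>y\<in>ball x d \<inter> ball 0 \<rho>. cmod (f n y) \<le> cmod (h n))"
      if x: "x \<in> ball 0 \<rho>" for x
    proof (intro exI conjI)
      let ?h = "\<lambda>n. complex_of_real (real (Suc n) ^ j * (\<rho> ^ Suc n / (1 - \<rho>)))"
      show "(1::real) > 0" by simp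
      have "summable (\<lambda>n. real (Suc n) ^ j * \<rho> ^ Suc n)"
        using summable_of_nat_power_powser[of \<rho> j] \<rho> \<rho>0
        by (subst summable_Suc_iff) auto
      then have "summable (\<lambda>n. real (Suc n) ^ j * \<rho> ^ Suc n / (1 - \<rho>))"
        by (rule summable_divide)
      then show "summable ?h"
        unfolding summable_complex_of_real by simp
      show "range ?h \<subseteq> \<real>\<^sub>\<ge>\<^sub>0"
        using \<rho> \<rho>0 by (auto simp del: of_real_mult of_real_power of_real_divide)
      show "\<forall>\<^sub>F n in sequentially. \<forall>y\<in>ball x 1 \<inter> ball 0 \<rho>. cmod (f n y) \<le> cmod (?h n)"
      proof (intro always_eventually allI ballI)
        fix n y assume "y \<in> ball x 1 \<inter> ball 0 \<rho>"
        then have y: "norm y < \<rho>" by auto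
        have "norm (lam y (Suc n)) \<le> norm y ^ Suc n / (1 - norm y)"
          using y \<rho> by (intro norm_lam_le) auto
        also have "\<dots> \<le> \<rho> ^ Suc n / (1 - \<rho>)"
          using y \<rho> \<rho>0 by (intro frac_le power_mono) auto
        finally have "real (Suc n) ^ j * norm (lam y (Suc n)) \<le> real (Suc n) ^ j * (\<rho> ^ Suc n / (1 - \<rho>))"
          by (intro mult_left_mono) auto
        also have "\<dots> = norm (?h n)"
          unfolding norm_of_real using \<rho> \<rho>0 by (simp del: power_Suc)
        finally show "cmod (f n y) \<le> cmod (?h n)"
          unfolding f_def norm_mult norm_power norm_of_nat .
      qed
    qed
    show "(f n has_field_derivative f' n x) (at x)" if "x \<in> ball 0 \<rho>" for n x
      unfolding f_def f'_def
      using DERIV_cmult[OF has_field_derivative_lam[of x "Suc n"], of "of_nat (Suc n) ^ j"] that \<rho> by auto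
  qed
  then obtain g g' where g: "\<And>x. x \<in> ball 0 \<rho> \<Longrightarrow> (\<lambda>n. f n x) sums g x"
    "\<And>x. x \<in> ball 0 \<rho> \<Longrightarrow> (\<lambda>n. f' n x) sums g' x"
    "\<And>x. x \<in> ball 0 \<rho> \<Longrightarrow> (g has_field_derivative g' x) (at x)"
    by blast
  have "g x = Phi j x" if "x \<in> ball 0 \<rho>" for x
    using sums_unique2[OF g(1)[OF that]] Phi_sums[of x j] that \<rho> unfolding f_def by auto
  then have "(Phi j has_field_derivative g' q) (at q)"
    using has_field_derivative_transform_within_open[OF g(3)[of q] open_ball[of 0 \<rho>], of "Phi j"] \<rho> by simp
  then show ?thesis using g(2)[of q] \<rho> unfolding f'_def by auto
qed

lemma Phi_has_field_derivative:
  assumes q: "norm q < 1"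
  obtains D where "(Phi j has_field_derivative D) (at q)"
    "q * D = Phi (Suc j) q + (\<Sum>\<^sub>\<infinity>n\<in>{1..}. of_nat n ^ Suc j * lam q n ^ 2)"
proof -
  obtain D where D: "(Phi j has_field_derivative D) (at q)"
    "(\<lambda>n. of_nat (Suc n) ^ j * (of_nat (Suc n) * q ^ n / (1 - q ^ Suc n)^2)) sums D"
    using Phi_derivative_sums[OF q] by blast
  have "((\<lambda>n. of_nat n ^ Suc j * lam q n + of_nat n ^ Suc j * lam q n ^ 2) has_sum
      (Phi (Suc j) q + (\<Sum>\<^sub>\<infinity>n\<in>{1..}. of_nat n ^ Suc j * lam q n ^ 2))) {1..}"
    unfolding Phi_def
    by (intro has_sum_add has_sum_infsum Phi_summable lam_square_summable q)
  then have "((\<lambda>n. of_nat (Suc n) ^ Suc j * lam q (Suc n) + of_nat (Suc n) ^ Suc j * lam q (Suc n) ^ 2) has_sum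
      (Phi (Suc j) q + (\<Sum>\<^sub>\<infinity>n\<in>{1..}. of_nat n ^ Suc j * lam q n ^ 2))) UNIV"
    by (subst has_sum_Suc_iff)
  from has_sum_imp_sums[OF this]
  have "(\<lambda>n. q * (of_nat (Suc n) ^ j * (of_nat (Suc n) * q ^ n / (1 - q ^ Suc n)^2))) sums
     (Phi (Suc j) q + (\<Sum>\<^sub>\<infinity>n\<in>{1..}. of_nat n ^ Suc j * lam q n ^ 2))"
  proof (rule sums_cong[THEN iffD1, rotated])
    fix n
    have "q * (of_nat (Suc n) * q ^ n / (1 - q ^ Suc n)^2) = of_nat (Suc n) * (lam q (Suc n) + lam q (Suc n) ^ 2)"
      using lam_derivative_times[OF q, of "Suc n"] by simp
    then show "of_nat (Suc n) ^ Suc j * lam q (Suc n) + of_nat (Suc n) ^ Suc j * lam q (Suc n) ^ 2 =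
      q * (of_nat (Suc n) ^ j * (of_nat (Suc n) * q ^ n / (1 - q ^ Suc n)^2))"
      by (metis (no_types, lifting) distrib_left mult.assoc mult.left_commute power_Suc)
  qed
  with sums_mult[OF D(2), of q]
  have "q * D = Phi (Suc j) q + (\<Sum>\<^sub>\<infinity>n\<in>{1..}. of_nat n ^ Suc j * lam q n ^ 2)"
    by (rule sums_unique2)
  with D(1) show thesis by (rule that)
qed

lemma Phi_0: "Phi j 0 = 0"
  unfolding Phi_def by (rule infsum_0) (auto simp: lam_def)

text \<open>Only the term with \<open>0 ^ 0 = 1\<close> survives: the linear coefficient of the
  divisor sum series is 1.\<close>

lemma Phi_derivative_0: "(Phi j has_field_derivative 1) (at 0)"
proof -
  obtain D where D: "(Phi j has_field_derivative D) (at 0)"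
    "(\<lambda>n. of_nat (Suc n) ^ j * (of_nat (Suc n) * 0 ^ n / (1 - 0 ^ Suc n)^2)) sums D"
    using Phi_derivative_sums[of 0 j] by auto
  have "(\<lambda>n. of_nat (Suc n) ^ j * (of_nat (Suc n) * 0 ^ n / (1 - 0 ^ Suc n)^2)) sums (1::complex)"
    using powser_sums_zero[of "\<lambda>n. of_nat (Suc n) ^ j * of_nat (Suc n) :: complex"] by (simp add: mult.assoc)
  with D show ?thesis using sums_unique2 by blast
qed

section \<open>Power sums and convolution sums of quadratic forms\<close>

text \<open>Faulhaber's formulas up to exponent 6. The upper end \<open>c\<close> is left out since
  \<open>a\<close> runs over the first components of the positive pairs with sum
  \<open>c\<close>.\<close>

lemma sum_of_nat_powers:
  fixes c :: nat
  defines "x \<equiv> of_nat c :: complex"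
  assumes "c \<ge> 1"
  shows "(\<Sum>a\<in>{1..<c}. 1) = x - 1"
    and "(\<Sum>a\<in>{1..<c}. of_nat a) = (x^2 - x) / 2"
    and "(\<Sum>a\<in>{1..<c}. of_nat a ^ 2) = x^3 / 3 - x^2 / 2 + x / 6"
    and "(\<Sum>a\<in>{1..<c}. of_nat a ^ 3) = x^4 / 4 - x^3 / 2 + x^2 / 4"
    and "(\<Sum>a\<in>{1..<c}. of_nat a ^ 4) = x^5 / 5 - x^4 / 2 + x^3 / 3 - x / 30"
    and "(\<Sum>a\<in>{1..<c}. of_nat a ^ 5) = x^6 / 6 - x^5 / 2 + 5 * x^4 / 12 - x^2 / 12"
    and "(\<Sum>a\<in>{1..<c}. of_nat a ^ 6) = x^7 / 7 - x^6 / 2 + x^5 / 2 - x^3 / 6 + x / 42"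
proof -
  have "(\<Sum>a\<in>{1..<c}. 1) = x - 1 \<and> (\<Sum>a\<in>{1..<c}. of_nat a) = (x^2 - x) / 2 \<and>
     (\<Sum>a\<in>{1..<c}. of_nat a ^ 2) = x^3 / 3 - x^2 / 2 + x / 6 \<and>
     (\<Sum>a\<in>{1..<c}. of_nat a ^ 3) = x^4 / 4 - x^3 / 2 + x^2 / 4 \<and>
     (\<Sum>a\<in>{1..<c}. of_nat a ^ 4) = x^5 / 5 - x^4 / 2 + x^3 / 3 - x / 30 \<and>
     (\<Sum>a\<in>{1..<c}. of_nat a ^ 5) = x^6 / 6 - x^5 / 2 + 5 * x^4 / 12 - x^2 / 12 \<and>
     (\<Sum>a\<in>{1..<c}. of_nat a ^ 6) = x^7 / 7 - x^6 / 2 + x^5 / 2 - x^3 / 6 + x / 42"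
    unfolding x_def using assms(2)
  proof (induction c rule: dec_induct)
    case base
    show ?case by simp
  next
    case (step n)
    let ?y = "of_nat n :: complex"
    have p2: "(?y + 1)^2 = ?y^2 + 2 * ?y + 1"
      by (simp add: power2_eq_square algebra_simps)
    have p3: "(?y + 1)^3 = ?y^3 + 3 * ?y^2 + 3 * ?y + 1"
      using p2 by (simp add: eval_nat_numeral algebra_simps)
    have p4: "(?y + 1)^4 = ?y^4 + 4 * ?y^3 + 6 * ?y^2 + 4 * ?y + 1"
      unfolding power_Suc[of "?y + 1" 3, simplified] p3 by (simp add: eval_nat_numeral algebra_simps)
    have p5: "(?y + 1)^5 = ?y^5 + 5 * ?y^4 + 10 * ?y^3 + 10 * ?y^2 + 5 * ?y + 1"
      unfolding power_Suc[of "?y + 1" 4, simplified] p4 by (simp add: eval_nat_numeral algebra_simps)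
    have p6: "(?y + 1)^6 = ?y^6 + 6 * ?y^5 + 15 * ?y^4 + 20 * ?y^3 + 15 * ?y^2 + 6 * ?y + 1"
      unfolding power_Suc[of "?y + 1" 5, simplified] p5 by (simp add: eval_nat_numeral algebra_simps)
    have p7: "(?y + 1)^7 = ?y^7 + 7 * ?y^6 + 21 * ?y^5 + 35 * ?y^4 + 35 * ?y^3 + 21 * ?y^2 + 7 * ?y + 1"
      unfolding power_Suc[of "?y + 1" 6, simplified] p6 by (simp add: eval_nat_numeral algebra_simps)
    have S: "of_nat (Suc n) = ?y + 1" by simp
    have I: "(\<Sum>a\<in>{1..<Suc n}. f a) = (\<Sum>a\<in>{1..<n}. f a) + f n" for f :: "nat \<Rightarrow> complex"
      using step.hyps by (simp add: sum.atLeastLessThan_Suc)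
    note ih = step.IH[THEN conjunct1]
      step.IH[THEN conjunct2, THEN conjunct1]
      step.IH[THEN conjunct2, THEN conjunct2, THEN conjunct1]
      step.IH[THEN conjunct2, THEN conjunct2, THEN conjunct2, THEN conjunct1]
      step.IH[THEN conjunct2, THEN conjunct2, THEN conjunct2, THEN conjunct2, THEN conjunct1]
      step.IH[THEN conjunct2, THEN conjunct2, THEN conjunct2, THEN conjunct2, THEN conjunct2, THEN conjunct1]
      step.IH[THEN conjunct2, THEN conjunct2, THEN conjunct2, THEN conjunct2, THEN conjunct2, THEN conjunct2]
    show ?case
      unfolding I S p2 p3 p4 p5 p6 p7 ih by (simp add: field_simps)
  qed
  then show "(\<Sum>a\<in>{1..<c}. 1) = x - 1" "(\<Sum>a\<in>{1..<c}. of_nat a) = (x^2 - x) / 2"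
     "(\<Sum>a\<in>{1..<c}. of_nat a ^ 2) = x^3 / 3 - x^2 / 2 + x / 6"
     "(\<Sum>a\<in>{1..<c}. of_nat a ^ 3) = x^4 / 4 - x^3 / 2 + x^2 / 4"
     "(\<Sum>a\<in>{1..<c}. of_nat a ^ 4) = x^5 / 5 - x^4 / 2 + x^3 / 3 - x / 30"
     "(\<Sum>a\<in>{1..<c}. of_nat a ^ 5) = x^6 / 6 - x^5 / 2 + 5 * x^4 / 12 - x^2 / 12"
     "(\<Sum>a\<in>{1..<c}. of_nat a ^ 6) = x^7 / 7 - x^6 / 2 + x^5 / 2 - x^3 / 6 + x / 42"
    by blast+
qed
text \<open>For \<open>b = c - a\<close> the summands are powers of \<open>a * b\<close>; the forms
  below reduce to such powers because a^2 + a b + b^2 = c^2 - a b.\<close>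

lemma sum_products:
  fixes c :: nat
  defines "x \<equiv> of_nat c :: complex"
  assumes "c \<ge> 1"
  shows "(\<Sum>a\<in>{1..<c}. of_nat a * (x - of_nat a)) = (x^3 - x) / 6"
    and "(\<Sum>a\<in>{1..<c}. (of_nat a * (x - of_nat a))^2) = (x^5 - x) / 30"
    and "(\<Sum>a\<in>{1..<c}. (of_nat a * (x - of_nat a))^3) = x^7 / 140 + x^3 / 60 - x / 42"
proof -
  note s = sum_of_nat_powers[OF assms(2), folded x_def]
  have "(\<Sum>a\<in>{1..<c}. of_nat a * (x - of_nat a)) =
     (\<Sum>a\<in>{1..<c}. x * of_nat a - of_nat a ^ 2)"
    by (simp add: algebra_simps power2_eq_square)
  also have "\<dots> = (x^3 - x) / 6"
    unfolding sum_subtractf sum_distrib_left[symmetric] s by (simp add: field_simps eval_nat_numeral)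
  finally show "(\<Sum>a\<in>{1..<c}. of_nat a * (x - of_nat a)) = (x^3 - x) / 6" .
  have "(\<Sum>a\<in>{1..<c}. (of_nat a * (x - of_nat a))^2) =
     (\<Sum>a\<in>{1..<c}. x^2 * of_nat a ^ 2 - 2 * x * of_nat a ^ 3 + 1 * of_nat a ^ 4)"
    by (intro sum.cong) (auto simp: algebra_simps eval_nat_numeral)
  also have "\<dots> = (x^5 - x) / 30"
    unfolding sum_subtractf sum.distrib sum_distrib_left[symmetric] s by (simp add: field_simps eval_nat_numeral)
  finally show "(\<Sum>a\<in>{1..<c}. (of_nat a * (x - of_nat a))^2) = (x^5 - x) / 30" .
  have "(\<Sum>a\<in>{1..<c}. (of_nat a * (x - of_nat a))^3) =
     (\<Sum>a\<in>{1..<c}. x^3 * of_nat a ^ 3 - 3 * x^2 * of_nat a ^ 4 + 3 * x * of_nat a ^ 5 - 1 * of_nat a ^ 6)"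
    by (intro sum.cong) (auto simp: algebra_simps eval_nat_numeral)
  also have "\<dots> = x^7 / 140 + x^3 / 60 - x / 42"
    unfolding sum_subtractf sum.distrib sum_distrib_left[symmetric] s by (simp add: field_simps eval_nat_numeral)
  finally show "(\<Sum>a\<in>{1..<c}. (of_nat a * (x - of_nat a))^3) = x^7 / 140 + x^3 / 60 - x / 42" .
qed

text \<open>Half of a^2 + b^2 + (a + b)^2, hence invariant under permutations of a, b and -(a + b).
  This is what \<open>lambert_product_identity\<close> asks for: the form and its expression in
  \<open>a\<close> and \<open>a + b\<close> are both symmetric, and powers inherit this.\<close>

definition sq_form :: "nat \<Rightarrow> nat \<Rightarrow> complex" where
  "sq_form a b = of_nat a ^ 2 + of_nat a * of_nat b + of_nat b ^ 2"

definition sq_form' :: "nat \<Rightarrow> nat \<Rightarrow> complex" where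
  "sq_form' a b = of_nat a ^ 2 - of_nat a * of_nat b + of_nat b ^ 2"

lemma sq_form_props:
  "sq_form a b = sq_form b a" "sq_form' a b = sq_form' b a" "sq_form a b = sq_form' a (a + b)"
  "sq_form' a a = of_nat a ^ 2"
  by (auto simp: sq_form_def sq_form'_def algebra_simps power2_eq_square)

lemma poly_bounded_sq_form: "poly_bounded sq_form" "poly_bounded sq_form'"
  unfolding sq_form_def [abs_def] sq_form'_def [abs_def] by (intro poly_bounded_intros)+

lemma sq_form_sum_args:
  assumes "a \<in> {1..<c}"
  shows "sq_form a (c - a) = of_nat c ^ 2 - of_nat a * (of_nat c - of_nat a)"
  using assms by (auto simp: sq_form_def of_nat_diff algebra_simps power2_eq_square)

lemma has_sum_finite_sum:
  fixes f :: "'i \<Rightarrow> 'a \<Rightarrow> complex"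
  assumes "finite I" "\<And>i. i \<in> I \<Longrightarrow> (f i has_sum s i) A"
  shows "((\<lambda>x. \<Sum>i\<in>I. f i x) has_sum (\<Sum>i\<in>I. s i)) A"
  using assms by (induction I rule: finite_induct) (auto intro!: has_sum_add)

text \<open>A polynomial in \<open>c\<close> is encoded as a finite set of pairs (exponent,
  coefficient), so that its Lambert sum is read off monomial by monomial.\<close>

lemma infsum_Phi_combination:
  fixes f :: "nat \<Rightarrow> complex"
  assumes "norm q < 1" "finite I" "\<And>c. c \<ge> 1 \<Longrightarrow> f c = (\<Sum>(k, x)\<in>I. x * of_nat c ^ k)"
  shows "(\<Sum>\<^sub>\<infinity>c\<in>{1..}. f c * lam q c) = (\<Sum>(k, x)\<in>I. x * Phi k q)"
proof -
  have "((\<lambda>c. \<Sum>(k, x)\<in>I. x * (of_nat c ^ k * lam q c)) has_sum (\<Sum>(k, x)\<in>I. x * Phi k q)) {1..}"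
    unfolding case_prod_unfold Phi_def
    by (intro has_sum_finite_sum has_sum_cmult_right has_sum_infsum Phi_summable assms(1,2))
  then have "((\<lambda>c. f c * lam q c) has_sum (\<Sum>(k, x)\<in>I. x * Phi k q)) {1..}"
    by (rule has_sum_cong[THEN iffD1, rotated])
       (auto simp: assms(3) sum_distrib_right case_prod_unfold mult.assoc)
  then show ?thesis by (rule infsumI)
qed

lemma pair_sum_Phi_combination:
  assumes "norm q < 1" "finite I" "\<And>a b. f a b = (\<Sum>(i, j, x)\<in>I. x * (of_nat a ^ i * of_nat b ^ j))"
  shows "(\<Sum>\<^sub>\<infinity>(a, b)\<in>pos_pairs. f a b * (lam q a * lam q b)) = (\<Sum>(i, j, x)\<in>I. x * (Phi i q * Phi j q))"
proof -
  have *: "((\<lambda>(a, b). of_nat a ^ i * of_nat b ^ j * (lam q a * lam q b)) has_sum Phi i q * Phi j q) pos_pairs" for i j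
  proof -
    have "poly_bounded (\<lambda>a b. of_nat a ^ i * of_nat b ^ j)" by (intro poly_bounded_intros)
    from has_sum_infsum[OF pair_sums_summable(1)[OF assms(1) this]] show ?thesis
      unfolding Phi_mult[OF assms(1)] .
  qed
  have "((\<lambda>y. \<Sum>z\<in>I. case z of (i, j, x) \<Rightarrow> x * (case y of (a, b) \<Rightarrow> of_nat a ^ i * of_nat b ^ j * (lam q a * lam q b)))
    has_sum (\<Sum>(i, j, x)\<in>I. x * (Phi i q * Phi j q))) pos_pairs"
    unfolding case_prod_unfold
    by (intro has_sum_finite_sum has_sum_cmult_right *[unfolded case_prod_unfold] assms(2))
  then have "((\<lambda>(a, b). f a b * (lam q a * lam q b)) has_sum (\<Sum>(i, j, x)\<in>I. x * (Phi i q * Phi j q))) pos_pairs"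
    by (rule has_sum_cong[THEN iffD1, rotated])
       (auto simp: assms(3) sum_distrib_right case_prod_unfold mult.assoc)
  then show ?thesis by (rule infsumI)
qed

text \<open>\<open>I\<close> lists the monomials of \<open>g - p\<close> and \<open>C\<close> those of the convolution sum of \<open>g\<close>.\<close>

lemma Phi_derivative_formula:
  fixes g p :: "nat \<Rightarrow> nat \<Rightarrow> complex"
  assumes q: "norm q < 1" and fin: "finite I" "finite C"
    and form: "poly_bounded g" "poly_bounded p" "\<And>a b. g a b = g b a" "\<And>a b. p a b = p b a"
      "\<And>a b. g a b = p a (a + b)" "\<And>a. p a a = of_nat a ^ Suc j"
    and gp: "\<And>a b. g a b - p a b = (\<Sum>(k, l, x)\<in>I. x * (of_nat a ^ k * of_nat b ^ l))"
    and conv: "\<And>c. c \<ge> 1 \<Longrightarrow> (\<Sum>a\<in>{1..<c}. g a (c - a)) = (\<Sum>(k, x)\<in>C. x * of_nat c ^ k)"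
  obtains D where "(Phi j has_field_derivative D) (at q)"
    "q * D = Phi (Suc j) q + ((\<Sum>(k, x)\<in>C. x * Phi k q) - (\<Sum>(k, l, x)\<in>I. x * (Phi k q * Phi l q)))"
proof -
  obtain D where D: "(Phi j has_field_derivative D) (at q)"
    "q * D = Phi (Suc j) q + (\<Sum>\<^sub>\<infinity>n\<in>{1..}. of_nat n ^ Suc j * lam q n ^ 2)"
    using Phi_has_field_derivative[OF q] .
  have C: "(\<Sum>\<^sub>\<infinity>c\<in>{1..}. (\<Sum>a\<in>{1..<c}. g a (c - a)) * lam q c) = (\<Sum>(k, x)\<in>C. x * Phi k q)"
    by (rule infsum_Phi_combination[OF q fin(2) conv])
  have I: "(\<Sum>\<^sub>\<infinity>(a, b)\<in>pos_pairs. (g a b - p a b) * (lam q a * lam q b)) = (\<Sum>(k, l, x)\<in>I. x * (Phi k q * Phi l q))"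
    by (rule pair_sum_Phi_combination[OF q fin(1) gp])
  have "x = P + (A - U)" if "x = P + T" "U = A - T" for x P A T U :: complex
    using that by simp
  from this[OF D(2) lambert_product_identity[OF q form, unfolded C I]] D(1) show thesis
    by (intro that)
qed

section \<open>Ramanujan's equations in the variable q\<close>

text \<open>The entry \<open>(2, -1)\<close> stems from the number \<open>c - 1\<close> of summands
  and cancels the term \<open>Phi 2\<close> of the derivative formula, so that only odd indices
  remain. In terms of Eisenstein series this is q dE2/dq = (E2^2 - E4) / 12.\<close>

lemma Phi_1_derivative:
  assumes q: "norm q < 1"
  obtains D where "(Phi 1 has_field_derivative D) (at q)"
    "q * D = 5 / 6 * Phi 3 q + Phi 1 q / 6 - 2 * Phi 1 q ^ 2"
proof -
  have conv: "(\<Sum>a\<in>{1..<c}. sq_form a (c - a)) = (\<Sum>(k, x)\<in>{(3, 5 / 6), (2, -1), (1, 1 / 6)}. x * of_nat c ^ k)"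
    if "c \<ge> 1" for c
  proof -
    let ?x = "of_nat c :: complex"
    have "(\<Sum>a\<in>{1..<c}. sq_form a (c - a)) = (\<Sum>a\<in>{1..<c}. ?x^2 * 1 - of_nat a * (?x - of_nat a))"
      by (intro sum.cong) (auto simp: sq_form_sum_args)
    also have "\<dots> = ?x ^ 2 * (?x - 1) - (?x ^ 3 - ?x) / 6"
      unfolding sum_subtractf sum_distrib_left[symmetric] sum_of_nat_powers(1)[OF that] sum_products(1)[OF that] ..
    also have "\<dots> = (\<Sum>(k, x)\<in>{(3, 5 / 6), (2, -1), (1, 1 / 6)}. x * ?x ^ k)"
      by (simp add: field_simps eval_nat_numeral)
    finally show ?thesis .
  qed
  have gp: "sq_form a b - sq_form' a b = (\<Sum>(k, l, x)\<in>{(1, 1, 2)}. x * (of_nat a ^ k * of_nat b ^ l))" for a b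
    by (simp add: sq_form_def sq_form'_def)
  obtain D where "(Phi 1 has_field_derivative D) (at q)"
    "q * D = Phi (Suc 1) q + ((\<Sum>(k, x)\<in>{(3, 5 / 6), (2, -1), (1, 1 / 6)}. x * Phi k q) - (\<Sum>(k, l, x)\<in>{(1, 1, 2)}. x * (Phi k q * Phi l q)))"
    by (rule Phi_derivative_formula[OF q _ _ poly_bounded_sq_form sq_form_props(1-3) _ gp conv])
       (auto simp: sq_form_props(4) power2_eq_square)
  then show thesis by (intro that[of D]) (simp_all add: power2_eq_square numeral_2_eq_2)
qed

text \<open>The square of the form has the diagonal value \<open>a ^ 4\<close> needed for index 3,
  and \<open>(4, -1)\<close> cancels \<open>Phi 4\<close>. The result amounts to q dE4/dq = (E2 E4 -
  E6) / 3.\<close>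

lemma Phi_3_derivative:
  assumes q: "norm q < 1"
  obtains D where "(Phi 3 has_field_derivative D) (at q)"
    "q * D = 7 / 10 * Phi 5 q + Phi 3 q / 3 - Phi 1 q / 30 - 8 * Phi 1 q * Phi 3 q"
proof -
  define g where "g = (\<lambda>a b. sq_form a b ^ 2)"
  define p where "p = (\<lambda>a b. sq_form' a b ^ 2)"
  have conv: "(\<Sum>a\<in>{1..<c}. g a (c - a)) = (\<Sum>(k, x)\<in>{(5, 7 / 10), (4, -1), (3, 1 / 3), (1, - 1 / 30)}. x * of_nat c ^ k)"
    if "c \<ge> 1" for c
  proof -
    let ?x = "of_nat c :: complex"
    have "(\<Sum>a\<in>{1..<c}. g a (c - a)) = (\<Sum>a\<in>{1..<c}. ?x^4 * 1 - 2 * ?x^2 * (of_nat a * (?x - of_nat a))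
       + (of_nat a * (?x - of_nat a))^2)"
      by (intro sum.cong) (auto simp: g_def sq_form_sum_args power2_diff simp flip: power_mult)
    also have "\<dots> = ?x ^ 4 * (?x - 1) - 2 * ?x^2 * ((?x ^ 3 - ?x) / 6) + (?x ^ 5 - ?x) / 30"
      unfolding sum_subtractf sum.distrib sum_distrib_left[symmetric] sum_of_nat_powers(1)[OF that] sum_products[OF that] ..
    also have "\<dots> = (\<Sum>(k, x)\<in>{(5, 7 / 10), (4, -1), (3, 1 / 3), (1, - 1 / 30)}. x * ?x ^ k)"
      by (simp add: field_simps flip: power_Suc power_add)
    finally show ?thesis .
  qed
  have gp: "g a b - p a b = (\<Sum>(k, l, x)\<in>{(1, 3, 4), (3, 1, 4)}. x * (of_nat a ^ k * of_nat b ^ l))" for a b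
  proof -
    define x y :: complex where "x = of_nat a" and "y = of_nat b"
    have sf: "sq_form a b = (x^2 + y^2) + x * y" "sq_form' a b = (x^2 + y^2) - x * y"
      by (simp_all add: sq_form_def sq_form'_def x_def y_def)
    have "g a b - p a b = ((x^2 + y^2) + x * y)^2 - ((x^2 + y^2) - x * y)^2"
      unfolding g_def p_def sf ..
    also have "\<dots> = 4 * (x * y^3) + 4 * (x^3 * y)"
      by (simp add: eval_nat_numeral algebra_simps)
    finally show ?thesis by (simp add: x_def y_def)
  qed
  obtain D where "(Phi 3 has_field_derivative D) (at q)"
    "q * D = Phi (Suc 3) q + ((\<Sum>(k, x)\<in>{(5, 7 / 10), (4, -1), (3, 1 / 3), (1, - 1 / 30)}. x * Phi k q) - (\<Sum>(k, l, x)\<in>{(1, 3, 4), (3, 1, 4)}. x * (Phi k q * Phi l q)))"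
  proof (rule Phi_derivative_formula[OF q _ _ _ _ _ _ _ _ gp conv])
    show "poly_bounded g" "poly_bounded p"
      unfolding g_def p_def by (intro poly_bounded_intros poly_bounded_sq_form)+
    show "g a b = g b a" "p a b = p b a" for a b
      unfolding g_def p_def sq_form_props(1)[of a b] sq_form_props(2)[of a b] by (rule refl)+
    show "g a b = p a (a + b)" for a b
      unfolding g_def p_def sq_form_props(3)[of a b] ..
    show "p a a = of_nat a ^ Suc 3" for a
      unfolding p_def sq_form_props(4) by (simp flip: power_mult)
  qed auto
  then show thesis by (intro that[of D]) (simp_all add: power2_eq_square)
qed

text \<open>Two admissible forms of degree 6 exist; the coefficient \<open>249/14\<close> is chosen
  to cancel the term in \<open>Phi 7\<close>.\<close>

lemma Phi_5_derivative:
  assumes q: "norm q < 1"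
  obtains D where "(Phi 5 has_field_derivative D) (at q)"
    "q * D = Phi 5 q / 2 + 10 / 21 * Phi 3 q + Phi 1 q / 42 - 12 * Phi 1 q * Phi 5 q + 400 / 7 * Phi 3 q ^ 2"
proof -
  define g where "g = (\<lambda>a b. sq_form a b ^ 3 - 249 / 14 * (of_nat a * of_nat b * (of_nat a + of_nat b)) ^ 2)"
  define p where "p = (\<lambda>a b. sq_form' a b ^ 3 - 249 / 14 * (of_nat a * of_nat b * (of_nat a - of_nat b)) ^ 2)"
  have conv: "(\<Sum>a\<in>{1..<c}. g a (c - a)) = (\<Sum>(k, x)\<in>{(5, 1 / 2), (6, -1), (3, 10 / 21), (1, 1 / 42)}. x * of_nat c ^ k)"
    if "c \<ge> 1" for c
  proof -
    let ?x = "of_nat c :: complex"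
    have "(\<Sum>a\<in>{1..<c}. g a (c - a)) = (\<Sum>a\<in>{1..<c}. ?x^6 * 1 - 3 * ?x^4 * (of_nat a * (?x - of_nat a))
       + 3 * ?x^2 * (of_nat a * (?x - of_nat a))^2 - (of_nat a * (?x - of_nat a))^3
       - 249 / 14 * ?x^2 * (of_nat a * (?x - of_nat a))^2)"
    proof (intro sum.cong refl)
      fix a assume a: "a \<in> {1..<c}"
      then have "of_nat (c - a) = ?x - of_nat a" by (simp add: of_nat_diff)
      moreover have "(X^2 - Y)^3 = X^6 - 3 * X^4 * Y + 3 * X^2 * Y^2 - Y^3" for X Y :: complex
        by (simp add: eval_nat_numeral algebra_simps)
      ultimately show "g a (c - a) = ?x^6 * 1 - 3 * ?x^4 * (of_nat a * (?x - of_nat a))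
       + 3 * ?x^2 * (of_nat a * (?x - of_nat a))^2 - (of_nat a * (?x - of_nat a))^3
       - 249 / 14 * ?x^2 * (of_nat a * (?x - of_nat a))^2"
        unfolding g_def sq_form_sum_args[OF a] by (simp add: power_mult_distrib mult_ac)
    qed
    \<comment> \<open>In the coefficient of \<open>?x ^ 7\<close> the sq_form part contributes 1 -
      1/2 + 1/10 - 1/140 = 83/140, which equals 249/14 times 1/30.\<close>
    also have "\<dots> = ?x ^ 6 * (?x - 1) - 3 * ?x^4 * ((?x ^ 3 - ?x) / 6) + 3 * ?x^2 * ((?x ^ 5 - ?x) / 30)
       - (?x^7 / 140 + ?x^3 / 60 - ?x / 42) - 249 / 14 * ?x^2 * ((?x ^ 5 - ?x) / 30)"
      unfolding sum_subtractf sum.distrib sum_distrib_left[symmetric] sum_of_nat_powers(1)[OF that] sum_products[OF that] ..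
    also have "\<dots> = (\<Sum>(k, x)\<in>{(5, 1 / 2), (6, -1), (3, 10 / 21), (1, 1 / 42)}. x * ?x ^ k)"
      by (simp add: field_simps flip: power_Suc power_add)
    finally show ?thesis .
  qed
  have gp: "g a b - p a b = (\<Sum>(k, l, x)\<in>{(1, 5, 6), (5, 1, 6), (3, 3, - 400 / 7)}. x * (of_nat a ^ k * of_nat b ^ l))" for a b
  proof -
    define x y :: complex where "x = of_nat a" and "y = of_nat b"
    have sf: "sq_form a b = (x^2 + y^2) + x * y" "sq_form' a b = (x^2 + y^2) - x * y"
      by (simp_all add: sq_form_def sq_form'_def x_def y_def)
    have regroup: "A - c * B - (A' - c * B') = A - A' - c * (B - B')" for A B A' B' c :: complex
      by (simp add: algebra_simps)
    have "g a b - p a b = ((x^2 + y^2) + x * y)^3 - ((x^2 + y^2) - x * y)^3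
        - 249 / 14 * ((x * y * (x + y))^2 - (x * y * (x - y))^2)"
      unfolding g_def p_def sf x_def[symmetric] y_def[symmetric] by (rule regroup)
    also have "((x^2 + y^2) + x * y)^3 - ((x^2 + y^2) - x * y)^3 = 6 * (x^2 + y^2)^2 * (x * y) + 2 * (x * y)^3"
      by (simp add: eval_nat_numeral algebra_simps)
    also have "(x * y * (x + y))^2 - (x * y * (x - y))^2 = 4 * (x * y)^3"
      by (simp add: eval_nat_numeral algebra_simps)
    also have "6 * (x^2 + y^2)^2 * (x * y) + 2 * (x * y)^3 - 249 / 14 * (4 * (x * y)^3)
        = 6 * (x * y^5) + 6 * (x^5 * y) + - 400 / 7 * (x^3 * y^3)"
    proof -
      have "(x^2 + y^2)^2 * (x * y) = x * y^5 + x^5 * y + 2 * (x * y)^3"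
        by (simp add: eval_nat_numeral algebra_simps)
      moreover have "6 * U * V + 2 * Z - 249 / 14 * (4 * Z) = 6 * A + 6 * B + - 400 / 7 * Z"
        if "U * V = A + B + 2 * Z" for A B Z U V :: complex
        unfolding mult.assoc that by (simp add: field_simps)
      ultimately show ?thesis unfolding power_mult_distrib[of x y 3, symmetric] by blast
    qed
    finally show ?thesis by (simp add: x_def y_def)
  qed
  obtain D where "(Phi 5 has_field_derivative D) (at q)"
    "q * D = Phi (Suc 5) q + ((\<Sum>(k, x)\<in>{(5, 1 / 2), (6, -1), (3, 10 / 21), (1, 1 / 42)}. x * Phi k q) - (\<Sum>(k, l, x)\<in>{(1, 5, 6), (5, 1, 6), (3, 3, - 400 / 7)}. x * (Phi k q * Phi l q)))"
  proof (rule Phi_derivative_formula[OF q _ _ _ _ _ _ _ _ gp conv])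
    show "poly_bounded g" "poly_bounded p"
      unfolding g_def p_def by (intro poly_bounded_intros poly_bounded_sq_form)+
    show "g a b = g b a" for a b
      unfolding g_def sq_form_props(1)[of a b] by (simp add: mult.commute add.commute)
    show "p a b = p b a" for a b
      unfolding p_def sq_form_props(2)[of a b] by (simp add: mult.commute power_mult_distrib power2_commute)
    show "g a b = p a (a + b)" for a b
      unfolding g_def p_def sq_form_props(3)[of a b] by (simp add: mult_ac)
    show "p a a = of_nat a ^ Suc 5" for a
      unfolding p_def by (simp add: sq_form_props flip: power_mult)
  qed auto
  then show thesis by (intro that[of D]) (simp_all add: power2_eq_square)
qed

section \<open>Eisenstein series on the upper half-plane\<close>

lemma norm_nome_less_1: "z \<in> \<H> \<Longrightarrow> norm (nome z) < 1"
  by (simp add: nome_def upper_half_plane_def)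

lemma nome_nonzero: "nome z \<noteq> 0"
  by (simp add: nome_def)

lemma has_field_derivative_nome: "(nome has_field_derivative 2 * of_real pi * \<i> * nome z) (at z)"
  unfolding nome_def [abs_def] by (auto intro!: derivative_eq_intros)

lemma open_upper_half_plane: "open \<H>"
  unfolding upper_half_plane_def by (rule open_halfspace_Im_gt)

lemma convex_upper_half_plane: "convex \<H>"
  unfolding upper_half_plane_def by (rule convex_halfspace_Im_gt)

definition E2 :: "complex \<Rightarrow> complex" where
  "E2 z = 1 - 24 * Phi 1 (nome z)"

lemma Phi_suminf:
  assumes "norm q < 1"
  shows "(\<Sum>n. let m = Suc n in of_nat m ^ j * q ^ m / (1 - q ^ m)) = Phi j q"
  using sums_unique[OF Phi_sums[OF assms, of j]] by (simp add: lam_def Let_def)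

lemma E4_eq_Phi: "z \<in> \<H> \<Longrightarrow> E4 z = 1 + 240 * Phi 3 (nome z)"
  unfolding E4_def by (subst Phi_suminf) (auto intro: norm_nome_less_1)

lemma E6_eq_Phi: "z \<in> \<H> \<Longrightarrow> E6 z = 1 - 504 * Phi 5 (nome z)"
  unfolding E6_def by (subst Phi_suminf) (auto intro: norm_nome_less_1)

lemma Phi_nome_derivative:
  assumes "(Phi j has_field_derivative D) (at (nome z))"
  shows "((\<lambda>z. Phi j (nome z)) has_field_derivative 2 * of_real pi * \<i> * (nome z * D)) (at z)"
  using DERIV_chain2[OF assms has_field_derivative_nome] by (simp add: mult_ac)

lemma has_field_derivative_E2:
  assumes z: "z \<in> \<H>"
  shows "(E2 has_field_derivative 2 * of_real pi * \<i> * ((E2 z ^ 2 - E4 z) / 12)) (at z)"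
proof -
  obtain D where D: "(Phi 1 has_field_derivative D) (at (nome z))"
    "nome z * D = 5 / 6 * Phi 3 (nome z) + Phi 1 (nome z) / 6 - 2 * Phi 1 (nome z) ^ 2"
    using Phi_1_derivative[OF norm_nome_less_1[OF z]] .
  show ?thesis
    unfolding E2_def [abs_def] E4_eq_Phi[OF z]
    by (rule derivative_eq_intros Phi_nome_derivative[OF D(1), unfolded D(2)] refl)+
       (simp add: field_simps power2_eq_square)
qed

lemma has_field_derivative_E4:
  assumes z: "z \<in> \<H>"
  shows "(E4 has_field_derivative 2 * of_real pi * \<i> * ((E2 z * E4 z - E6 z) / 3)) (at z)"
proof -
  obtain D where D: "(Phi 3 has_field_derivative D) (at (nome z))"
    "nome z * D = 7 / 10 * Phi 5 (nome z) + Phi 3 (nome z) / 3 - Phi 1 (nome z) / 30 - 8 * Phi 1 (nome z) * Phi 3 (nome z)"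
    using Phi_3_derivative[OF norm_nome_less_1[OF z]] .
  have "((\<lambda>z. 1 + 240 * Phi 3 (nome z)) has_field_derivative 2 * of_real pi * \<i> * ((E2 z * E4 z - E6 z) / 3)) (at z)"
    unfolding E2_def E4_eq_Phi[OF z] E6_eq_Phi[OF z]
    by (rule derivative_eq_intros Phi_nome_derivative[OF D(1), unfolded D(2)] refl)+
       (simp add: field_simps power2_eq_square)
  then show ?thesis
    by (rule has_field_derivative_transform_within_open[OF _ open_upper_half_plane z]) (simp add: E4_eq_Phi)
qed

lemma has_field_derivative_E6:
  assumes z: "z \<in> \<H>"
  shows "(E6 has_field_derivative 2 * of_real pi * \<i> * ((E2 z * E6 z - E4 z ^ 2) / 2)) (at z)"
proof -
  obtain D where D: "(Phi 5 has_field_derivative D) (at (nome z))"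
    "nome z * D = Phi 5 (nome z) / 2 + 10 / 21 * Phi 3 (nome z) + Phi 1 (nome z) / 42
      - 12 * Phi 1 (nome z) * Phi 5 (nome z) + 400 / 7 * Phi 3 (nome z) ^ 2"
    using Phi_5_derivative[OF norm_nome_less_1[OF z]] .
  have "((\<lambda>z. 1 - 504 * Phi 5 (nome z)) has_field_derivative 2 * of_real pi * \<i> * ((E2 z * E6 z - E4 z ^ 2) / 2)) (at z)"
    unfolding E2_def E4_eq_Phi[OF z] E6_eq_Phi[OF z]
    by (rule derivative_eq_intros Phi_nome_derivative[OF D(1), unfolded D(2)] refl)+
       (simp add: field_simps power2_eq_square)
  then show ?thesis
    by (rule has_field_derivative_transform_within_open[OF _ open_upper_half_plane z]) (simp add: E6_eq_Phi)
qed

lemma holomorphic_Eisenstein: "E2 holomorphic_on \<H>" "E4 holomorphic_on \<H>" "E6 holomorphic_on \<H>"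
  unfolding holomorphic_on_def field_differentiable_def
  using has_field_derivative_E2 has_field_derivative_E4 has_field_derivative_E6 has_field_derivative_at_within
  by blast+

section \<open>Nonvanishing of the discriminant\<close>

text \<open>The q-expansion begins with 1728 q. Every \<open>q\<close> in the punctured unit disc is
  a nome, taken at \<open>Ln q / (2 * \<pi> * \<i>)\<close>, so vanishing on \<H> would contradict
  the derivative at \<open>q = 0\<close>.\<close>

lemma discriminant_not_identically_0: "\<exists>z\<in>\<H>. E4 z ^ 3 - E6 z ^ 2 \<noteq> 0"
proof (rule ccontr)
  assume "\<not> ?thesis"
  then have *: "E4 z ^ 3 - E6 z ^ 2 = 0" if "z \<in> \<H>" for z using that by auto
  define d where "d = (\<lambda>q. (1 + 240 * Phi 3 q) ^ 3 - (1 - 504 * Phi 5 q) ^ 2)"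
  \<comment> \<open>3 * 240 + 2 * 504 = 1728.\<close>
  have "(d has_field_derivative 1728) (at 0)"
    unfolding d_def
    by (rule derivative_eq_intros Phi_derivative_0 refl)+ (simp add: Phi_0)
  then have "((\<lambda>q. (d q - d 0) / (q - 0)) \<longlongrightarrow> 1728) (at 0)"
    unfolding has_field_derivative_iff .
  then have lim: "((\<lambda>q. d q / q) \<longlongrightarrow> 1728) (at 0)"
    by (simp add: d_def Phi_0)
  have "d q = 0" if q: "q \<noteq> 0" "norm q < 1" for q
  proof -
    define z where "z = Ln q / (2 * of_real pi * \<i>)"
    have nz: "nome z = q" using q by (simp add: nome_def z_def)
    have "Re (Ln q) < 0" using q by simp
    then have "z \<in> \<H>"
      by (simp add: z_def upper_half_plane_def Im_divide divide_simps power2_eq_square mult_less_0_iff)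
    then show ?thesis using *[of z] nz by (simp add: E4_eq_Phi E6_eq_Phi d_def)
  qed
  then have "eventually (\<lambda>q. d q / q = 0) (at 0)"
    unfolding eventually_at by (intro exI[of _ 1]) auto
  then have "((\<lambda>q. d q / q) \<longlongrightarrow> 0) (at 0)"
    by (rule tendsto_eventually)
  with lim show False using tendsto_unique[OF at_neq_bot] by force
qed

text \<open>The discriminant satisfies the linear equation \<open>f' = 2 \<pi> \<i> E2 f\<close>, so a single zero
  would make it vanish identically.\<close>

lemma discriminant_nonzero:
  assumes z: "z \<in> \<H>"
  shows "E4 z ^ 3 - E6 z ^ 2 \<noteq> 0"
proof
  assume z0: "E4 z ^ 3 - E6 z ^ 2 = 0"
  have "(\<lambda>z. 2 * of_real pi * \<i> * E2 z) holomorphic_on \<H>"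
    by (intro holomorphic_intros holomorphic_Eisenstein)
  then obtain g where g: "\<And>x. x \<in> \<H> \<Longrightarrow> (g has_field_derivative 2 * of_real pi * \<i> * E2 x) (at x within \<H>)"
    using holomorphic_convex_primitive'[OF convex_upper_half_plane open_upper_half_plane] by blast
  define f where "f = (\<lambda>x. (E4 x ^ 3 - E6 x ^ 2) * exp (- g x))"
  have "(f has_field_derivative 0) (at x within \<H>)" if x: "x \<in> \<H>" for x
    unfolding f_def
    by (rule derivative_eq_intros g[OF x] has_field_derivative_E4[OF x, THEN has_field_derivative_at_within]
          has_field_derivative_E6[OF x, THEN has_field_derivative_at_within] refl)+
       (simp add: field_simps eval_nat_numeral)
  then obtain c where c: "\<And>x. x \<in> \<H> \<Longrightarrow> f x = c"
    using has_field_derivative_zero_constant[OF convex_upper_half_plane] by metis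
  have "c = 0" using c[OF z] z0 by (simp add: f_def)
  then show False using c discriminant_not_identically_0 by (auto simp: f_def)
qed

lemma E4_nonzero_if_E6_zero: "z \<in> \<H> \<Longrightarrow> E6 z = 0 \<Longrightarrow> E4 z \<noteq> 0"
  using discriminant_nonzero by fastforce

section \<open>The zero of \<open>E6\<close> at \<open>\<i>\<close>\<close>

definition powser :: "(nat \<Rightarrow> complex) \<Rightarrow> complex \<Rightarrow> complex" where
  "powser c x = (\<Sum>n. c n * x ^ n)"

lemma powser_derivative:
  assumes "\<And>x. norm x < R \<Longrightarrow> summable (\<lambda>n. c n * x ^ n)" "norm x < R"
  obtains D where "(powser c has_field_derivative D) (at x)" "x * D = powser (\<lambda>n. of_nat n * c n) x"
proof -
  have "(powser c has_field_derivative (\<Sum>n. diffs c n * x ^ n)) (at x)"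
    unfolding powser_def [abs_def] using assms by (rule termdiffs_strong')
  moreover have "(\<lambda>n. of_nat n * c n * x ^ n) sums (x * (\<Sum>n. diffs c n * x ^ n))"
  proof -
    have "summable (\<lambda>n. diffs c n * x ^ n)"
      using assms(2,1) by (rule termdiff_converges)
    from sums_mult[OF diffs_equiv[OF this], of x]
    have "(\<lambda>n. x * (of_nat n * c n * x ^ (n - Suc 0))) sums (x * (\<Sum>n. diffs c n * x ^ n))" .
    moreover have "x * (of_nat n * c n * x ^ (n - Suc 0)) = of_nat n * c n * x ^ n" for n
      by (cases n) auto
    ultimately show ?thesis by simp
  qed
  ultimately show thesis
    by (intro that) (auto simp: powser_def sums_iff)
qed

section \<open>Reflection formulas for polygamma functions\<close>

lemma not_nonpos_Int_if_notin_Ints: "z \<notin> \<int> \<Longrightarrow> z \<notin> \<int>\<^sub>\<le>\<^sub>0" "z \<notin> \<int> \<Longrightarrow> 1 - z \<notin> \<int>\<^sub>\<le>\<^sub>0"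
  by (auto dest: nonpos_Ints_Int)

lemma open_complement_Ints: "open (- \<int> :: complex set)"
  by (simp add: closed_Ints open_Compl)

lemma sin_pi_nonzero:
  fixes z :: complex
  assumes "z \<notin> \<int>"
  shows "sin (of_real pi * z) \<noteq> 0"
  using assms by (auto simp: sin_eq_0 mult.commute)

text \<open>Logarithmic derivative of Euler's formula Gamma(z) Gamma(1 - z) = \<pi> / sin(\<pi>
  z).\<close>

lemma Digamma_reflection:
  fixes z :: complex
  assumes z: "z \<notin> \<int>"
  shows "Digamma z - Digamma (1 - z) = - of_real pi * cot (of_real pi * z)"
proof -
  let ?s = "sin (of_real pi * z)"
  have s: "?s \<noteq> 0" by (rule sin_pi_nonzero[OF z])
  note nz = not_nonpos_Int_if_notin_Ints[OF z]
  have "((\<lambda>z. Gamma z * Gamma (1 - z)) has_field_derivative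
      (Gamma z * Gamma (1 - z) * (Digamma z - Digamma (1 - z)))) (at z)"
    using nz by (auto intro!: derivative_eq_intros simp: algebra_simps)
  moreover have "((\<lambda>z. Gamma z * Gamma (1 - z)) has_field_derivative
      (of_real pi / ?s * (- of_real pi * cot (of_real pi * z)))) (at z)"
    unfolding Gamma_reflection_complex using s
    by (auto intro!: derivative_eq_intros simp: cot_def field_simps)
  ultimately have "Gamma z * Gamma (1 - z) * (Digamma z - Digamma (1 - z)) =
      of_real pi / ?s * (- of_real pi * cot (of_real pi * z))"
    by (rule DERIV_unique)
  then show ?thesis unfolding Gamma_reflection_complex using s by (subst (asm) mult_left_cancel) simp_all
qed

lemma Polygamma_reflection_derivative:
  fixes z :: complex
  assumes z: "z \<notin> \<int>"
  shows "((\<lambda>z. Polygamma k z - (-1) ^ k * Polygamma k (1 - z)) has_field_derivative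
    (Polygamma (Suc k) z - (-1) ^ Suc k * Polygamma (Suc k) (1 - z))) (at z)"
  using not_nonpos_Int_if_notin_Ints[OF z]
  by (auto intro!: derivative_eq_intros DERIV_chain'[of "\<lambda>z. 1 - z"])

text \<open>Since cot' = -(1 + cot^2), the \<open>k\<close>-th derivative of cot is this polynomial
  evaluated at cot.\<close>

fun cot_deriv :: "nat \<Rightarrow> complex poly" where
  "cot_deriv 0 = [:0, 1:]"
| "cot_deriv (Suc k) = - [:1, 0, 1:] * pderiv (cot_deriv k)"

lemma Polygamma_reflection_cot:
  fixes z :: complex
  assumes z: "z \<notin> \<int>"
  shows "Polygamma k z - (-1) ^ k * Polygamma k (1 - z) =
    - (of_real pi ^ Suc k) * poly (cot_deriv k) (cot (of_real pi * z))"
  using z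
proof (induction k arbitrary: z)
  case 0
  then show ?case using Digamma_reflection by simp
next
  case (Suc k)
  let ?s = "sin (of_real pi * z)"
  have s: "?s \<noteq> 0" by (rule sin_pi_nonzero[OF Suc.prems])
  have c: "((\<lambda>z. cot (of_real pi * z)) has_field_derivative - of_real pi * (1 + cot (of_real pi * z) ^ 2)) (at z)"
  proof -
    have *: "- inverse (?s ^ 2) = - (1 + cot (of_real pi * z) ^ 2)"
      using s sin_cos_squared_add[of "of_real pi * z"]
      by (simp add: cot_def field_simps power2_eq_square)
    have "((\<lambda>z. of_real pi * z) has_field_derivative of_real pi) (at z)"
      by (auto intro!: derivative_eq_intros)
    from DERIV_chain2[where f = cot and g = "\<lambda>z. of_real pi * z", OF DERIV_cot[OF s] this]
    show ?thesis unfolding * by (rule DERIV_cong) (simp add: algebra_simps)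
  qed
  have "((\<lambda>z. - (of_real pi ^ Suc k) * poly (cot_deriv k) (cot (of_real pi * z))) has_field_derivative
     (- (of_real pi ^ Suc k) * (poly (pderiv (cot_deriv k)) (cot (of_real pi * z)) *
         (- of_real pi * (1 + cot (of_real pi * z) ^ 2))))) (at z)"
    by (intro DERIV_cmult DERIV_chain2[OF poly_DERIV c])
  also have "- (of_real pi ^ Suc k) * (poly (pderiv (cot_deriv k)) (cot (of_real pi * z)) *
         (- of_real pi * (1 + cot (of_real pi * z) ^ 2))) =
      - (of_real pi ^ Suc (Suc k)) * poly (cot_deriv (Suc k)) (cot (of_real pi * z))"
    by (simp add: algebra_simps power2_eq_square)
  finally have "((\<lambda>z. Polygamma k z - (-1) ^ k * Polygamma k (1 - z)) has_field_derivative
       - (of_real pi ^ Suc (Suc k)) * poly (cot_deriv (Suc k)) (cot (of_real pi * z))) (at z)"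
    by (rule has_field_derivative_transform_within_open[OF _ open_complement_Ints])
       (use Suc in auto)
  with Polygamma_reflection_derivative[OF Suc.prems] show ?case
    by (rule DERIV_unique)
qed

lemma notin_Ints_upper_half_plane: "z \<in> \<H> \<Longrightarrow> z \<notin> \<int>"
  by (auto simp: upper_half_plane_def elim!: Ints_cases)

text \<open>Exponential form of the cotangent, arranged so that its geometric expansion is a
  q-series.\<close>

lemma cot_upper_half_plane:
  assumes z: "z \<in> \<H>"
  shows "cot (of_real pi * z) = - \<i> * (2 / (1 - nome z) - 1)"
proof -
  define e where "e = exp (\<i> * (of_real pi * z))"
  have e: "e \<noteq> 0" "exp (- (\<i> * (of_real pi * z))) = 1 / e" "e * e = nome z"
    unfolding e_def nome_def by (auto simp: exp_minus field_simps simp flip: exp_add)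
  have q: "1 - nome z \<noteq> 0"
    using norm_nome_less_1[OF z] by auto
  have "cot (of_real pi * z) = \<i> * ((e + 1 / e) / (e - 1 / e))"
  proof -
    have "A / 2 / (B / (2 * \<i>)) = \<i> * (A / B)" for A B :: complex
      by (cases "B = 0") (auto simp: field_simps)
    then show ?thesis
      unfolding cot_def sin_exp_eq cos_exp_eq e_def[symmetric] minus_mult_left[symmetric] e(2) by blast
  qed
  also have "(e + 1 / e) / (e - 1 / e) = (nome z + 1) / (nome z - 1)"
    using e(1) q unfolding e(3)[symmetric] by (simp add: field_simps)
  also have "\<dots> = - (2 / (1 - nome z) - 1)"
    using q by (simp add: field_simps)
  finally show ?thesis by (simp add: algebra_simps)
qed

text \<open>Lipschitz's formula: for \<open>k \<ge> 1\<close> the left-hand side is, up to a factor,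
  the sum of 1 / (z + n)^(k + 1) over all integers n, and the right-hand side is its q-expansion.
  The constant 1 disappears with the first differentiation.\<close>

lemma Polygamma_reflection_powser:
  assumes z: "z \<in> \<H>"
  shows "Polygamma k z - (-1) ^ k * Polygamma k (1 - z) =
    of_real pi * \<i> * (2 * (2 * of_real pi * \<i>) ^ k * powser (\<lambda>n. of_nat n ^ k) (nome z) - (if k = 0 then 1 else 0))"
  using z
proof (induction k arbitrary: z)
  case 0
  have "powser (\<lambda>n. 1) (nome z) = 1 / (1 - nome z)"
    using geometric_sums[OF norm_nome_less_1[OF 0]] by (simp add: powser_def sums_iff)
  then show ?case
    using Digamma_reflection[OF notin_Ints_upper_half_plane[OF 0]] cot_upper_half_plane[OF 0]
    by simp
next
  case (Suc k)
  obtain D where D: "(powser (\<lambda>n. of_nat n ^ k) has_field_derivative D) (at (nome z))"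
    "nome z * D = powser (\<lambda>n. of_nat n * of_nat n ^ k) (nome z)"
    using powser_derivative[OF summable_of_nat_power_powser norm_nome_less_1[OF Suc.prems]] by blast
  have "((\<lambda>z. powser (\<lambda>n. of_nat n ^ k) (nome z)) has_field_derivative
       2 * of_real pi * \<i> * powser (\<lambda>n. of_nat n ^ Suc k) (nome z)) (at z)"
  proof (rule DERIV_cong[OF DERIV_chain2[OF D(1) has_field_derivative_nome]])
    have "powser (\<lambda>n. of_nat n ^ Suc k) (nome z) = nome z * D" by (simp add: D(2))
    then show "D * (2 * of_real pi * \<i> * nome z) = 2 * of_real pi * \<i> * powser (\<lambda>n. of_nat n ^ Suc k) (nome z)"
      by (simp only: mult_ac)
  qed
  from DERIV_cmult[OF DERIV_diff[OF DERIV_cmult[OF this, of "2 * (2 * of_real pi * \<i>) ^ k"]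
     DERIV_const[of "if k = 0 then 1 else 0"]], of "of_real pi * \<i>"]
  have "((\<lambda>z. of_real pi * \<i> * (2 * (2 * of_real pi * \<i>) ^ k * powser (\<lambda>n. of_nat n ^ k) (nome z) - (if k = 0 then 1 else 0)))
    has_field_derivative (of_real pi * \<i> * (2 * (2 * of_real pi * \<i>) ^ Suc k * powser (\<lambda>n. of_nat n ^ Suc k) (nome z)))) (at z)"
    by (simp add: mult_ac)
  then have "((\<lambda>z. Polygamma k z - (-1) ^ k * Polygamma k (1 - z)) has_field_derivative
       (of_real pi * \<i> * (2 * (2 * of_real pi * \<i>) ^ Suc k * powser (\<lambda>n. of_nat n ^ Suc k) (nome z)))) (at z)"
    by (rule has_field_derivative_transform_within_open[OF _ open_upper_half_plane Suc.prems])
       (rule Suc.IH[symmetric])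
  from DERIV_unique[OF Polygamma_reflection_derivative[OF notin_Ints_upper_half_plane[OF Suc.prems]] this]
  show ?case by (simp only: nat.distinct if_False diff_zero)
qed

section \<open>The value of the zeta function at 6\<close>

lemma Polygamma_5_sums:
  fixes z :: complex
  assumes "z \<noteq> 0"
  shows "(\<lambda>n. 1 / (z + of_nat n) ^ 6) sums (Polygamma 5 z / 120)"
  using summable_sums[OF Polygamma_converges'[OF assms, of 6]]
  by (simp add: Polygamma_def inverse_eq_divide fact_numeral)

definition zeta6 :: complex where "zeta6 = (\<Sum>\<^sub>\<infinity>n\<in>{1..}. 1 / of_nat n ^ 6)"

lemma inverse_power_6_summable_on: "(\<lambda>n. 1 / of_nat n ^ 6 :: complex) summable_on {1..}"
proof -
  have "summable (\<lambda>n. norm (1 / of_nat n ^ 6 :: complex))"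
    using inverse_power_summable[of 6, where ?'a = real]
    by (simp add: norm_divide norm_power inverse_eq_divide)
  from norm_summable_imp_summable_on[OF this] show ?thesis
    by (rule summable_on_subset_banach) simp
qed

text \<open>Even indices contribute \<open>zeta6 / 64\<close>, odd ones a multiple of
  \<open>Polygamma 5 (1 / 2)\<close>. The point 1/2 is fixed by z -> 1 - z and cot vanishes at \<pi>
  / 2, so the reflection formula evaluates that number.\<close>

lemma zeta6_eq: "zeta6 = of_real pi ^ 6 / 945"
proof -
  define f where "f = (\<lambda>n::nat. 1 / of_nat n ^ 6 :: complex)"
  define Od where "Od = (\<lambda>n. 2 * n + 1) ` (UNIV :: nat set)"
  define Ev where "Ev = (\<lambda>n. 2 * n) ` {1::nat..}"
  have S: "f summable_on A" if "A \<subseteq> {1..}" for A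
    using summable_on_subset_banach[OF inverse_power_6_summable_on that] unfolding f_def .
  have split: "{1..} = Od \<union> Ev"
  proof (intro equalityI subsetI)
    fix n :: nat assume "n \<in> {1..}"
    then show "n \<in> Od \<union> Ev"
      by (cases "even n") (auto simp: Od_def Ev_def elim!: evenE oddE)
  qed (auto simp: Od_def Ev_def)
  have disj: "Od \<inter> Ev = {}" unfolding Od_def Ev_def by (auto; presburger)
  have "zeta6 = infsum f Od + infsum f Ev"
    unfolding zeta6_def f_def[symmetric] split
    by (rule infsum_Un_disjoint[OF S S disj]) (use split in auto)
  also have "infsum f Ev = zeta6 / 64"
  proof -
    have "infsum f Ev = (\<Sum>\<^sub>\<infinity>n\<in>{1..}. (1 / 64) * (1 / of_nat n ^ 6))"
      unfolding Ev_def by (subst infsum_reindex) (auto simp: inj_on_def f_def o_def power_mult_distrib)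
    then show ?thesis unfolding infsum_cmult_right' zeta6_def by simp
  qed
  also have "infsum f Od = Polygamma 5 (1 / 2) / 120 / 64"
  proof -
    have "(\<lambda>n. 1 / (1 / 2 + of_nat n) ^ 6 / 64) sums (Polygamma 5 (1 / 2) / 120 / 64 :: complex)"
      by (intro sums_divide Polygamma_5_sums) simp
    moreover have "1 / (1 / 2 + of_nat n) ^ 6 / 64 = f (2 * n + 1)" for n
    proof -
      have "of_nat (2 * n + 1) = 2 * (1 / 2 + of_nat n :: complex)" by simp
      then show ?thesis unfolding f_def by (simp only: power_mult_distrib) simp
    qed
    ultimately have 1: "(\<lambda>n. f (2 * n + 1)) sums (Polygamma 5 (1 / 2) / 120 / 64)" by simp
    have "(f \<circ> (\<lambda>n. 2 * n + 1)) summable_on UNIV"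
      by (subst summable_on_reindex[symmetric]) (use S[of Od] split in \<open>auto simp: inj_on_def Od_def\<close>)
    then have "(\<lambda>n. f (2 * n + 1)) sums (\<Sum>\<^sub>\<infinity>n. f (2 * n + 1))"
      by (intro has_sum_imp_sums has_sum_infsum) (simp add: o_def)
    then have "(\<Sum>\<^sub>\<infinity>n. f (2 * n + 1)) = Polygamma 5 (1 / 2) / 120 / 64"
      using 1 sums_unique2 by blast
    then show ?thesis
      unfolding Od_def by (subst infsum_reindex) (auto simp: inj_on_def o_def)
  qed
  also have "Polygamma 5 (1 / 2) = 8 * (of_real pi ^ 6 :: complex)"
  proof -
    have "(1 / 2 :: complex) \<notin> \<int>"
    proof
      assume "(1 / 2 :: complex) \<in> \<int>"
      then obtain k where "1 / 2 = (of_int k :: complex)" by (auto elim: Ints_cases)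
      then have "of_int (2 * k) = (of_int 1 :: complex)" by (simp add: field_simps)
      then have "2 * k = 1" by (simp only: of_int_eq_iff)
      then show False by presburger
    qed
    from Polygamma_reflection_cot[OF this, of 5]
    have "2 * Polygamma 5 (1 / 2) = - (of_real pi ^ 6) * poly (cot_deriv 5) (cot (of_real pi / 2) :: complex)"
      by simp
    moreover have "cot (of_real pi / 2) = (0 :: complex)"
      by (simp add: cot_def)
    moreover have "poly (cot_deriv 5) 0 = - 16"
    proof -
      have "cot_deriv (Suc 0) = [:-1, 0, -1:]" by (simp add: pderiv_pCons)
      then have "cot_deriv (Suc (Suc 0)) = [:0, 2, 0, 2:]" by (simp add: pderiv_pCons)
      then have "cot_deriv (Suc (Suc (Suc 0))) = [:-2, 0, -8, 0, -6:]" by (simp add: pderiv_pCons)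
      then have "cot_deriv 4 = [:0, 16, 0, 40, 0, 24:]" by (simp add: pderiv_pCons eval_nat_numeral)
      moreover have "cot_deriv 5 = - [:1, 0, 1:] * pderiv (cot_deriv 4)" by (simp add: eval_nat_numeral)
      ultimately show ?thesis by (simp add: pderiv_pCons)
    qed
    ultimately show ?thesis by simp
  qed
  finally show ?thesis by (simp add: field_simps)
qed

section \<open>The lattice sum over the Gaussian integers\<close>

text \<open>The points \<open>m * \<i> + n\<close> and \<open>m * \<i> - n\<close> with positive
  \<open>m\<close> and \<open>n\<close> represent all Gaussian integers off the axes up to sign, and
  the even exponent ignores the sign.\<close>

definition lat :: "nat \<Rightarrow> nat \<Rightarrow> complex" where
  "lat m n = 1 / (of_nat m * \<i> + of_nat n) ^ 6 + 1 / (of_nat m * \<i> - of_nat n) ^ 6"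

lemma lat_antisym: "lat n m = - lat m n"
proof -
  have "(of_nat n * \<i> + of_nat m) ^ 6 = (\<i> * (of_nat n - of_nat m * \<i>)) ^ 6"
    by (simp add: algebra_simps)
  also have "\<dots> = - ((of_nat m * \<i> - of_nat n) ^ 6)"
    unfolding power_mult_distrib by (simp add: eval_nat_numeral algebra_simps)
  finally have 1: "(of_nat n * \<i> + of_nat m) ^ 6 = - ((of_nat m * \<i> - of_nat n :: complex) ^ 6)" .
  have "(of_nat n * \<i> - of_nat m) ^ 6 = (\<i> * (of_nat n + of_nat m * \<i>)) ^ 6"
    by (simp add: algebra_simps)
  also have "\<dots> = - ((of_nat m * \<i> + of_nat n) ^ 6)"
    unfolding power_mult_distrib by (simp add: eval_nat_numeral algebra_simps)
  finally have 2: "(of_nat n * \<i> - of_nat m) ^ 6 = - ((of_nat m * \<i> + of_nat n :: complex) ^ 6)" .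
  show ?thesis unfolding lat_def 1 2 by simp
qed

text \<open>From 2 m n \<le> m^2 + n^2 = |z|^2 one obtains a bound that splits into a factor for
  \<open>m\<close> and one for \<open>n\<close>, hence a majorant of product form.\<close>

lemma norm_lat_le:
  assumes "m \<ge> 1" "n \<ge> 1"
  shows "norm (lat m n) \<le> 2 * (1 / real m ^ 2 * (1 / real n ^ 2))"
proof -
  have mn: "real m * real n \<ge> 1" using assms by (metis mult_mono' of_nat_0_le_iff of_nat_1 of_nat_le_iff mult_1 zero_le_one)
  have *: "norm (1 / z ^ 6) \<le> 1 / real m ^ 2 * (1 / real n ^ 2)"
    if "norm z ^ 2 = real m ^ 2 + real n ^ 2" for z :: complex
  proof -
    have "real m * real n \<le> 2 * (real m * real n)" using mn by simp
    also have "\<dots> \<le> real m ^ 2 + real n ^ 2"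
      using sum_squares_bound[of "real m" "real n"] by simp
    finally have "(real m * real n) ^ 3 \<le> (norm z ^ 2) ^ 3"
      unfolding that by (intro power_mono) auto
    moreover have "(real m * real n) ^ 2 \<le> (real m * real n) ^ 3"
      using mn by (intro power_increasing) auto
    ultimately have "(real m * real n) ^ 2 \<le> norm z ^ 6"
      by (simp flip: power_mult)
    moreover have "(real m * real n) ^ 2 > 0" using assms by simp
    ultimately have "1 / norm z ^ 6 \<le> 1 / (real m * real n) ^ 2"
      by (intro frac_le) auto
    then show ?thesis by (simp add: norm_divide norm_power power_mult_distrib)
  qed
  have "norm (1 / (of_nat m * \<i> + of_nat n :: complex) ^ 6) \<le> 1 / real m ^ 2 * (1 / real n ^ 2)"
       "norm (1 / (of_nat m * \<i> - of_nat n :: complex) ^ 6) \<le> 1 / real m ^ 2 * (1 / real n ^ 2)"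
    by (intro *; simp add: cmod_power2)+
  then show ?thesis
    unfolding lat_def using norm_triangle_ineq[of "1 / (of_nat m * \<i> + of_nat n) ^ 6" "1 / (of_nat m * \<i> - of_nat n) ^ 6"]
    by linarith
qed

lemma lat_summable: "(\<lambda>(m, n). lat m n) summable_on pos_pairs"
proof (rule Infinite_Sum.abs_summable_summable, rule Infinite_Sum.abs_summable_on_comparison_test')
  have "(\<lambda>n. 1 / real n ^ 2) summable_on UNIV"
    using inverse_power_summable[of 2, where ?'a = real]
    by (intro norm_summable_imp_summable_on) (simp add: inverse_eq_divide)
  then have "(\<lambda>n. 1 / real n ^ 2) summable_on {1..}"
    by (rule summable_on_subset_banach) simp
  from summable_on_cmult_right[OF summable_on_pos_pairs_product[OF this], of 2]
  show "(\<lambda>x. 2 * (case x of (m, n) \<Rightarrow> 1 / real m ^ 2 * (1 / real n ^ 2))) summable_on pos_pairs"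
    by simp
  show "norm (case x of (m, n) \<Rightarrow> lat m n) \<le> 2 * (case x of (m, n) \<Rightarrow> 1 / real m ^ 2 * (1 / real n ^ 2))"
    if "x \<in> pos_pairs" for x
    using that norm_lat_le by auto
qed

text \<open>Multiplication by \<open>\<i>\<close> permutes the lattice and changes the sign of the summands.\<close>

lemma lat_infsum_0: "(\<Sum>\<^sub>\<infinity>(m, n)\<in>pos_pairs. lat m n) = 0"
proof -
  have bij: "bij_betw (\<lambda>(a, b). (b, a)) pos_pairs pos_pairs"
    by (rule bij_betwI[where g = "\<lambda>(a, b). (b, a)"]) auto
  have "(\<Sum>\<^sub>\<infinity>(m, n)\<in>pos_pairs. lat m n) = (\<Sum>\<^sub>\<infinity>(m, n)\<in>pos_pairs. lat n m)"
    using infsum_reindex_bij_betw[OF bij, of "\<lambda>(m, n). lat m n"] by (simp add: case_prod_unfold)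
  also have "\<dots> = (\<Sum>\<^sub>\<infinity>(m, n)\<in>pos_pairs. - lat m n)"
    by (rule infsum_cong) (auto intro: lat_antisym)
  also have "\<dots> = - (\<Sum>\<^sub>\<infinity>(m, n)\<in>pos_pairs. lat m n)"
    by (simp add: case_prod_unfold infsum_uminus)
  finally show ?thesis by simp
qed

text \<open>A full row over all integers n is given by Lipschitz's formula at
  \<open>m * \<i>\<close>. Leaving out n = 0 accounts for \<open>1 / m ^ 6\<close>, as
  \<open>\<i> ^ 6 = -1\<close>.\<close>

lemma lat_row_sum:
  assumes m: "m \<ge> 1"
  shows "(\<Sum>\<^sub>\<infinity>n\<in>{1..}. lat m n) = 1 / of_nat m ^ 6 - 8 * of_real pi ^ 6 / 15 * (\<Sum>\<^sub>\<infinity>d\<in>{1..}. of_nat d ^ 5 * (nome \<i> ^ m) ^ d)"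
proof -
  define z where "z = of_nat m * \<i>"
  have z: "z \<in> \<H>" "z \<noteq> 0" "1 - z \<noteq> 0" "1 + z \<noteq> 0"
    using m by (auto simp: z_def upper_half_plane_def complex_eq_iff)
  have nz: "nome z = nome \<i> ^ m"
    unfolding nome_def z_def by (simp add: mult_ac flip: exp_of_nat_mult)
  have "(\<lambda>n. lat m (Suc n)) sums (Polygamma 5 (1 + z) / 120 + Polygamma 5 (1 - z) / 120)"
  proof -
    have "(\<lambda>n. 1 / (1 + z + of_nat n) ^ 6 + 1 / (1 - z + of_nat n) ^ 6) sums (Polygamma 5 (1 + z) / 120 + Polygamma 5 (1 - z) / 120)"
      by (intro sums_add Polygamma_5_sums z)
    moreover have "1 / (1 + z + of_nat n) ^ 6 + 1 / (1 - z + of_nat n) ^ 6 = lat m (Suc n)" for n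
    proof -
      have "(1 - z + of_nat n) ^ 6 = (z - of_nat (Suc n)) ^ 6"
        using power_minus_even[of 6 "z - of_nat (Suc n)"] by (simp add: algebra_simps)
      then show ?thesis by (simp add: lat_def z_def[symmetric] add_ac)
    qed
    ultimately show ?thesis by simp
  qed
  moreover have "(\<lambda>n. lat m (Suc n)) sums (\<Sum>\<^sub>\<infinity>n\<in>{1..}. lat m n)"
  proof -
    have "(\<lambda>n. lat m n) summable_on {1..}"
      using summable_on_SigmaD1[of "\<lambda>m n. lat m n" "{1..}" "\<lambda>_. {1..}" m] lat_summable m by auto
    then show ?thesis
      by (intro has_sum_imp_sums has_sum_Suc_iff[THEN iffD2] has_sum_infsum)
  qed
  ultimately have "(\<Sum>\<^sub>\<infinity>n\<in>{1..}. lat m n) = (Polygamma 5 (z + 1) + Polygamma 5 (1 - z)) / 120"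
    using sums_unique2 by (fastforce simp: add.commute add_divide_distrib)
  \<comment> \<open>The shift splits off the term of index 0, so that the arguments \<open>z\<close>
    and \<open>1 - z\<close> match the reflection formula.\<close>
  also have "Polygamma 5 (z + 1) = Polygamma 5 z - 120 / z ^ 6"
    using Polygamma_plus1[OF z(2), of 5] by (simp add: fact_numeral)
  also have "z ^ 6 = - (of_nat m ^ 6)"
    by (simp add: z_def power_mult_distrib)
  also have "Polygamma 5 z - 120 / - (of_nat m ^ 6) + Polygamma 5 (1 - z) =
      120 / of_nat m ^ 6 + of_real pi * \<i> * (2 * (2 * of_real pi * \<i>) ^ 5 * powser (\<lambda>n. of_nat n ^ 5) (nome z))"
    using Polygamma_reflection_powser[OF z(1), of 5] by simp
  \<comment> \<open>The numerical factor is 2 * 2^5 * \<i>^6 = -64; divided by 5! = 120 it becomes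
    -8/15.\<close>
  also have "of_real pi * \<i> * (2 * (2 * of_real pi * \<i>) ^ 5 * powser (\<lambda>n. of_nat n ^ 5) (nome z)) =
      - 64 * of_real pi ^ 6 * powser (\<lambda>n. of_nat n ^ 5) (nome z)"
  proof -
    have "\<i> ^ 5 = \<i>" "of_real pi ^ 6 = of_real pi * (of_real pi ^ 5 :: complex)"
      by (simp_all add: eval_nat_numeral)
    moreover have "a * \<i> * (2 * (2 ^ 5 * p * \<i>) * W) = - 64 * (a * p) * W" for a p W :: complex
      by (simp add: algebra_simps)
    ultimately show ?thesis unfolding power_mult_distrib by metis
  qed
  also have "powser (\<lambda>n. of_nat n ^ 5) (nome z) = (\<Sum>\<^sub>\<infinity>d\<in>{1..}. of_nat d ^ 5 * (nome \<i> ^ m) ^ d)"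
  proof -
    have "(\<lambda>n. of_nat n ^ 5 * nome z ^ n) summable_on UNIV"
      using of_nat_power_powser_norm_summable_on[OF norm_nome_less_1[OF z(1)]]
      by (rule Infinite_Sum.abs_summable_summable)
    then have "powser (\<lambda>n. of_nat n ^ 5) (nome z) = (\<Sum>\<^sub>\<infinity>d. of_nat d ^ 5 * nome z ^ d)"
      unfolding powser_def using has_sum_imp_sums[OF has_sum_infsum] sums_unique by metis
    also have "\<dots> = (\<Sum>\<^sub>\<infinity>d\<in>{1..}. of_nat d ^ 5 * nome z ^ d)"
      by (rule infsum_cong_neutral) (auto simp: not_le)
    finally show ?thesis unfolding nz .
  qed
  finally show ?thesis by (simp add: add_divide_distrib diff_divide_distrib)
qed

text \<open>Adding up the rows of the vanishing lattice sum and exchanging the order of summation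
  gives 0 = zeta(6) - 8 \<pi>^6 / 15 * Phi 5, and 8 * 945 = 15 * 504.\<close>

lemma Phi_5_nome_i: "Phi 5 (nome \<i>) = 1 / 504"
proof -
  define q where "q = nome \<i>"
  have q: "norm q < 1" "q \<noteq> 0"
    unfolding q_def by (auto intro!: norm_nome_less_1 simp: upper_half_plane_def nome_nonzero)
  have S: "(\<lambda>(m, d). of_nat d ^ 5 * (q ^ m) ^ d) summable_on pos_pairs"
  proof (rule Infinite_Sum.abs_summable_summable, rule norm_summable_on_pos_pairs[of "\<lambda>a b. of_nat b ^ 5" "norm q" "1 / norm q"])
    fix a b :: nat assume ab: "a \<ge> 1" "b \<ge> 1"
    \<comment> \<open>That is, (a - 1) (b - 1) is nonnegative. The spare factor
      \<open>1 / norm q\<close> turns the exponent \<open>a * b\<close> into a majorant of product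
      form.\<close>
    have "a * b + 1 \<ge> a + b" using ab by (cases a; cases b) auto
    then have "norm q ^ (a * b + 1) \<le> norm q ^ (a + b)"
      using q by (intro power_decreasing) auto
    then have "norm ((q ^ a) ^ b) \<le> 1 / norm q * (norm q ^ a * norm q ^ b)"
      using q by (simp add: field_simps norm_power power_add flip: power_mult)
    from mult_left_mono[OF this, of "real b ^ 5"]
    show "norm (case (a, b) of (m, d) \<Rightarrow> of_nat d ^ 5 * (q ^ m) ^ d) \<le> 1 / norm q * norm (of_nat b ^ 5 :: complex) * (norm q ^ a * norm q ^ b)"
      by (simp add: norm_mult norm_power mult_ac)
  qed (use q in \<open>auto intro!: poly_bounded_intros\<close>)
  have "0 = (\<Sum>\<^sub>\<infinity>m\<in>{1..}. \<Sum>\<^sub>\<infinity>n\<in>{1..}. lat m n)"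
    using infsum_Sigma'_banach[OF lat_summable] lat_infsum_0 by simp
  also have "\<dots> = (\<Sum>\<^sub>\<infinity>m\<in>{1..}. 1 / of_nat m ^ 6 + (- 8 * of_real pi ^ 6 / 15) * (\<Sum>\<^sub>\<infinity>d\<in>{1..}. of_nat d ^ 5 * (q ^ m) ^ d))"
    by (rule infsum_cong, subst lat_row_sum) (simp_all add: q_def)
  also have "\<dots> = zeta6 + (- 8 * of_real pi ^ 6 / 15) * (\<Sum>\<^sub>\<infinity>m\<in>{1..}. \<Sum>\<^sub>\<infinity>d\<in>{1..}. of_nat d ^ 5 * (q ^ m) ^ d)"
  proof -
    let ?B = "\<lambda>m. \<Sum>\<^sub>\<infinity>d\<in>{1..}. of_nat d ^ 5 * (q ^ m) ^ d"
    have "?B summable_on {1..}" by (rule summable_on_Sigma_banach[OF S])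
    then have "(\<lambda>m. (- 8 * of_real pi ^ 6 / 15) * ?B m) summable_on {1..}"
      by (rule summable_on_cmult_right)
    from infsum_add[OF inverse_power_6_summable_on this] show ?thesis
      unfolding infsum_cmult_right' zeta6_def .
  qed
  also have "(\<Sum>\<^sub>\<infinity>m\<in>{1..}. \<Sum>\<^sub>\<infinity>d\<in>{1..}. of_nat d ^ 5 * (q ^ m) ^ d) = (\<Sum>\<^sub>\<infinity>d\<in>{1..}. \<Sum>\<^sub>\<infinity>m\<in>{1..}. of_nat d ^ 5 * (q ^ m) ^ d)"
    by (rule infsum_swap_banach[OF S])
  also have "\<dots> = Phi 5 q"
    unfolding Phi_def
  proof (rule infsum_cong)
    fix d :: nat assume d: "d \<in> {1..}"
    then have qd: "norm (q ^ d) < 1" using q by (simp add: norm_power power_less_one_iff)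
    have "((\<lambda>m. (q ^ d) ^ m) has_sum (q ^ d / (1 - q ^ d))) {1..}"
    proof -
      have "(\<lambda>m. of_nat m ^ 0 * (q ^ d) ^ m) summable_on {1..}"
        by (rule Infinite_Sum.abs_summable_summable[OF of_nat_power_powser_norm_summable_on[OF qd]])
      then have 1: "((\<lambda>m. (q ^ d) ^ m) has_sum (infsum (\<lambda>m. (q ^ d) ^ m) {1..})) {1..}"
        by (intro has_sum_infsum) simp
      have "(\<lambda>m. (q ^ d) ^ Suc m) sums (infsum (\<lambda>m. (q ^ d) ^ m) {1..})"
        by (rule has_sum_imp_sums[OF has_sum_Suc_iff[THEN iffD2, OF 1]])
      moreover have "(\<lambda>m. (q ^ d) ^ Suc m) sums (q ^ d / (1 - q ^ d))"
        using sums_mult[OF geometric_sums[OF qd], of "q ^ d"] by simp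
      ultimately have "infsum (\<lambda>m. (q ^ d) ^ m) {1..} = q ^ d / (1 - q ^ d)"
        by (rule sums_unique2)
      with 1 show ?thesis by simp
    qed
    moreover have "(\<Sum>\<^sub>\<infinity>m\<in>{1..}. of_nat d ^ 5 * (q ^ m) ^ d) = (\<Sum>\<^sub>\<infinity>m\<in>{1..}. of_nat d ^ 5 * (q ^ d) ^ m)"
      by (intro infsum_cong) (simp add: mult.commute flip: power_mult)
    ultimately show "(\<Sum>\<^sub>\<infinity>m\<in>{1..}. of_nat d ^ 5 * (q ^ m) ^ d) = of_nat d ^ 5 * lam q d"
      by (simp only: infsum_cmult_right' lam_def infsumI)
  qed
  finally have "of_real pi ^ 6 * (8 / 15 * Phi 5 q) = of_real pi ^ 6 * (1 / 945)"
    unfolding zeta6_eq by (simp add: field_simps)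
  then have "8 / 15 * Phi 5 q = 1 / 945"
    by (subst (asm) mult_left_cancel) simp_all
  then show ?thesis unfolding q_def by (simp add: field_simps)
qed

lemma i_in_upper_half_plane: "\<i> \<in> \<H>"
  by (simp add: upper_half_plane_def)

lemma E6_i: "E6 \<i> = 0"
  using E6_eq_Phi[OF i_in_upper_half_plane] Phi_5_nome_i by simp

section \<open>Logarithmic singularities on a slit disc\<close>

lemma slit_ball_mem_iff: "z \<in> slit_ball z0 e \<longleftrightarrow> z \<in> ball z0 e \<and> z - z0 \<notin> \<real>\<^sub>\<le>\<^sub>0"
  by (simp add: slit_ball_def)

lemma slit_ballD: "z \<in> slit_ball z0 e \<Longrightarrow> z \<in> ball z0 e" "z \<in> slit_ball z0 e \<Longrightarrow> z \<noteq> z0"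
  by (auto simp: slit_ball_def)

lemma slit_ball_subset: "e \<le> e' \<Longrightarrow> slit_ball z0 e \<subseteq> slit_ball z0 e'"
  by (auto simp: slit_ball_def)

lemma open_slit_ball: "open (slit_ball z0 e)"
proof -
  have "slit_ball z0 e = ball z0 e \<inter> (\<lambda>z. z - z0) -` (- \<real>\<^sub>\<le>\<^sub>0)"
    by (auto simp: slit_ball_def)
  moreover have "open ((\<lambda>z. z - z0) -` (- \<real>\<^sub>\<le>\<^sub>0))"
    by (intro open_vimage continuous_intros) (simp add: closed_nonpos_Reals_complex open_Compl)
  ultimately show ?thesis by (simp add: open_Int)
qed

text \<open>Star-shaped about \<open>z0 + e / 2\<close>: a segment from there can meet the slit only
  if its other end lies on it.\<close>

lemma connected_slit_ball: "connected (slit_ball z0 e)"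
proof (cases "e > 0")
  case True
  let ?a = "z0 + of_real (e / 2)"
  have a: "?a \<in> slit_ball z0 e"
    using True by (simp add: slit_ball_def dist_norm complex_nonpos_Reals_iff)
  have "closed_segment ?a z \<subseteq> slit_ball z0 e" if z: "z \<in> slit_ball z0 e" for z
  proof
    fix x assume x: "x \<in> closed_segment ?a z"
    then have 1: "x \<in> ball z0 e"
      using convex_ball[of z0 e] a z slit_ballD(1) closed_segment_subset by blast
    obtain u where u: "0 \<le> u" "u \<le> 1" "x = (1 - u) *\<^sub>R ?a + u *\<^sub>R z"
      using x by (auto simp: closed_segment_def)
    have x': "x - z0 = of_real ((1 - u) * (e / 2)) + of_real u * (z - z0)"
      using u(3) by (simp add: scaleR_conv_of_real algebra_simps)
    have "x - z0 \<notin> \<real>\<^sub>\<le>\<^sub>0"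
    proof (cases "u = 0")
      case True
      then show ?thesis using \<open>e > 0\<close> unfolding x' by (simp add: complex_nonpos_Reals_iff)
    next
      case False
      show ?thesis
      proof (cases "Im (z - z0) = 0")
        case True
        then have "Re (z - z0) > 0"
          using z by (auto simp: slit_ball_def complex_nonpos_Reals_iff)
        then have "(1 - u) * (e / 2) + u * Re (z - z0) > 0"
          using u False \<open>e > 0\<close> by (intro add_nonneg_pos mult_nonneg_nonneg mult_pos_pos) auto
        then show ?thesis unfolding x' complex_nonpos_Reals_iff by simp
      next
        case im: False
        then show ?thesis unfolding x' complex_nonpos_Reals_iff using False by simp
      qed
    qed
    with 1 show "x \<in> slit_ball z0 e" by (simp add: slit_ball_def)
  qed
  with a have "starlike (slit_ball z0 e)" unfolding starlike_def by blast
  then show ?thesis by (rule starlike_imp_connected)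
next
  case False
  then have "ball z0 e = {}" by (simp add: not_less)
  then have "slit_ball z0 e = {}" unfolding slit_ball_def by blast
  then show ?thesis by simp
qed

section \<open>Solutions and Wronskians\<close>

definition solves_on :: "complex set \<Rightarrow> (complex \<Rightarrow> complex) \<Rightarrow> (complex \<Rightarrow> complex) \<Rightarrow> (complex \<Rightarrow> complex) \<Rightarrow> bool" where
  "solves_on S Q y y' \<longleftrightarrow> (\<forall>z\<in>S. (y has_field_derivative y' z) (at z) \<and> (y' has_field_derivative Q z * y z) (at z))"

lemma solves_on_subset: "solves_on S Q y y' \<Longrightarrow> T \<subseteq> S \<Longrightarrow> solves_on T Q y y'"
  unfolding solves_on_def by blast

lemma solves_on_imp_local_solution:
  assumes "solves_on (slit_ball z0 e) Q y y'" "e > 0" "Q holomorphic_on ball z0 e - {z0}"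
  shows "local_solution Q z0 e y"
  unfolding local_solution_def
proof (intro conjI assms ballI)
  show "y holomorphic_on slit_ball z0 e"
    using assms(1) unfolding solves_on_def holomorphic_on_def field_differentiable_def
    using has_field_derivative_at_within by blast
  fix z assume z: "z \<in> slit_ball z0 e"
  have "eventually (\<lambda>w. w \<in> slit_ball z0 e) (nhds z)"
    using z open_slit_ball by (rule eventually_nhds_in_open[rotated])
  then have "eventually (\<lambda>w. deriv y w = y' w) (nhds z)"
    by eventually_elim (use assms(1) in \<open>auto simp: solves_on_def intro: DERIV_imp_deriv\<close>)
  then have "deriv (deriv y) z = deriv y' z"
    by (rule deriv_cong_ev) simp
  also have "\<dots> = Q z * y z"
    using assms(1) z by (auto simp: solves_on_def intro: DERIV_imp_deriv)
  finally show "(deriv ^^ 2) y z = Q z * y z"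
    by (simp add: numeral_2_eq_2)
qed

lemma local_solution_imp_solves_on:
  assumes "local_solution Q z0 e y"
  shows "solves_on (slit_ball z0 e) Q y (deriv y)"
  unfolding solves_on_def
proof
  fix z assume z: "z \<in> slit_ball z0 e"
  have y: "y holomorphic_on slit_ball z0 e" "(deriv ^^ 2) y z = Q z * y z"
    using assms z by (auto simp: local_solution_def)
  have "(deriv y has_field_derivative deriv (deriv y) z) (at z)"
    by (rule holomorphic_derivI[OF holomorphic_deriv[OF y(1) open_slit_ball] open_slit_ball z])
  then show "(y has_field_derivative deriv y z) (at z) \<and> (deriv y has_field_derivative Q z * y z) (at z)"
    using holomorphic_derivI[OF y(1) open_slit_ball z] y(2) by (simp add: numeral_2_eq_2)
qed

lemma wronskian_constant:
  assumes "open S" "connected S" "solves_on S Q u u'" "solves_on S Q v v'"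
  shows "\<exists>c. \<forall>z\<in>S. u z * v' z - u' z * v z = c"
proof -
  have *: "((\<lambda>z. u z * v' z - u' z * v z) has_field_derivative 0) (at z)" if "z \<in> S" for z
    using that assms(3,4) unfolding solves_on_def
    by (auto intro!: derivative_eq_intros simp: algebra_simps)
  then have "continuous_on S (\<lambda>z. u z * v' z - u' z * v z)"
    by (meson DERIV_isCont continuous_at_imp_continuous_on)
  from DERIV_zero_connected_constant[OF assms(2,1) finite.emptyI this] * show ?thesis
    by (metis Diff_empty)
qed

text \<open>Cramer's rule: the coefficients are quotients of Wronskians, which are constant because
  the equation has no first-order term.\<close>

lemma solutions_spanned:
  assumes S: "open S" "connected S" and u: "solves_on S Q u u'" and v: "solves_on S Q v v'" and y: "solves_on S Q y y'"
    and W: "z \<in> S" "u z * v' z - u' z * v z \<noteq> 0"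
  shows "\<exists>c d. \<forall>z\<in>S. y z = c * u z + d * v z"
proof -
  obtain w where w: "\<And>z. z \<in> S \<Longrightarrow> u z * v' z - u' z * v z = w"
    using wronskian_constant[OF S u v] by blast
  obtain c where c: "\<And>z. z \<in> S \<Longrightarrow> y z * v' z - y' z * v z = c"
    using wronskian_constant[OF S y v] by blast
  obtain d where d: "\<And>z. z \<in> S \<Longrightarrow> u z * y' z - u' z * y z = d"
    using wronskian_constant[OF S u y] by blast
  have "w \<noteq> 0" using w W by auto
  moreover have "y z * w = c * u z + d * v z" if "z \<in> S" for z
    unfolding c[OF that, symmetric] d[OF that, symmetric] w[OF that, symmetric] by (simp add: algebra_simps)
  ultimately have "\<forall>z\<in>S. y z = c / w * u z + d / w * v z"
    by (auto simp: field_simps)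
  then show ?thesis by blast
qed

section \<open>Boundary values on the slit\<close>

text \<open>\<open>Ln\<close> of a point close to the slit is \<open>Ln\<close> of the opposite
  point shifted by \<open>\<i> * \<pi>\<close> up to sign; the opposite point stays near the
  positive axis, where \<open>Ln\<close> is continuous.\<close>

lemma Ln_slit_limit:
  fixes \<sigma> :: real
  assumes "x > 0" "\<sigma> = 1 \<or> \<sigma> = - 1"
  shows "((\<lambda>t. Ln (- of_real x + \<i> * of_real (\<sigma> * t))) \<longlongrightarrow> of_real (ln x) + \<i> * (\<sigma> * pi)) (at_right 0)"
proof -
  have L: "isCont Ln (of_real x)" using assms by (intro continuous_at_Ln) (simp add: complex_nonpos_Reals_iff)
  have "((\<lambda>t::real. of_real x - \<i> * of_real (\<sigma> * t)) \<longlongrightarrow> of_real x - \<i> * of_real (\<sigma> * 0)) (at_right 0)"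
    by (intro tendsto_intros)
  then have "((\<lambda>t. Ln (of_real x - \<i> * of_real (\<sigma> * t)) + \<i> * (\<sigma> * pi)) \<longlongrightarrow> Ln (of_real x) + \<i> * (\<sigma> * pi)) (at_right 0)"
    by (intro tendsto_intros isCont_tendsto_compose[OF L]) simp
  moreover have "eventually (\<lambda>t. Ln (of_real x - \<i> * of_real (\<sigma> * t)) + \<i> * (\<sigma> * pi) = Ln (- of_real x + \<i> * of_real (\<sigma> * t))) (at_right 0)"
    unfolding eventually_at_right_field
  proof (intro exI[of _ 1] conjI allI impI)
    fix t :: real assume t: "t > 0" "t < 1"
    have "Ln (- (of_real x - \<i> * of_real (\<sigma> * t))) = Ln (of_real x - \<i> * of_real (\<sigma> * t)) + \<i> * (\<sigma> * pi)"
      using t assms by (subst Ln_minus) (auto simp: complex_eq_iff)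
    then show "Ln (of_real x - \<i> * of_real (\<sigma> * t)) + \<i> * (\<sigma> * pi) = Ln (- of_real x + \<i> * of_real (\<sigma> * t))"
      by simp
  qed simp
  ultimately show ?thesis
    using assms by (subst Ln_of_real[symmetric]) (auto intro: Lim_transform_eventually)
qed

lemma holomorphic_on_ball_isCont:
  "f holomorphic_on ball z0 e \<Longrightarrow> z \<in> ball z0 e \<Longrightarrow> isCont f z"
  using continuous_on_interior[OF holomorphic_on_imp_continuous_on] by (auto simp: interior_open)

lemma tendsto_along_slit:
  fixes z0 :: complex
  shows "((\<lambda>x. z0 - of_real x) \<longlongrightarrow> z0) (at_right 0)" "((\<lambda>x. z0 + of_real x) \<longlongrightarrow> z0) (at_right 0)"
  using tendsto_diff[OF tendsto_const[of z0] tendsto_of_real[OF tendsto_ident_at[of "0::real" "{0<..}"]]]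
    tendsto_add[OF tendsto_const[of z0] tendsto_of_real[OF tendsto_ident_at[of "0::real" "{0<..}"]]]
  by simp_all

text \<open>Comparing the two one-sided limits at a point of the slit replaces analytic continuation
  around \<open>z0\<close>.\<close>

lemma slit_jump:
  assumes hol: "f holomorphic_on ball z0 e" "g holomorphic_on ball z0 e" "F holomorphic_on ball z0 e"
    and eq: "\<And>z. z \<in> slit_ball z0 e \<Longrightarrow> (z - z0) powr b * (f z + g z * Ln (z - z0)) = F z"
    and x: "0 < x" "x < e"
  shows "exp (b * (of_real (ln x) + \<i> * pi)) * (f (z0 - of_real x) + g (z0 - of_real x) * (of_real (ln x) + \<i> * pi)) =
     exp (b * (of_real (ln x) - \<i> * pi)) * (f (z0 - of_real x) + g (z0 - of_real x) * (of_real (ln x) - \<i> * pi))"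
proof -
  have p: "z0 - of_real x \<in> ball z0 e" using x by (simp add: dist_norm)
  have cont: "isCont f (z0 - of_real x)" "isCont g (z0 - of_real x)" "isCont F (z0 - of_real x)"
    using hol p by (auto intro: holomorphic_on_ball_isCont)
  have lim: "exp (b * (of_real (ln x) + \<i> * (\<sigma> * pi))) * (f (z0 - of_real x) + g (z0 - of_real x) * (of_real (ln x) + \<i> * (\<sigma> * pi))) = F (z0 - of_real x)"
    if \<sigma>: "\<sigma> = 1 \<or> \<sigma> = - 1" for \<sigma> :: real
  proof -
    note L = Ln_slit_limit[OF x(1) \<sigma>]
    let ?w = "\<lambda>t. z0 - of_real x + \<i> * of_real (\<sigma> * t)"
    have "(?w \<longlongrightarrow> z0 - of_real x + \<i> * of_real (\<sigma> * 0)) (at_right 0)"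
      by (intro tendsto_intros)
    then have w: "(?w \<longlongrightarrow> z0 - of_real x) (at_right 0)" by simp
    have "((\<lambda>t. exp (b * Ln (- of_real x + \<i> * of_real (\<sigma> * t))) * (f (?w t) + g (?w t) * Ln (- of_real x + \<i> * of_real (\<sigma> * t)))) \<longlongrightarrow>
      exp (b * (of_real (ln x) + \<i> * (\<sigma> * pi))) * (f (z0 - of_real x) + g (z0 - of_real x) * (of_real (ln x) + \<i> * (\<sigma> * pi)))) (at_right 0)"
      by (intro tendsto_intros L isCont_tendsto_compose[OF cont(1) w] isCont_tendsto_compose[OF cont(2) w])
    moreover have "eventually (\<lambda>t. exp (b * Ln (- of_real x + \<i> * of_real (\<sigma> * t))) * (f (?w t) + g (?w t) * Ln (- of_real x + \<i> * of_real (\<sigma> * t))) = F (?w t)) (at_right 0)"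
    proof -
      have "eventually (\<lambda>t. ?w t \<in> ball z0 e) (at_right 0)"
        by (rule topological_tendstoD[OF w open_ball p])
      moreover have "eventually (\<lambda>t::real. t > 0) (at_right 0)"
        by (simp add: eventually_at_right_less)
      ultimately show ?thesis
      proof eventually_elim
        case (elim t)
        have s: "?w t \<in> slit_ball z0 e"
          using elim \<sigma> x by (auto simp: slit_ball_def complex_nonpos_Reals_iff)
        have d: "?w t - z0 = - of_real x + \<i> * of_real (\<sigma> * t)" by simp
        have E: "(?w t - z0) powr b = exp (b * Ln (?w t - z0))"
          using slit_ballD(2)[OF s] by (simp add: powr_def)
        show ?case by (rule eq[OF s, unfolded E, unfolded d])
      qed
    qed
    ultimately have "((\<lambda>t. F (?w t)) \<longlongrightarrow>
      exp (b * (of_real (ln x) + \<i> * (\<sigma> * pi))) * (f (z0 - of_real x) + g (z0 - of_real x) * (of_real (ln x) + \<i> * (\<sigma> * pi)))) (at_right 0)"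
      by (rule Lim_transform_eventually)
    moreover have "((\<lambda>t. F (?w t)) \<longlongrightarrow> F (z0 - of_real x)) (at_right 0)"
      by (rule isCont_tendsto_compose[OF cont(3) w])
    ultimately show ?thesis using tendsto_unique[OF trivial_limit_at_right_real] by blast
  qed
  show ?thesis
    using lim[of 1] lim[of "-1"] by simp
qed

text \<open>\<open>ln x\<close> has no finite limit at 0, which settles \<open>k = 0\<close>. For
  larger \<open>k\<close> the function vanishes at the centre, so a factor \<open>z - z0\<close> can
  be divided out.\<close>

lemma no_holomorphic_log:
  assumes "\<phi> holomorphic_on ball z0 r" "r > 0"
    and "\<And>x. 0 < x \<Longrightarrow> x < r \<Longrightarrow> \<phi> (z0 - of_real x) = (- of_real x) ^ k * (c - of_real (ln x))"
  shows False
  using assms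
proof (induction k arbitrary: \<phi>)
  have ev: "eventually (\<lambda>x::real. 0 < x \<and> x < r) (at_right 0)"
    using \<open>r > 0\<close> by (auto simp: eventually_at_right_field)
  {
    case (0 \<phi>)
    have "isCont \<phi> z0"
      using 0 by (auto intro: holomorphic_on_ball_isCont)
    then have "((\<lambda>x. \<phi> (z0 - of_real x)) \<longlongrightarrow> \<phi> z0) (at_right 0)"
      using tendsto_along_slit(1) by (rule isCont_tendsto_compose)
    moreover have "eventually (\<lambda>x. \<phi> (z0 - of_real x) = c - of_real (ln x)) (at_right 0)"
      using ev by eventually_elim (use 0 in simp)
    ultimately have "((\<lambda>x. c - of_real (ln x)) \<longlongrightarrow> \<phi> z0) (at_right 0)"
      by (rule Lim_transform_eventually)
    from tendsto_Re[OF this] have "((\<lambda>x. Re c - ln x) \<longlongrightarrow> Re (\<phi> z0)) (at_right 0)" by simp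
    from tendsto_diff[OF tendsto_const[of "Re c"] this]
    have "((\<lambda>x::real. ln x) \<longlongrightarrow> Re c - Re (\<phi> z0)) (at_right 0)" by simp
    then show False
      using not_tendsto_and_filterlim_at_infinity[OF trivial_limit_at_right_real]
        filterlim_at_bot_imp_at_infinity[OF ln_at_0] by blast
  next
    case (Suc k \<phi>)
    have "isCont \<phi> z0"
      using Suc.prems by (auto intro: holomorphic_on_ball_isCont)
    then have "((\<lambda>x. \<phi> (z0 - of_real x)) \<longlongrightarrow> \<phi> z0) (at_right 0)"
      using tendsto_along_slit(1) by (rule isCont_tendsto_compose)
    moreover have "eventually (\<lambda>x. \<phi> (z0 - of_real x) = (- of_real x) ^ Suc k * (c - of_real (ln x))) (at_right 0)"
      using ev by eventually_elim (use Suc.prems in simp)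
    ultimately have 1: "((\<lambda>x. (- of_real x) ^ Suc k * (c - of_real (ln x))) \<longlongrightarrow> \<phi> z0) (at_right 0)"
      by (rule Lim_transform_eventually)
    have "((\<lambda>x::real. x ^ Suc k) \<longlongrightarrow> 0) (at_right 0)" "((\<lambda>x::real. x ^ Suc k * ln x) \<longlongrightarrow> 0) (at_right 0)"
      by real_asymp+
    then have "((\<lambda>x. (- 1) ^ Suc k * (of_real (x ^ Suc k) * c - of_real (x ^ Suc k * ln x))) \<longlongrightarrow>
       (- 1) ^ Suc k * (of_real 0 * c - of_real 0)) (at_right 0)"
      by (intro tendsto_intros)
    moreover have "(- 1) ^ Suc k * (of_real (x ^ Suc k) * c - of_real (x ^ Suc k * ln x)) =
       (- of_real x) ^ Suc k * (c - of_real (ln x))" for x :: real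
      unfolding power_minus[of "of_real x"] by (simp add: algebra_simps)
    ultimately have "((\<lambda>x. (- of_real x) ^ Suc k * (c - of_real (ln x))) \<longlongrightarrow> 0) (at_right 0)"
      by simp
    with 1 have \<phi>0: "\<phi> z0 = 0"
      using tendsto_unique[OF trivial_limit_at_right_real] by blast
    define \<psi> where "\<psi> = (\<lambda>z. if z = z0 then deriv \<phi> z0 else (\<phi> z - \<phi> z0) / (z - z0))"
    have "\<psi> holomorphic_on ball z0 r"
      unfolding \<psi>_def using Suc.prems by (intro pole_lemma_open) auto
    moreover have "\<psi> (z0 - of_real x) = (- of_real x) ^ k * (c - of_real (ln x))" if "0 < x" "x < r" for x
      using Suc.prems(3)[OF that] that \<phi>0 by (simp add: \<psi>_def)
    ultimately show False using Suc.IH Suc.prems(2) by blast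
  }
qed

lemma holomorphic_zero_on_ball:
  assumes "g holomorphic_on ball z0 e" "0 < r" "r \<le> e" "\<And>x. 0 < x \<Longrightarrow> x < r \<Longrightarrow> g (z0 - of_real x) = 0" "z \<in> ball z0 e"
  shows "g z = 0"
proof (rule analytic_continuation[OF assms(1) open_ball connected_ball _ _ _ _ assms(5)])
  let ?U = "(\<lambda>x. z0 - of_real x) ` {0<..<r}"
  show "?U \<subseteq> ball z0 e" using assms by (auto simp: dist_norm)
  show "z0 \<in> ball z0 e" using assms by simp
  show "z0 islimpt ?U"
    unfolding islimpt_approachable
  proof (intro allI impI)
    fix d :: real assume d: "d > 0"
    define x where "x = min d r / 2"
    have "x > 0" "x < d" "x < r" using d assms by (auto simp: x_def)
    then have "z0 - of_real x \<in> ?U" "z0 - of_real x \<noteq> z0" "dist (z0 - of_real x) z0 < d"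
      by (auto simp: dist_norm)
    then show "\<exists>x'\<in>?U. x' \<noteq> z0 \<and> dist x' z0 < d" by blast
  qed
qed (use assms in auto)

text \<open>Across the slit the power is multiplied by \<open>M\<close> and \<open>Ln\<close> shifts
  by 2 \<pi> \<i>, whereas \<open>F\<close> is unchanged. For \<open>M = 1\<close> this leaves
  \<open>g = 0\<close> on the slit; otherwise \<open>f = g * (c - ln x)\<close> there, and a
  quotient of holomorphic functions would be a logarithm. The exponent \<open>b\<close> is arbitrary
  since the one in a logarithmic representation is.\<close>

lemma log_free_coefficient_zero:
  assumes hol: "f holomorphic_on ball z0 e" "g holomorphic_on ball z0 e" "F holomorphic_on ball z0 r"
    and re: "0 < r" "r \<le> e"
    and eq: "\<And>z. z \<in> slit_ball z0 r \<Longrightarrow> (z - z0) powr b * (f z + g z * Ln (z - z0)) = F z"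
    and z: "z \<in> ball z0 e"
  shows "g z = 0"
proof (rule ccontr)
  assume gz: "g z \<noteq> 0"
  have sub: "ball z0 r \<subseteq> ball z0 e" using re by auto
  define M where "M = exp (b * (2 * \<i> * pi))"
  have jump: "M * (f p + g p * (of_real (ln x) + \<i> * pi)) = f p + g p * (of_real (ln x) - \<i> * pi)"
    if x: "0 < x" "x < r" and p: "p = z0 - of_real x" for x p
  proof -
    have "exp (b * (of_real (ln x) + \<i> * pi)) = M * exp (b * (of_real (ln x) - \<i> * pi))"
      unfolding M_def by (simp add: algebra_simps flip: exp_add)
    then have "exp (b * (of_real (ln x) - \<i> * pi)) * (M * (f p + g p * (of_real (ln x) + \<i> * pi))) =
       exp (b * (of_real (ln x) - \<i> * pi)) * (f p + g p * (of_real (ln x) - \<i> * pi))"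
      using slit_jump[OF hol(1)[THEN holomorphic_on_subset, OF sub] hol(2)[THEN holomorphic_on_subset, OF sub] hol(3) eq x]
      unfolding p by (simp add: mult_ac)
    then show ?thesis by simp
  qed
  show False
  proof (cases "M = 1")
    case True
    have "g (z0 - of_real x) = 0" if "0 < x" "x < r" for x
      using jump[OF that refl] True by (simp add: algebra_simps)
    from holomorphic_zero_on_ball[OF hol(2) re this z] gz show False by simp
  next
    case False
    \<comment> \<open>The constant part of \<open>f / g\<close> when the jump relation is solved for
      this quotient.\<close>
    define c where "c = - \<i> * pi * (1 + M) / (M - 1)"
    have fg: "f p = g p * (c - of_real (ln x))" if "0 < x" "x < r" "p = z0 - of_real x" for x p
    proof -
      have "(M - 1) * f p = (M - 1) * (g p * (c - of_real (ln x)))"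
      proof -
        have "(M - 1) * c = - \<i> * pi * (1 + M)" using False by (simp add: c_def)
        then have "(M - 1) * (g p * (c - of_real (ln x))) = g p * (- \<i> * pi * (1 + M) - (M - 1) * of_real (ln x))"
          by (simp only: mult.left_commute[of "M - 1" "g p"] right_diff_distrib[of "M - 1" c])
        also have "\<dots> = (M - 1) * f p" using jump[OF that] by (simp add: algebra_simps)
        finally show ?thesis ..
      qed
      then show ?thesis using False by simp
    qed
    \<comment> \<open>The zero of \<open>g\<close> at the centre is split off, so that
      \<open>f\<close> can be divided by the nonvanishing factor \<open>h\<close>.\<close>
    obtain h r' k where h: "0 < r'" "r' \<le> r" "h holomorphic_on ball z0 r'"
       "\<And>w. w \<in> ball z0 r' \<Longrightarrow> g w = (w - z0) ^ k * h w \<and> h w \<noteq> 0"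
    proof (cases "g z0 = 0")
      case True
      have "\<not> g constant_on ball z0 e"
        unfolding constant_on_def using True gz z re by (metis centre_in_ball less_le_trans)
      from holomorphic_factor_zero_nonconstant[OF hol(2) open_ball connected_ball _ True this]
      obtain h r1 n where h: "0 < r1" "ball z0 r1 \<subseteq> ball z0 e" "h holomorphic_on ball z0 r1"
        "\<And>w. w \<in> ball z0 r1 \<Longrightarrow> g w = (w - z0) ^ n * h w" "\<And>w. w \<in> ball z0 r1 \<Longrightarrow> h w \<noteq> 0"
        using re by (metis centre_in_ball less_le_trans)
      show thesis
        by (rule that[of "min r1 r" h n]) (use h re in \<open>auto elim: holomorphic_on_subset\<close>)
    next
      case False
      have "continuous_on (ball z0 e) g" using hol(2) holomorphic_on_imp_continuous_on by blast
      then obtain d where d: "d > 0" "\<And>w. dist z0 w < d \<Longrightarrow> g w \<noteq> 0"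
        using continuous_on_open_avoid[of "ball z0 e" g z0 0] False re by (metis centre_in_ball less_le_trans open_ball)
      show thesis
        by (rule that[of "min d r" g 0]) (use d re hol(2) in \<open>auto elim: holomorphic_on_subset\<close>)
    qed
    have "(\<lambda>z. f z / h z) holomorphic_on ball z0 r'"
      using h re by (intro holomorphic_intros holomorphic_on_subset[OF hol(1)]) auto
    moreover have "f (z0 - of_real x) / h (z0 - of_real x) = (- of_real x) ^ k * (c - of_real (ln x))" if "0 < x" "x < r'" for x
    proof -
      have "z0 - of_real x \<in> ball z0 r'" using that by (simp add: dist_norm)
      from h(4)[OF this] fg[of x, OF _ _ refl] that h(2) show ?thesis by simp
    qed
    ultimately show False by (rule no_holomorphic_log[OF _ h(1)])
  qed
qed

lemma powr_times_power:
  fixes z :: complex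
  assumes "z \<noteq> 0"
  shows "z powr (a + of_nat n) = z powr a * z ^ n"
  using assms by (simp add: powr_add powr_nat)

text \<open>Since \<open>n\<close> is positive, the two solutions are independent and every solution
  is \<open>(z - z0) powr a\<close> times a function holomorphic at the centre. Such a function has
  no logarithmic representation, whatever exponent is tried.\<close>

lemma no_log_singularity:
  assumes e: "e > 0" and n: "n \<ge> 1"
    and hol: "P holomorphic_on ball z0 e" "R holomorphic_on ball z0 e" "P z0 \<noteq> 0" "R z0 \<noteq> 0"
    and u: "solves_on (slit_ball z0 e) Q u u'" "\<And>z. z \<in> slit_ball z0 e \<Longrightarrow> u z = (z - z0) powr (a + of_nat n) * P z"
    and v: "solves_on (slit_ball z0 e) Q v v'" "\<And>z. z \<in> slit_ball z0 e \<Longrightarrow> v z = (z - z0) powr a * R z"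
  shows "\<not> (local_solution Q z0 e' y \<and> has_log_singularity y z0 e')"
proof
  assume asm: "local_solution Q z0 e' y \<and> has_log_singularity y z0 e'"
  have "isCont P z0" "isCont R z0"
    using hol e by (auto intro: holomorphic_on_ball_isCont)
  then obtain d1 d2 where d: "d1 > 0" "\<And>w. dist z0 w < d1 \<Longrightarrow> P w \<noteq> 0" "d2 > 0" "\<And>w. dist z0 w < d2 \<Longrightarrow> R w \<noteq> 0"
    using hol(3,4) continuous_at_avoid by metis
  define r where "r = min (min e e') (min d1 d2)"
  have e': "e' > 0" using asm by (simp add: local_solution_def)
  have r: "r > 0" "r \<le> e" "r \<le> e'" using e e' d by (auto simp: r_def)
  have nz: "P z \<noteq> 0" "R z \<noteq> 0" if "z \<in> ball z0 r" for z using that d by (auto simp: r_def)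
  let ?S = "slit_ball z0 r"
  have su: "solves_on ?S Q u u'" and sv: "solves_on ?S Q v v'"
    using u(1) v(1) r slit_ball_subset by (blast intro: solves_on_subset)+
  have sy: "solves_on ?S Q y (deriv y)"
    using local_solution_imp_solves_on[of Q z0 e' y] asm r slit_ball_subset by (blast intro: solves_on_subset)
  have S: "z \<in> slit_ball z0 e" "z \<in> ball z0 r" "z - z0 \<noteq> 0" if "z \<in> ?S" for z
    using that r slit_ball_subset[OF r(2), of z0] slit_ballD[OF that] by auto
  have vnz: "v z \<noteq> 0" if "z \<in> ?S" for z
    using S[OF that] nz by (simp add: v(2))
  \<comment> \<open>Otherwise \<open>u / v\<close> is a constant \<open>C\<close>, and letting
    \<open>z\<close> tend to \<open>z0\<close> along the ray opposite to the slit gives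
    \<open>C = 0\<close>, although \<open>u\<close> has no zero near \<open>z0\<close>.\<close>
  have "\<exists>z\<in>?S. u z * v' z - u' z * v z \<noteq> 0"
  proof (rule ccontr)
    assume "\<not> ?thesis"
    then have W: "u z * v' z - u' z * v z = 0" if "z \<in> ?S" for z using that by blast
    have D: "((\<lambda>z. u z / v z) has_field_derivative 0) (at z)" if z: "z \<in> ?S" for z
      using su sv W[OF z] vnz[OF z] z unfolding solves_on_def
      by (auto intro!: derivative_eq_intros simp: algebra_simps)
    then have "continuous_on ?S (\<lambda>z. u z / v z)"
      by (meson DERIV_isCont continuous_at_imp_continuous_on)
    from DERIV_zero_connected_constant[OF connected_slit_ball open_slit_ball finite.emptyI this] D
    obtain C where C: "\<And>z. z \<in> ?S \<Longrightarrow> u z / v z = C" by (metis Diff_empty)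
    have "(z - z0) ^ n * P z = C * R z" if "z \<in> ?S" for z
    proof -
      have "u z / v z = (z - z0) ^ n * P z / R z"
        using S[OF that] by (simp add: u(2) v(2) powr_times_power)
      then show ?thesis using C[OF that] nz(2)[OF S(2)[OF that]] by (simp add: field_simps)
    qed
    then have 1: "(of_real x) ^ n * P (z0 + of_real x) = C * R (z0 + of_real x)" if "0 < x" "x < r" for x
      using that by (metis (no_types, lifting) add_diff_cancel_left' complex_nonpos_Reals_iff dist_norm norm_minus_commute
        slit_ball_mem_iff mem_ball norm_of_real abs_of_pos Re_complex_of_real not_le)
    have t1: "((\<lambda>x. (of_real x) ^ n * P (z0 + of_real x)) \<longlongrightarrow> (of_real 0) ^ n * P z0) (at_right 0)"
      by (intro tendsto_intros isCont_tendsto_compose[OF \<open>isCont P z0\<close> tendsto_along_slit(2)])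
    have t2: "((\<lambda>x. C * R (z0 + of_real x)) \<longlongrightarrow> C * R z0) (at_right 0)"
      by (intro tendsto_intros isCont_tendsto_compose[OF \<open>isCont R z0\<close> tendsto_along_slit(2)])
    have ev: "eventually (\<lambda>x. (of_real x) ^ n * P (z0 + of_real x) = C * R (z0 + of_real x)) (at_right 0)"
      unfolding eventually_at_right_field using 1 r by (intro exI[of _ r]) auto
    have "(of_real 0) ^ n * P z0 = C * R z0"
      by (rule tendsto_unique[OF trivial_limit_at_right_real Lim_transform_eventually[OF t1 ev] t2])
    then have "C = 0" using n hol(4) by (cases n) auto
    define p where "p = z0 + of_real (r / 2)"
    have "p \<in> ?S" using r by (simp add: p_def slit_ball_def dist_norm complex_nonpos_Reals_iff)
    then show False
      using C[of p] \<open>C = 0\<close> S[of p] nz vnz by (simp add: u(2))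
  qed
  then obtain c d where cd: "\<And>z. z \<in> ?S \<Longrightarrow> y z = c * u z + d * v z"
    using solutions_spanned[OF open_slit_ball connected_slit_ball su sv sy] by blast
  define F where "F = (\<lambda>z. c * ((z - z0) ^ n * P z) + d * R z)"
  have "F holomorphic_on ball z0 e"
    unfolding F_def by (intro holomorphic_intros hol)
  then have F: "F holomorphic_on ball z0 r"
    by (rule holomorphic_on_subset) (use r in auto)
  have yF: "y z = (z - z0) powr a * F z" if "z \<in> ?S" for z
    using cd[OF that] S[OF that] by (simp add: u(2) v(2) F_def powr_times_power algebra_simps)
  obtain b f g where log: "f holomorphic_on ball z0 e'" "g holomorphic_on ball z0 e'" "\<exists>z\<in>ball z0 e'. g z \<noteq> 0"
      "\<And>z. z \<in> slit_ball z0 e' \<Longrightarrow> y z = (z - z0) powr b * (f z + g z * Ln (z - z0))"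
    using asm unfolding has_log_singularity_def by blast
  have "(z - z0) powr (b - a) * (f z + g z * Ln (z - z0)) = F z" if "z \<in> ?S" for z
  proof -
    have "z \<in> slit_ball z0 e'" using that slit_ball_subset[OF r(3)] by blast
    from log(4)[OF this] yF[OF that] S[OF that] show ?thesis
      by (simp add: powr_diff field_simps)
  qed
  from log_free_coefficient_zero[OF log(1,2) F r(1,3) this] log(3) show False by blast
qed

section \<open>Frobenius series\<close>

lemma powser_0: "powser c 0 = c 0"
  unfolding powser_def by simp

lemma powser_add:
  "summable (\<lambda>n. c n * x ^ n) \<Longrightarrow> summable (\<lambda>n. d n * x ^ n) \<Longrightarrow> powser (\<lambda>n. c n + d n) x = powser c x + powser d x"
  unfolding powser_def by (simp add: suminf_add algebra_simps)

lemma powser_cmult: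
  "summable (\<lambda>n. c n * x ^ n) \<Longrightarrow> powser (\<lambda>n. a * c n) x = a * powser c x"
  unfolding powser_def by (simp add: suminf_mult mult.assoc)

lemma summable_of_nat_times_powser:
  fixes c :: "nat \<Rightarrow> complex"
  assumes "\<And>x. norm x < R \<Longrightarrow> summable (\<lambda>n. c n * x ^ n)" "norm x < R"
  shows "summable (\<lambda>n. of_nat n * c n * x ^ n)"
proof -
  have "summable (\<lambda>n. diffs c n * x ^ n)"
    using assms(2,1) by (rule termdiff_converges)
  from summable_mult[OF this, of x] have "summable (\<lambda>n. of_nat (Suc n) * c (Suc n) * x ^ Suc n)"
    by (simp add: diffs_def mult_ac)
  then show ?thesis by (subst (asm) summable_Suc_iff)
qed

lemma summable_affine_powser:
  fixes c :: "nat \<Rightarrow> complex"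
  assumes "\<And>x. norm x < R \<Longrightarrow> summable (\<lambda>n. c n * x ^ n)" "norm x < R"
  shows "summable (\<lambda>n. (2 * of_nat n + \<mu>) * c n * x ^ n)"
  using summable_add[OF summable_mult[OF summable_of_nat_times_powser[OF assms], of 2] summable_mult[OF assms(1)[OF assms(2)], of \<mu>]]
  by (simp add: algebra_simps)

lemma powser_affine:
  assumes "\<And>x. norm x < R \<Longrightarrow> summable (\<lambda>n. c n * x ^ n)" "norm x < R"
  shows "powser (\<lambda>n. (2 * of_nat n + \<mu>) * c n) x = 2 * powser (\<lambda>n. of_nat n * c n) x + \<mu> * powser c x"
  using powser_add[OF summable_mult[OF summable_of_nat_times_powser[OF assms], of 2, unfolded mult.assoc[symmetric]]
      summable_mult[OF assms(1)[OF assms(2)], of \<mu>, unfolded mult.assoc[symmetric]]]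
    powser_cmult[OF summable_of_nat_times_powser[OF assms], of 2] powser_cmult[OF assms(1)[OF assms(2)], of \<mu>]
  by (simp add: algebra_simps)

text \<open>With \<Lambda> a logarithm of s, the function is s^\<mu> times a power series in s^2.
  Multiplying the coefficients by \<open>2 * n + \<mu>\<close> is the operator s d/ds, and
  \<open>l\<close> is the logarithmic derivative of s.\<close>

lemma has_field_derivative_exp_powser:
  assumes c: "\<And>x. norm x < R \<Longrightarrow> summable (\<lambda>n. c n * x ^ n)"
    and L: "(\<Lambda> has_field_derivative l) (at z)" and R: "norm (exp (\<Lambda> z) ^ 2) < R"
  shows "((\<lambda>z. exp (\<mu> * \<Lambda> z) * powser c (exp (\<Lambda> z) ^ 2)) has_field_derivative
     l * (exp (\<mu> * \<Lambda> z) * powser (\<lambda>n. (2 * of_nat n + \<mu>) * c n) (exp (\<Lambda> z) ^ 2))) (at z)"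
proof -
  obtain D where D: "(powser c has_field_derivative D) (at (exp (\<Lambda> z) ^ 2))"
    "exp (\<Lambda> z) ^ 2 * D = powser (\<lambda>n. of_nat n * c n) (exp (\<Lambda> z) ^ 2)"
    using powser_derivative[OF c R] .
  have "((\<lambda>z. exp (\<Lambda> z) ^ 2) has_field_derivative 2 * l * exp (\<Lambda> z) ^ 2) (at z)"
    by (auto intro!: derivative_eq_intros L simp: power2_eq_square)
  from DERIV_chain2[OF D(1) this]
  have "((\<lambda>z. powser c (exp (\<Lambda> z) ^ 2)) has_field_derivative 2 * l * (exp (\<Lambda> z) ^ 2 * D)) (at z)"
    by (simp add: mult_ac)
  then have P: "((\<lambda>z. powser c (exp (\<Lambda> z) ^ 2)) has_field_derivative 2 * l * powser (\<lambda>n. of_nat n * c n) (exp (\<Lambda> z) ^ 2)) (at z)"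
    unfolding D(2) .
  have E: "((\<lambda>z. exp (\<mu> * \<Lambda> z)) has_field_derivative \<mu> * l * exp (\<mu> * \<Lambda> z)) (at z)"
    by (auto intro!: derivative_eq_intros L)
  have aff: "powser (\<lambda>n. (2 * of_nat n + \<mu>) * c n) (exp (\<Lambda> z) ^ 2) =
      2 * powser (\<lambda>n. of_nat n * c n) (exp (\<Lambda> z) ^ 2) + \<mu> * powser c (exp (\<Lambda> z) ^ 2)"
    by (rule powser_affine[OF c R])
  from DERIV_mult[OF E P] show ?thesis
    unfolding aff by (rule DERIV_cong) (simp add: algebra_simps)
qed

text \<open>\<open>frob \<alpha> \<beta> k\<close> is the coefficient sequence of the Frobenius series with exponent
  \<open>1/2 + k\<close>.  If \<open>k\<close> is a negative integer, the coefficient number \<open>-k\<close> is \<open>0\<close> because \<open>x / 0 = 0\<close>.\<close>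

fun frob :: "complex \<Rightarrow> complex \<Rightarrow> complex \<Rightarrow> nat \<Rightarrow> complex" where
  "frob \<alpha> \<beta> k 0 = 1"
| "frob \<alpha> \<beta> k (Suc m) = (2 * of_nat m + (1/2 + k) + \<alpha>) * (2 * of_nat m + (1/2 + k) + \<beta>) * frob \<alpha> \<beta> k m /
     (4 * of_nat (Suc m) * (of_nat (Suc m) + k))"

definition frob_ok :: "complex \<Rightarrow> complex \<Rightarrow> complex \<Rightarrow> bool" where
  "frob_ok \<alpha> \<beta> k \<longleftrightarrow> (\<forall>m. of_nat (Suc m) + k = 0 \<longrightarrow>
     (2 * of_nat m + (1/2 + k) + \<alpha>) * (2 * of_nat m + (1/2 + k) + \<beta>) * frob \<alpha> \<beta> k m = 0)"

lemma frob_recurrence: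
  assumes "frob_ok \<alpha> \<beta> k"
  shows "4 * of_nat (Suc m) * (of_nat (Suc m) + k) * frob \<alpha> \<beta> k (Suc m) =
    (2 * of_nat m + (1/2 + k) + \<alpha>) * (2 * of_nat m + (1/2 + k) + \<beta>) * frob \<alpha> \<beta> k m"
proof (cases "of_nat (Suc m) + k = 0")
  case True
  then show ?thesis using assms unfolding frob_ok_def by simp
next
  case False
  have "4 * of_nat (Suc m) * (of_nat (Suc m) + k) \<noteq> 0"
    using False by (simp del: of_nat_Suc)
  then show ?thesis by (simp del: of_nat_Suc)
qed

lemma of_nat_plus_quotient_tendsto:
  fixes A B :: complex
  shows "(\<lambda>n. (of_nat n + A) / (of_nat n + B)) \<longlonglongrightarrow> 1"
proof -
  have inf: "filterlim (\<lambda>n. of_nat n + B) at_infinity sequentially"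
    using tendsto_add_filterlim_at_infinity'[OF tendsto_of_nat tendsto_const[of B]] .
  then have "(\<lambda>n. 1 + (A - B) / (of_nat n + B)) \<longlonglongrightarrow> 1 + 0"
    by (intro tendsto_add tendsto_divide_0[OF tendsto_const]) auto
  moreover have "eventually (\<lambda>n. 1 + (A - B) / (of_nat n + B) = (of_nat n + A) / (of_nat n + B)) sequentially"
    using filterlim_at_infinity_imp_eventually_ne[OF inf, of 0]
    by eventually_elim (simp add: field_simps)
  ultimately show ?thesis by (simp add: Lim_transform_eventually)
qed

text \<open>The ratio of successive coefficients tends to 1, in accordance with the singular points
  of the equation at s^2 = 1.\<close>

lemma frob_summable:
  assumes "norm x < 1"
  shows "summable (\<lambda>n. frob \<alpha> \<beta> k n * x ^ n)"
proof -
  define \<rho> where "\<rho> = (\<lambda>m. (2 * of_nat m + (1/2 + k) + \<alpha>) * (2 * of_nat m + (1/2 + k) + \<beta>) /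
     (4 * of_nat (Suc m) * (of_nat (Suc m) + k)))"
  have "(\<lambda>m. ((of_nat m + (1/2 + k + \<alpha>) / 2) / (of_nat m + 1)) * ((of_nat m + (1/2 + k + \<beta>) / 2) / (of_nat m + (1 + k)))) \<longlonglongrightarrow> 1 * 1"
    by (intro tendsto_mult of_nat_plus_quotient_tendsto)
  moreover have "((of_nat m + (1/2 + k + \<alpha>) / 2) / (of_nat m + 1)) * ((of_nat m + (1/2 + k + \<beta>) / 2) / (of_nat m + (1 + k))) = \<rho> m" for m
  proof -
    have e: "2 * of_nat m + (1/2 + k) + c = 2 * (of_nat m + (1/2 + k + c) / 2)" for c by simp
    have quot: "(2 * A) * (2 * B) / (4 * C * D) = (A / C) * (B / D)" for A B C D :: complex
      by simp
    have "\<rho> m = (2 * (of_nat m + (1/2 + k + \<alpha>) / 2)) * (2 * (of_nat m + (1/2 + k + \<beta>) / 2)) /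
       (4 * (of_nat m + 1) * (of_nat m + (1 + k)))"
      unfolding \<rho>_def e of_nat_Suc by (simp only: add_ac)
    also have "\<dots> = ((of_nat m + (1/2 + k + \<alpha>) / 2) / (of_nat m + 1)) * ((of_nat m + (1/2 + k + \<beta>) / 2) / (of_nat m + (1 + k)))"
      by (rule quot)
    finally show ?thesis ..
  qed
  ultimately have "\<rho> \<longlonglongrightarrow> 1" by simp
  then have "(\<lambda>m. norm (\<rho> m) * norm x) \<longlonglongrightarrow> norm (1::complex) * norm x"
    by (intro tendsto_intros)
  then have lim: "(\<lambda>m. norm (\<rho> m) * norm x) \<longlonglongrightarrow> norm x" by simp
  obtain c where c: "norm x < c" "c < 1" using dense[OF assms] by blast
  from order_tendstoD(2)[OF lim c(1)] obtain N where N: "\<And>m. m \<ge> N \<Longrightarrow> norm (\<rho> m) * norm x < c"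
    by (auto simp: eventually_sequentially)
  show ?thesis
  proof (rule summable_ratio_test[OF c(2)])
    fix m assume m: "m \<ge> N"
    have "frob \<alpha> \<beta> k (Suc m) * x ^ Suc m = (\<rho> m * x) * (frob \<alpha> \<beta> k m * x ^ m)"
      by (simp add: \<rho>_def)
    then have "norm (frob \<alpha> \<beta> k (Suc m) * x ^ Suc m) = (norm (\<rho> m) * norm x) * norm (frob \<alpha> \<beta> k m * x ^ m)"
      by (simp only: norm_mult)
    also have "\<dots> \<le> c * norm (frob \<alpha> \<beta> k m * x ^ m)"
      using N[OF m] by (intro mult_right_mono) auto
    finally show "norm (frob \<alpha> \<beta> k (Suc m) * x ^ Suc m) \<le> c * norm (frob \<alpha> \<beta> k m * x ^ m)" .
  qed
qed

text \<open>The coefficients of the defect of the series with exponent \<open>1/2 + k\<close> in the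
  hypergeometric equation.\<close>

definition resid :: "complex \<Rightarrow> complex \<Rightarrow> complex \<Rightarrow> (nat \<Rightarrow> complex) \<Rightarrow> nat \<Rightarrow> complex" where
  "resid \<alpha> \<beta> k c n = 4 * of_nat n * (of_nat n + k) * c n -
     (if n = 0 then 0 else (2 * of_nat (n - 1) + (1/2 + k) + \<alpha>) * (2 * of_nat (n - 1) + (1/2 + k) + \<beta>) * c (n - 1))"

lemma powser_residual:
  fixes \<alpha> \<beta> k x :: complex
  defines "\<mu> \<equiv> 1/2 + k"
  assumes c: "\<And>x. norm x < R \<Longrightarrow> summable (\<lambda>n. c n * x ^ n)" and x: "norm x < R"
  defines "c1 \<equiv> \<lambda>n. (2 * of_nat n + \<mu>) * c n" and "c2 \<equiv> \<lambda>n. (2 * of_nat n + \<mu>) * ((2 * of_nat n + \<mu>) * c n)"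
  shows "summable (\<lambda>n. resid \<alpha> \<beta> k c n * x ^ n)"
    and "powser c2 x - powser c1 x + (1/4 - k^2) * powser c x -
      x * (powser c2 x + (\<alpha> + \<beta>) * powser c1 x + \<alpha> * \<beta> * powser c x) = powser (resid \<alpha> \<beta> k c) x"
proof -
  have c1: "summable (\<lambda>n. c1 n * x ^ n)" if "norm x < R" for x
    unfolding c1_def by (rule summable_affine_powser[OF c that])
  have c2: "summable (\<lambda>n. c2 n * x ^ n)"
    unfolding c2_def c1_def[symmetric] using summable_affine_powser[OF c1 x] by (simp add: c1_def)
  define A where "A = (\<lambda>n. 4 * of_nat n * (of_nat n + k) * c n)"
  define B where "B = (\<lambda>n. (2 * of_nat n + \<mu> + \<alpha>) * (2 * of_nat n + \<mu> + \<beta>) * c n)"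
  have "(\<lambda>n. c2 n * x ^ n - c1 n * x ^ n + (1/4 - k^2) * (c n * x ^ n)) sums
     (powser c2 x - powser c1 x + (1/4 - k^2) * powser c x)"
    unfolding powser_def by (intro sums_add sums_diff sums_mult summable_sums c c1 c2 x)
  \<comment> \<open>The indicial polynomial X^2 - X + 1/4 - k^2 takes the value 4 n (n + k) at X = 2
    n + 1/2 + k.\<close>
  also have "(\<lambda>n. c2 n * x ^ n - c1 n * x ^ n + (1/4 - k^2) * (c n * x ^ n)) = (\<lambda>n. A n * x ^ n)"
    by (rule ext) (simp add: A_def c1_def c2_def \<mu>_def field_simps power2_eq_square)
  finally have A: "(\<lambda>n. A n * x ^ n) sums (powser c2 x - powser c1 x + (1/4 - k^2) * powser c x)" .
  have "(\<lambda>n. c2 n * x ^ n + (\<alpha> + \<beta>) * (c1 n * x ^ n) + \<alpha> * \<beta> * (c n * x ^ n)) sums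
     (powser c2 x + (\<alpha> + \<beta>) * powser c1 x + \<alpha> * \<beta> * powser c x)"
    unfolding powser_def by (intro sums_add sums_diff sums_mult summable_sums c c1 c2 x)
  also have "(\<lambda>n. c2 n * x ^ n + (\<alpha> + \<beta>) * (c1 n * x ^ n) + \<alpha> * \<beta> * (c n * x ^ n)) = (\<lambda>n. B n * x ^ n)"
    by (rule ext) (simp add: B_def c1_def c2_def algebra_simps)
  finally have "(\<lambda>n. x * (B n * x ^ n)) sums (x * (powser c2 x + (\<alpha> + \<beta>) * powser c1 x + \<alpha> * \<beta> * powser c x))"
    by (rule sums_mult)
  also have "(\<lambda>n. x * (B n * x ^ n)) = (\<lambda>n. (if Suc n = 0 then 0 else B (Suc n - 1)) * x ^ Suc n)"
    by (rule ext) simp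
  finally have B: "(\<lambda>n. (if n = 0 then 0 else B (n - 1)) * x ^ n) sums (x * (powser c2 x + (\<alpha> + \<beta>) * powser c1 x + \<alpha> * \<beta> * powser c x))"
    using sums_Suc[of "\<lambda>n. (if n = 0 then 0 else B (n - 1)) * x ^ n"] by fastforce
  have "(\<lambda>n. resid \<alpha> \<beta> k c n * x ^ n) = (\<lambda>n. A n * x ^ n - (if n = 0 then 0 else B (n - 1)) * x ^ n)"
    by (rule ext) (simp add: resid_def A_def B_def \<mu>_def left_diff_distrib)
  then have "(\<lambda>n. resid \<alpha> \<beta> k c n * x ^ n) sums (powser c2 x - powser c1 x + (1/4 - k^2) * powser c x -
      x * (powser c2 x + (\<alpha> + \<beta>) * powser c1 x + \<alpha> * \<beta> * powser c x))"
    using sums_diff[OF A B] by simp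
  then show "summable (\<lambda>n. resid \<alpha> \<beta> k c n * x ^ n)"
    "powser c2 x - powser c1 x + (1/4 - k^2) * powser c x -
      x * (powser c2 x + (\<alpha> + \<beta>) * powser c1 x + \<alpha> * \<beta> * powser c x) = powser (resid \<alpha> \<beta> k c) x"
    by (auto simp: powser_def sums_iff)
qed

lemma resid_frob:
  assumes "frob_ok \<alpha> \<beta> k"
  shows "resid \<alpha> \<beta> k (frob \<alpha> \<beta> k) n = 0"
proof (cases n)
  case (Suc m)
  show ?thesis using frob_recurrence[OF assms, of m] unfolding resid_def Suc by (simp del: frob.simps of_nat_Suc)
qed (simp add: resid_def)

text \<open>At index \<open>j\<close> the factor \<open>n - j\<close> on the left-hand side of the recurrence vanishes.\<close>

lemma resid_zero_imp_product_zero: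
  assumes "\<And>n. resid \<alpha> \<beta> (- of_nat j) c n = 0" "c 0 \<noteq> 0" "j \<ge> 1"
  shows "\<exists>m<j. (2 * of_nat m + (1/2 - of_nat j) + \<alpha>) * (2 * of_nat m + (1/2 - of_nat j) + \<beta>) = 0"
proof (rule ccontr)
  assume "\<not> ?thesis"
  then have nz: "(2 * of_nat m + (1/2 - of_nat j) + \<alpha>) * (2 * of_nat m + (1/2 - of_nat j) + \<beta>) \<noteq> 0" if "m < j" for m
    using that by blast
  have rec: "4 * of_nat (Suc m) * (of_nat (Suc m) - of_nat j) * c (Suc m) =
     (2 * of_nat m + (1/2 - of_nat j) + \<alpha>) * (2 * of_nat m + (1/2 - of_nat j) + \<beta>) * c m" for m
    using assms(1)[of "Suc m"] unfolding resid_def by (simp del: of_nat_Suc)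
  have "m < j \<Longrightarrow> c m \<noteq> 0" for m
  proof (induction m)
    case 0
    then show ?case using assms(2) by simp
  next
    case (Suc m)
    then have "4 * of_nat (Suc m) * (of_nat (Suc m) - of_nat j) * c (Suc m) \<noteq> 0"
      unfolding rec using nz[of m] by auto
    then show ?case by auto
  qed
  moreover obtain i where i: "j = Suc i" using assms(3) by (cases j) auto
  ultimately have "c i \<noteq> 0" by simp
  moreover have "(2 * of_nat i + (1/2 - of_nat j) + \<alpha>) * (2 * of_nat i + (1/2 - of_nat j) + \<beta>) * c i = 0"
    using rec[of i] i by simp
  ultimately show False using nz[of i] i by simp
qed

text \<open>A vanishing numerator at \<open>m\<close> makes all later coefficients 0; at index
  \<open>j\<close> division by zero gives 0 as well. The right-hand side at the critical index thus
  vanishes, through its numerator if \<open>m = j - 1\<close> and through the coefficient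
  otherwise.\<close>

lemma frob_okI_product_zero:
  assumes "m < j" "(2 * of_nat m + (1/2 - of_nat j) + \<alpha>) * (2 * of_nat m + (1/2 - of_nat j) + \<beta>) = 0"
  shows "frob_ok \<alpha> \<beta> (- of_nat j)"
proof -
  have 0: "frob \<alpha> \<beta> (- of_nat j) n = 0" if "n > m" for n
    using that
  proof (induction n)
    case (Suc n)
    show ?case
    proof (cases "n = m")
      case True
      then show ?thesis using assms(2) by (simp del: of_nat_Suc)
    next
      case False
      then show ?thesis using Suc by (simp del: of_nat_Suc)
    qed
  qed simp
  show ?thesis
    unfolding frob_ok_def
  proof (intro allI impI)
    fix i assume "of_nat (Suc i) + - of_nat j = (0 :: complex)"
    then have "of_nat (Suc i) = (of_nat j :: complex)" by (simp del: of_nat_Suc)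
    then have "j = Suc i" by (simp only: of_nat_eq_iff)
    then have "m = i \<or> i > m" using assms(1) by auto
    then show "(2 * of_nat i + (1/2 + - of_nat j) + \<alpha>) * (2 * of_nat i + (1/2 + - of_nat j) + \<beta>) * frob \<alpha> \<beta> (- of_nat j) i = 0"
      using assms(2) 0 by auto
  qed
qed

lemma frob_okI_not_negative_integer:
  assumes "\<And>m. of_nat (Suc m) + k \<noteq> 0"
  shows "frob_ok \<alpha> \<beta> k"
  using assms unfolding frob_ok_def by blast

section \<open>The equation near a zero of \<open>E6\<close>\<close>

text \<open>The chart avoids multivalued powers of \<open>E4\<close>: a logarithm \<open>h\<close> of \<open>E4\<close> is fixed, and
  \<open>(z - z0) * exp (L z)\<close> is the coordinate \<open>s = E6 / E4 powr (3/2)\<close>.\<close>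

locale E6_zero_chart =
  fixes z0 :: complex and e :: real and h L :: "complex \<Rightarrow> complex"
  assumes e_pos: "e > 0"
    and in_H: "ball z0 e \<subseteq> \<H>"
    and h_hol: "h holomorphic_on ball z0 e"
    and L_hol: "L holomorphic_on ball z0 e"
    and E4_chart: "\<And>z. z \<in> ball z0 e \<Longrightarrow> E4 z = exp (h z)"
    and E6_chart: "\<And>z. z \<in> ball z0 e \<Longrightarrow> E6 z = (z - z0) * exp (L z) * exp (3 / 2 * h z)"
    and small: "\<And>z. z \<in> ball z0 e \<Longrightarrow> norm ((z - z0) * exp (L z)) < 1"
begin

definition s :: "complex \<Rightarrow> complex" where "s z = (z - z0) * exp (L z)"

text \<open>A branch of log s on the slit disc; fractional powers of s are exponentials of its
  multiples.\<close>

definition \<Lambda> :: "complex \<Rightarrow> complex" where "\<Lambda> z = Ln (z - z0) + L z"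

text \<open>A holomorphic square root of \<open>E4\<close>.\<close>

definition w :: "complex \<Rightarrow> complex" where "w z = exp (h z / 2)"

abbreviation ip :: complex where "ip \<equiv> \<i> * of_real pi"

lemma ip_square: "ip * ip = - (of_real pi ^ 2)"
  by (simp add: power2_eq_square algebra_simps)

lemma w_nonzero: "w z \<noteq> 0" by (simp add: w_def)

lemma E4_w: "z \<in> ball z0 e \<Longrightarrow> E4 z = w z ^ 2"
  by (simp add: E4_chart w_def flip: exp_double)

lemma E6_w: "z \<in> ball z0 e \<Longrightarrow> E6 z = s z * w z ^ 3"
  by (simp add: E6_chart s_def w_def flip: exp_of_nat_mult)

lemma norm_s_square: "z \<in> ball z0 e \<Longrightarrow> norm (s z ^ 2) < 1"
  using small by (simp add: s_def norm_power power_less_one_iff)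

lemma one_minus_s_square: "z \<in> ball z0 e \<Longrightarrow> 1 - s z ^ 2 \<noteq> 0" "z \<in> ball z0 e \<Longrightarrow> 1 - s z ^ 2 \<notin> \<real>\<^sub>\<le>\<^sub>0"
proof -
  assume z: "z \<in> ball z0 e"
  have "Re (s z ^ 2) < 1"
    using norm_s_square[OF z] complex_Re_le_cmod[of "s z ^ 2"] by linarith
  then show "1 - s z ^ 2 \<noteq> 0" "1 - s z ^ 2 \<notin> \<real>\<^sub>\<le>\<^sub>0"
    by (auto simp: complex_nonpos_Reals_iff complex_eq_iff)
qed

lemma s_zero_iff: "s z = 0 \<longleftrightarrow> z = z0" by (simp add: s_def)

lemma exp_\<Lambda>: "z \<noteq> z0 \<Longrightarrow> exp (\<Lambda> z) = s z"
  by (simp add: \<Lambda>_def s_def exp_add)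

lemma h_derivative:
  assumes z: "z \<in> ball z0 e"
  shows "(h has_field_derivative 2 * ip * ((E2 z - s z * w z) / 3)) (at z)"
proof -
  have zH: "z \<in> \<H>" using z in_H by blast
  have h: "(h has_field_derivative deriv h z) (at z)"
    by (rule holomorphic_derivI[OF h_hol open_ball z])
  have "((\<lambda>z. exp (h z)) has_field_derivative exp (h z) * deriv h z) (at z)"
    using h by (auto intro!: derivative_eq_intros)
  then have "(E4 has_field_derivative exp (h z) * deriv h z) (at z)"
    by (rule has_field_derivative_transform_within_open[OF _ open_ball z]) (simp add: E4_chart)
  from DERIV_unique[OF this has_field_derivative_E4[OF zH]]
  have "w z ^ 2 * deriv h z = w z ^ 2 * (2 * ip * ((E2 z - s z * w z) / 3))"
    unfolding E4_chart[OF z, symmetric] E4_w[OF z] E6_w[OF z]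
    by (simp add: field_simps eval_nat_numeral)
  then have "deriv h z = 2 * ip * ((E2 z - s z * w z) / 3)"
    using w_nonzero by simp
  with h show ?thesis by simp
qed

lemma w_derivative:
  assumes z: "z \<in> ball z0 e"
  shows "(w has_field_derivative w z * (ip * ((E2 z - s z * w z) / 3))) (at z)"
proof -
  have "((\<lambda>z. h z / 2) has_field_derivative ip * ((E2 z - s z * w z) / 3)) (at z)"
    by (rule DERIV_cong[OF DERIV_cdivide[OF h_derivative[OF z], of 2]]) simp
  from DERIV_chain2[OF DERIV_exp this] show ?thesis by (simp only: w_def [abs_def])
qed

text \<open>\<open>s\<close> has weight 0, so the terms with \<open>E2\<close> cancel. The factor
  \<open>1 - s z ^ 2\<close> is the discriminant divided by \<open>E4 z ^ 3\<close>.\<close>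

lemma s_derivative:
  assumes z: "z \<in> ball z0 e"
  shows "(s has_field_derivative - ip * w z * (1 - s z ^ 2)) (at z)"
proof -
  have zH: "z \<in> \<H>" using z in_H by blast
  have "((\<lambda>z. E6 z / w z ^ 3) has_field_derivative - ip * w z * (1 - s z ^ 2)) (at z)"
    by (rule derivative_eq_intros has_field_derivative_E6[OF zH] w_derivative[OF z] refl)+
       (use w_nonzero in \<open>auto simp: E6_w[OF z] E4_w[OF z] field_simps eval_nat_numeral\<close>)
  then show ?thesis
    by (rule has_field_derivative_transform_within_open[OF _ open_ball z]) (simp add: E6_w w_nonzero)
qed

lemma \<Lambda>_derivative:
  assumes z: "z \<in> slit_ball z0 e"
  shows "(\<Lambda> has_field_derivative - ip * w z * (1 - s z ^ 2) / s z) (at z)"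
proof -
  note z' = slit_ballD[OF z]
  have L: "(L has_field_derivative deriv L z) (at z)"
    by (rule holomorphic_derivI[OF L_hol open_ball z'(1)])
  have "(s has_field_derivative exp (L z) + (z - z0) * (exp (L z) * deriv L z)) (at z)"
    unfolding s_def [abs_def] using L by (auto intro!: derivative_eq_intros)
  from DERIV_unique[OF this s_derivative[OF z'(1)]]
  moreover have "s z * (1 / (z - z0) + deriv L z) = exp (L z) + (z - z0) * (exp (L z) * deriv L z)"
    using z'(2) by (simp add: s_def distrib_left mult.assoc)
  ultimately have *: "- ip * w z * (1 - s z ^ 2) = s z * (1 / (z - z0) + deriv L z)"
    by simp
  have "(\<Lambda> has_field_derivative 1 / (z - z0) + deriv L z) (at z)"
    unfolding \<Lambda>_def [abs_def] using L z by (auto intro!: derivative_eq_intros simp: slit_ball_def inverse_eq_divide)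
  then show ?thesis unfolding * using z'(2) s_zero_iff by simp
qed

definition amp :: "complex \<Rightarrow> complex \<Rightarrow> complex" where
  "amp \<gamma> z = exp (- h z / 4 + \<gamma> * Ln (1 - s z ^ 2))"

lemma amp_nonzero: "amp \<gamma> z \<noteq> 0" by (simp add: amp_def)

lemma amp_derivative:
  assumes z: "z \<in> ball z0 e"
  shows "(amp \<gamma> has_field_derivative amp \<gamma> z * (ip * ((2 * \<gamma> + 1/6) * w z * s z - E2 z / 6))) (at z)"
proof -
  have "((\<lambda>z. - h z / 4 + \<gamma> * Ln (1 - s z ^ 2)) has_field_derivative
     ip * ((2 * \<gamma> + 1/6) * w z * s z - E2 z / 6)) (at z)"
  proof -
    have "((\<lambda>z. 1 - s z ^ 2) has_field_derivative - (2 * s z * (- ip * w z * (1 - s z ^ 2)))) (at z)"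
      by (rule derivative_eq_intros s_derivative[OF z] refl)+ simp
    from DERIV_chain2[OF has_field_derivative_Ln[OF one_minus_s_square(2)[OF z]] this]
    have "((\<lambda>z. Ln (1 - s z ^ 2)) has_field_derivative 2 * s z * ip * w z) (at z)"
      by (rule DERIV_cong) (use one_minus_s_square(1)[OF z] in \<open>simp add: field_simps\<close>)
    from DERIV_add[OF DERIV_cdivide[OF DERIV_minus[OF h_derivative[OF z]], of 4] DERIV_cmult[OF this, of \<gamma>]]
    show ?thesis by (rule DERIV_cong) (simp add: field_simps)
  qed
  from DERIV_chain2[OF DERIV_exp this] show ?thesis unfolding amp_def [abs_def] .
qed

end

text \<open>Here \<open>A\<close> and \<open>l\<close> are the logarithmic derivatives of the amplitude and of \<open>s\<close>, and
  \<open>A'\<close>, \<open>l'\<close> are their derivatives.\<close>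

lemma chart_algebra:
  fixes p w s \<epsilon> \<gamma> t v0 v1 v2 :: complex
  assumes nz: "s \<noteq> 0" "1 - s^2 \<noteq> 0"
  defines "\<alpha> \<equiv> 2 * \<gamma> + 1/6" and "\<beta> \<equiv> 2 * \<gamma> + 5/6"
  defines "A \<equiv> p * (\<alpha> * w * s - \<epsilon> / 6)" and "l \<equiv> - p * w * (1 - s^2) / s"
  defines "w' \<equiv> w * (p * ((\<epsilon> - s * w) / 3))" and "s' \<equiv> - p * w * (1 - s^2)"
    and "\<epsilon>' \<equiv> p * ((\<epsilon>^2 - w^2) / 6)"
  defines "A' \<equiv> p * (\<alpha> * (w' * s + w * s') - \<epsilon>' / 6)"
    and "l' \<equiv> - p * (w' * (1 - s^2) / s + w * (- s' / s^2 - s'))"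
  shows "A * (A * v0 + l * v1) + (A' * v0 + A * (l * v1) + l' * v1 + l * (l * v2)) =
    (- (p * p) * ((- 4 * \<gamma>^2 - t) * w^2 + t * w^2 / s^2)) * v0 +
    l^2 / (1 - s^2) * (v2 - v1 + t * v0 - s^2 * (v2 + (\<alpha> + \<beta>) * v1 + \<alpha> * \<beta> * v0))"
proof -
  have c2: "l^2 / (1 - s^2) * (1 - s^2) = l * l"
    using nz by (simp add: power2_eq_square)
  have l2: "l^2 / (1 - s^2) = p * p * w^2 * (1 - s^2) / s^2"
    using nz by (simp add: l_def power2_eq_square field_simps)
  \<comment> \<open>The exponent -1/4 of \<open>E4\<close> is decisive here: \<epsilon> enters
    \<open>2 * (A * l)\<close> as \<open>- p * \<epsilon> * l / 3\<close> and \<open>l'\<close> as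
    \<open>p * \<epsilon> * l / 3\<close>.\<close>
  have c1: "2 * (A * l) + l' = - (l^2 / (1 - s^2) * (1 + s^2 * (\<alpha> + \<beta>)))"
    unfolding l2 using nz(1)
    by (simp add: A_def l_def l'_def w'_def s'_def \<alpha>_def \<beta>_def divide_simps) (simp add: eval_nat_numeral algebra_simps)
  \<comment> \<open>The squares of \<epsilon> cancel by Ramanujan's equation for \<open>E2\<close>.
    The terms with s^2 require \<alpha> \<beta> = \<alpha>^2 + 2 \<alpha> / 3, which is the origin
    of \<beta> = \<alpha> + 2/3.\<close>
  have c0: "A * A + A' = - (p * p) * ((- 4 * \<gamma>^2 - t) * w^2 + t * w^2 / s^2) + l^2 / (1 - s^2) * (t - s^2 * (\<alpha> * \<beta>))"
    unfolding l2 using nz(1)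
    by (simp add: A_def A'_def w'_def s'_def \<epsilon>'_def \<alpha>_def \<beta>_def divide_simps) (simp add: eval_nat_numeral algebra_simps)
  have "A * (A * v0 + l * v1) + (A' * v0 + A * (l * v1) + l' * v1 + l * (l * v2)) =
     (A * A + A') * v0 + (2 * (A * l) + l') * v1 + (l * l) * v2"
    by (simp add: algebra_simps)
  also have "\<dots> = (- (p * p) * ((- 4 * \<gamma>^2 - t) * w^2 + t * w^2 / s^2)) * v0 +
    l^2 / (1 - s^2) * (v2 - v1 + t * v0 - s^2 * (v2 + (\<alpha> + \<beta>) * v1 + \<alpha> * \<beta> * v0))"
  proof -
    have "(P + X * (t - S * D)) * v0 + - (X * (1 + S * C)) * v1 + X * (1 - S) * v2 =
        P * v0 + X * (v2 - v1 + t * v0 - S * (v2 + C * v1 + D * v0))" for P X S C D :: complex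
      by (simp add: algebra_simps)
    then show ?thesis unfolding c0 c1 c2[symmetric] .
  qed
  finally show ?thesis .
qed

context E6_zero_chart
begin

definition ldiff :: "complex \<Rightarrow> complex" where
  "ldiff z = - ip * w z * (1 - s z ^ 2) / s z"

lemma ldiff_nonzero: "z \<in> slit_ball z0 e \<Longrightarrow> ldiff z \<noteq> 0"
  using slit_ballD[of z z0 e] one_minus_s_square w_nonzero s_zero_iff by (simp add: ldiff_def)

lemma E2_derivative:
  assumes z: "z \<in> ball z0 e"
  shows "(E2 has_field_derivative ip * ((E2 z ^ 2 - w z ^ 2) / 6)) (at z)"
proof -
  have "z \<in> \<H>" using in_H z by blast
  from has_field_derivative_E2[OF this] show ?thesis by (rule DERIV_cong) (simp add: E4_w[OF z])
qed

lemma potential_chart: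
  assumes z: "z \<in> ball z0 e" "z \<noteq> z0" and rt: "r + t = - 4 * \<gamma>^2"
  shows "potential r t z = - (ip * ip) * ((- 4 * \<gamma>^2 - t) * w z ^ 2 + t * w z ^ 2 / s z ^ 2)"
proof -
  have r: "r = - 4 * \<gamma>^2 - t" using rt by (simp add: algebra_simps)
  have "E4 z ^ 4 / E6 z ^ 2 = w z ^ 2 / s z ^ 2"
    using z w_nonzero[of z] s_zero_iff[of z] unfolding E4_w[OF z(1)] E6_w[OF z(1)]
    by (simp add: divide_simps power_mult_distrib flip: power_mult power_add)
  then show ?thesis unfolding potential_def r ip_square E4_w[OF z(1)] by simp
qed

definition dsol :: "complex \<Rightarrow> (complex \<Rightarrow> complex) \<Rightarrow> (complex \<Rightarrow> complex) \<Rightarrow> complex \<Rightarrow> complex" where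
  "dsol \<gamma> V V1 z = amp \<gamma> z * ((ip * ((2 * \<gamma> + 1/6) * w z * s z - E2 z / 6)) * V z + ldiff z * V1 z)"

text \<open>\<open>V1\<close> and \<open>V2\<close> play the roles of s d/ds and its square applied
  to \<open>V\<close>; the last bracket is the hypergeometric operator, so a solution results where
  it vanishes.\<close>

lemma chart_solution_derivatives:
  assumes z: "z \<in> slit_ball z0 e" and rt: "r + t = - 4 * \<gamma>^2"
    and V: "(V has_field_derivative ldiff z * V1 z) (at z)" "(V1 has_field_derivative ldiff z * V2 z) (at z)"
  shows "((\<lambda>z. amp \<gamma> z * V z) has_field_derivative dsol \<gamma> V V1 z) (at z)"
    and "(dsol \<gamma> V V1 has_field_derivative potential r t z * (amp \<gamma> z * V z) +
      amp \<gamma> z * (ldiff z ^ 2 / (1 - s z ^ 2) * (V2 z - V1 z + t * V z -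
        s z ^ 2 * (V2 z + ((2 * \<gamma> + 1/6) + (2 * \<gamma> + 5/6)) * V1 z + (2 * \<gamma> + 1/6) * (2 * \<gamma> + 5/6) * V z)))) (at z)"
proof -
  note zb = slit_ballD[OF z]
  have nz: "s z \<noteq> 0" "1 - s z ^ 2 \<noteq> 0"
    using zb s_zero_iff one_minus_s_square by auto
  show "((\<lambda>z. amp \<gamma> z * V z) has_field_derivative dsol \<gamma> V V1 z) (at z)"
    unfolding dsol_def
    by (rule DERIV_cong[OF DERIV_mult[OF amp_derivative[OF zb(1)] V(1)]]) (simp add: algebra_simps)
  define A where "A = (\<lambda>z. ip * ((2 * \<gamma> + 1/6) * w z * s z - E2 z / 6))"
  define w' where "w' = w z * (ip * ((E2 z - s z * w z) / 3))"
  define s' where "s' = - ip * w z * (1 - s z ^ 2)"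
  define E2' where "E2' = ip * ((E2 z ^ 2 - w z ^ 2) / 6)"
  define A' where "A' = ip * ((2 * \<gamma> + 1/6) * (w' * s z + w z * s') - E2' / 6)"
  define l' where "l' = - ip * (w' * (1 - s z ^ 2) / s z + w z * (- s' / s z ^ 2 - s'))"
  note dw = w_derivative[OF zb(1), folded w'_def]
  note ds = s_derivative[OF zb(1), folded s'_def]
  note dE2 = E2_derivative[OF zb(1), folded E2'_def]
  have dA: "(A has_field_derivative A') (at z)"
    unfolding A_def A'_def
    by (rule DERIV_cong[OF DERIV_cmult[OF DERIV_diff[OF DERIV_mult[OF DERIV_cmult[OF dw, of "2 * \<gamma> + 1/6"] ds]
          DERIV_cdivide[OF dE2, of 6]], of ip]]) (simp add: algebra_simps)
  have dl: "(ldiff has_field_derivative l') (at z)"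
    unfolding ldiff_def [abs_def] l'_def
    by (rule derivative_eq_intros dw ds refl nz)+
       (use nz(1) in \<open>simp add: divide_simps, simp add: algebra_simps power2_eq_square\<close>)
  have damp: "(amp \<gamma> has_field_derivative amp \<gamma> z * A z) (at z)"
    using amp_derivative[OF zb(1)] by (simp add: A_def)
  have "(dsol \<gamma> V V1 has_field_derivative
     amp \<gamma> z * (A z * (A z * V z + ldiff z * V1 z) + (A' * V z + A z * (ldiff z * V1 z) + l' * V1 z + ldiff z * (ldiff z * V2 z)))) (at z)"
  proof -
    have "dsol \<gamma> V V1 = (\<lambda>z. amp \<gamma> z * (A z * V z + ldiff z * V1 z))"
      by (rule ext) (simp add: dsol_def A_def)
    then show ?thesis
      by (simp only:) (rule DERIV_cong[OF DERIV_mult[OF damp DERIV_add[OF DERIV_mult[OF dA V(1)] DERIV_mult[OF dl V(2)]]]],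
        simp add: algebra_simps)
  qed
  also have "A z * (A z * V z + ldiff z * V1 z) + (A' * V z + A z * (ldiff z * V1 z) + l' * V1 z + ldiff z * (ldiff z * V2 z)) =
     potential r t z * V z + ldiff z ^ 2 / (1 - s z ^ 2) * (V2 z - V1 z + t * V z -
        s z ^ 2 * (V2 z + ((2 * \<gamma> + 1/6) + (2 * \<gamma> + 5/6)) * V1 z + (2 * \<gamma> + 1/6) * (2 * \<gamma> + 5/6) * V z))"
    unfolding potential_chart[OF zb rt]
    using chart_algebra[OF nz, of ip \<gamma> "w z" "E2 z" "V z" "V1 z" "V2 z" t]
    unfolding A_def A'_def l'_def w'_def s'_def E2'_def ldiff_def .
  finally show "(dsol \<gamma> V V1 has_field_derivative potential r t z * (amp \<gamma> z * V z) +
      amp \<gamma> z * (ldiff z ^ 2 / (1 - s z ^ 2) * (V2 z - V1 z + t * V z -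
        s z ^ 2 * (V2 z + ((2 * \<gamma> + 1/6) + (2 * \<gamma> + 5/6)) * V1 z + (2 * \<gamma> + 1/6) * (2 * \<gamma> + 5/6) * V z)))) (at z)"
    by (rule DERIV_cong) (simp add: algebra_simps)
qed

end

section \<open>Existence of charts\<close>

lemma holomorphic_powser:
  assumes "\<And>x. norm x < R \<Longrightarrow> summable (\<lambda>n. c n * x ^ n)"
  shows "powser c holomorphic_on ball 0 R"
  using assms by (intro power_series_holomorphic[of 0 R c]) (auto simp: powser_def summable_sums)

text \<open>At a zero of \<open>E6\<close> its derivative is -\<pi> \<i> E4^2, nonzero because the
  discriminant is. The zero is therefore simple, and s divided by \<open>z - z0\<close> has a
  holomorphic logarithm \<open>L\<close>. The bound \<rho> allows to keep s^2 inside a disc where a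
  given series has no zero.\<close>

lemma E6_zero_chart_exists:
  assumes z0: "z0 \<in> \<H>" "E6 z0 = 0" and \<rho>: "\<rho> > 0"
  obtains e h L where "E6_zero_chart z0 e h L" "\<And>z. z \<in> ball z0 e \<Longrightarrow> norm (((z - z0) * exp (L z)) ^ 2) < \<rho>"
proof -
  have E4z: "E4 z0 \<noteq> 0" by (rule E4_nonzero_if_E6_zero[OF z0])
  have cont: "continuous_on \<H> E4" by (rule holomorphic_on_imp_continuous_on[OF holomorphic_Eisenstein(2)])
  obtain e1 where e1: "e1 > 0" "ball z0 e1 \<subseteq> \<H>"
    using open_upper_half_plane z0(1) open_contains_ball by blast
  obtain e2 where e2: "e2 > 0" "\<And>z. dist z0 z < e2 \<Longrightarrow> E4 z \<noteq> 0"
    using continuous_on_open_avoid[OF cont open_upper_half_plane z0(1) E4z] by blast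
  define e3 where "e3 = min e1 e2"
  have e3: "e3 > 0" "ball z0 e3 \<subseteq> \<H>" "\<And>z. z \<in> ball z0 e3 \<Longrightarrow> E4 z \<noteq> 0"
    using e1 e2 by (auto simp: e3_def)
  have "E4 holomorphic_on ball z0 e3"
    using holomorphic_Eisenstein(2) e3(2) by (rule holomorphic_on_subset)
  then obtain h where h: "h holomorphic_on ball z0 e3" "\<And>z. z \<in> ball z0 e3 \<Longrightarrow> E4 z = exp (h z)"
    using contractible_imp_holomorphic_log[of E4 "ball z0 e3"] e3(3) convex_imp_contractible[OF convex_ball] by blast
  define q where "q = (\<lambda>z. E6 z * exp (- (3 / 2 * h z)))"
  have q_hol: "q holomorphic_on ball z0 e3"
    unfolding q_def by (intro holomorphic_intros h(1) holomorphic_on_subset[OF holomorphic_Eisenstein(3) e3(2)])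
  have q0: "q z0 = 0" by (simp add: q_def z0)
  define \<sigma> where "\<sigma> = (\<lambda>z. if z = z0 then deriv q z0 else (q z - q z0) / (z - z0))"
  have \<sigma>_hol: "\<sigma> holomorphic_on ball z0 e3"
    unfolding \<sigma>_def using q_hol by (intro pole_lemma_open) auto
  have q_\<sigma>: "q z = (z - z0) * \<sigma> z" for z by (simp add: \<sigma>_def q0)
  have "(h has_field_derivative deriv h z0) (at z0)"
    by (rule holomorphic_derivI[OF h(1) open_ball]) (use e3 in simp)
  then have "(q has_field_derivative 2 * of_real pi * \<i> * ((E2 z0 * E6 z0 - E4 z0 ^ 2) / 2) * exp (- (3 / 2 * h z0))) (at z0)"
    unfolding q_def by (auto intro!: derivative_eq_intros has_field_derivative_E6[OF z0(1)] simp: z0(2))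
  then have "\<sigma> z0 = 2 * of_real pi * \<i> * ((E2 z0 * E6 z0 - E4 z0 ^ 2) / 2) * exp (- (3 / 2 * h z0))"
    unfolding \<sigma>_def by (simp add: DERIV_imp_deriv)
  then have "\<sigma> z0 \<noteq> 0" using E4z z0(2) by simp
  moreover have "continuous_on (ball z0 e3) \<sigma>" by (rule holomorphic_on_imp_continuous_on[OF \<sigma>_hol])
  moreover have "z0 \<in> ball z0 e3" using e3 by simp
  ultimately obtain e4 where e4: "e4 > 0" "\<And>z. dist z0 z < e4 \<Longrightarrow> \<sigma> z \<noteq> 0"
    using continuous_on_open_avoid[of "ball z0 e3" \<sigma> z0 0] by auto
  have "isCont q z0"
    using q_hol e3(1) by (auto intro: holomorphic_on_ball_isCont)
  then have "(q \<longlongrightarrow> 0) (at z0)" unfolding isCont_def q0 .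
  then have "\<exists>d>0. \<forall>z. z \<noteq> z0 \<and> dist z z0 < d \<longrightarrow> dist (q z) 0 < min 1 \<rho>"
    using \<rho> unfolding tendsto_iff eventually_at by (metis (no_types, opaque_lifting) UNIV_I min_less_iff_conj zero_less_one)
  then obtain e5 where e5: "e5 > 0" "\<And>z. z \<noteq> z0 \<Longrightarrow> dist z z0 < e5 \<Longrightarrow> norm (q z) < min 1 \<rho>"
    by auto
  define e where "e = min e3 (min e4 e5)"
  have e: "e > 0" "ball z0 e \<subseteq> ball z0 e3" "\<And>z. z \<in> ball z0 e \<Longrightarrow> \<sigma> z \<noteq> 0"
    using e3 e4 e5 by (auto simp: e_def)
  have qs: "norm (q z) < min 1 \<rho>" if "z \<in> ball z0 e" for z
    using that e5(2)[of z] q0 \<rho> by (cases "z = z0") (auto simp: e_def dist_commute)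
  obtain L where L: "L holomorphic_on ball z0 e" "\<And>z. z \<in> ball z0 e \<Longrightarrow> \<sigma> z = exp (L z)"
    using contractible_imp_holomorphic_log[OF holomorphic_on_subset[OF \<sigma>_hol e(2)] convex_imp_contractible[OF convex_ball] e(3)] by blast
  have qL: "(z - z0) * exp (L z) = q z" if "z \<in> ball z0 e" for z
    using q_\<sigma> L(2)[OF that] by simp
  show thesis
  proof
    show "E6_zero_chart z0 e h L"
    proof
      show "e > 0" "L holomorphic_on ball z0 e" by fact+
      show "ball z0 e \<subseteq> \<H>" using e(2) e3(2) by blast
      show "h holomorphic_on ball z0 e" using h(1) e(2) by (rule holomorphic_on_subset)
      fix z assume z: "z \<in> ball z0 e"
      show "E4 z = exp (h z)" using h(2) e(2) z by blast
      show "norm ((z - z0) * exp (L z)) < 1" using qs[OF z] qL[OF z] by simp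
      show "E6 z = (z - z0) * exp (L z) * exp (3 / 2 * h z)"
        unfolding qL[OF z] q_def by (simp flip: exp_add add: mult.assoc)
    qed
    fix z assume z: "z \<in> ball z0 e"
    have "norm (q z) ^ 2 \<le> norm (q z) ^ 1"
      using qs[OF z] by (intro power_decreasing) auto
    then show "norm (((z - z0) * exp (L z)) ^ 2) < \<rho>"
      unfolding qL[OF z] norm_power using qs[OF z] by simp
  qed
qed

context E6_zero_chart
begin

section \<open>Frobenius series in a chart\<close>

definition series_sol :: "complex \<Rightarrow> complex \<Rightarrow> (nat \<Rightarrow> complex) \<Rightarrow> complex \<Rightarrow> complex" where
  "series_sol \<gamma> k c z = amp \<gamma> z * (exp ((1/2 + k) * \<Lambda> z) * powser c (exp (\<Lambda> z) ^ 2))"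

lemma \<Lambda>_derivative': "z \<in> slit_ball z0 e \<Longrightarrow> (\<Lambda> has_field_derivative ldiff z) (at z)"
  unfolding ldiff_def by (rule \<Lambda>_derivative)

lemma exp_\<Lambda>_slit: "z \<in> slit_ball z0 e \<Longrightarrow> exp (\<Lambda> z) = s z"
  by (rule exp_\<Lambda>) (rule slit_ballD(2))

text \<open>The coefficients are arbitrary and the defect is explicit, which serves two purposes:
  for Frobenius coefficients the defect is zero, and for a series known to be a solution the
  recurrence is read off from it.\<close>

lemma series_sol_derivatives:
  fixes \<gamma> k r t :: complex
  assumes c: "\<And>x. norm x < R \<Longrightarrow> summable (\<lambda>n. c n * x ^ n)"
    and R: "\<And>z. z \<in> ball z0 e \<Longrightarrow> norm (s z ^ 2) < R"
    and rt: "r + t = - 4 * \<gamma>^2" and t: "t = 1/4 - k^2"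
  shows "\<exists>y'. \<forall>z\<in>slit_ball z0 e. (series_sol \<gamma> k c has_field_derivative y' z) (at z) \<and>
     (y' has_field_derivative potential r t z * series_sol \<gamma> k c z +
       amp \<gamma> z * (ldiff z ^ 2 / (1 - s z ^ 2) * (exp ((1/2 + k) * \<Lambda> z) *
          powser (resid (2 * \<gamma> + 1/6) (2 * \<gamma> + 5/6) k c) (s z ^ 2)))) (at z)"
proof -
  define \<mu> where "\<mu> = 1/2 + k"
  define c1 where "c1 = (\<lambda>n. (2 * of_nat n + \<mu>) * c n)"
  define c2 where "c2 = (\<lambda>n. (2 * of_nat n + \<mu>) * c1 n)"
  define V where "V = (\<lambda>c z. exp (\<mu> * \<Lambda> z) * powser c (exp (\<Lambda> z) ^ 2))"
  have c1: "summable (\<lambda>n. c1 n * x ^ n)" if "norm x < R" for x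
    unfolding c1_def by (rule summable_affine_powser[OF c that])
  show ?thesis
  proof (intro exI ballI)
    fix z assume z: "z \<in> slit_ball z0 e"
    have sR: "norm (s z ^ 2) < R" using R slit_ballD(1)[OF z] .
    then have ER: "norm (exp (\<Lambda> z) ^ 2) < R" by (simp add: exp_\<Lambda>_slit[OF z])
    have V1: "(V c has_field_derivative ldiff z * V c1 z) (at z)"
      unfolding V_def c1_def by (rule has_field_derivative_exp_powser[OF c \<Lambda>_derivative'[OF z] ER])
    have V2: "(V c1 has_field_derivative ldiff z * V c2 z) (at z)"
      unfolding V_def c2_def by (rule has_field_derivative_exp_powser[OF c1 \<Lambda>_derivative'[OF z] ER])
    have res: "V c2 z - V c1 z + t * V c z -
        s z ^ 2 * (V c2 z + ((2 * \<gamma> + 1/6) + (2 * \<gamma> + 5/6)) * V c1 z + (2 * \<gamma> + 1/6) * (2 * \<gamma> + 5/6) * V c z) =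
        exp ((1/2 + k) * \<Lambda> z) * powser (resid (2 * \<gamma> + 1/6) (2 * \<gamma> + 5/6) k c) (s z ^ 2)"
    proof -
      have "powser c2 (s z ^ 2) - powser c1 (s z ^ 2) + (1/4 - k^2) * powser c (s z ^ 2) -
         s z ^ 2 * (powser c2 (s z ^ 2) + ((2 * \<gamma> + 1/6) + (2 * \<gamma> + 5/6)) * powser c1 (s z ^ 2) + (2 * \<gamma> + 1/6) * (2 * \<gamma> + 5/6) * powser c (s z ^ 2))
         = powser (resid (2 * \<gamma> + 1/6) (2 * \<gamma> + 5/6) k c) (s z ^ 2)"
        unfolding c2_def c1_def \<mu>_def by (rule powser_residual(2)[OF c sR])
      moreover have "E * p2 - E * p1 + T * (E * p0) - S * (E * p2 + A * (E * p1) + B * (E * p0)) =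
          E * (p2 - p1 + T * p0 - S * (p2 + A * p1 + B * p0))" for E p0 p1 p2 T S A B :: complex
        by (simp add: algebra_simps)
      ultimately show ?thesis
        unfolding V_def exp_\<Lambda>_slit[OF z] t \<mu>_def by metis
    qed
    have eq: "series_sol \<gamma> k c = (\<lambda>z. amp \<gamma> z * V c z)"
      by (rule ext) (simp add: series_sol_def V_def \<mu>_def)
    from chart_solution_derivatives[where V = "V c" and ?V1.0 = "V c1" and ?V2.0 = "V c2", OF z rt V1 V2]
    show "(series_sol \<gamma> k c has_field_derivative dsol \<gamma> (V c) (V c1) z) (at z) \<and>
     (dsol \<gamma> (V c) (V c1) has_field_derivative potential r t z * series_sol \<gamma> k c z +
       amp \<gamma> z * (ldiff z ^ 2 / (1 - s z ^ 2) * (exp ((1/2 + k) * \<Lambda> z) *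
          powser (resid (2 * \<gamma> + 1/6) (2 * \<gamma> + 5/6) k c) (s z ^ 2)))) (at z)"
      unfolding eq res by blast
  qed
qed

lemma frob_solution:
  assumes "frob_ok (2 * \<gamma> + 1/6) (2 * \<gamma> + 5/6) k" and rt: "r + t = - 4 * \<gamma>^2" and t: "t = 1/4 - k^2"
  obtains y' where "solves_on (slit_ball z0 e) (potential r t) (series_sol \<gamma> k (frob (2 * \<gamma> + 1/6) (2 * \<gamma> + 5/6) k)) y'"
proof -
  have "resid (2 * \<gamma> + 1/6) (2 * \<gamma> + 5/6) k (frob (2 * \<gamma> + 1/6) (2 * \<gamma> + 5/6) k) = (\<lambda>_. 0)"
    using resid_frob[OF assms(1)] by blast
  then have "powser (resid (2 * \<gamma> + 1/6) (2 * \<gamma> + 5/6) k (frob (2 * \<gamma> + 1/6) (2 * \<gamma> + 5/6) k)) x = 0" for x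
    by (simp add: powser_def)
  then show thesis
    using series_sol_derivatives[OF frob_summable norm_s_square rt t, of "2 * \<gamma> + 1/6" "2 * \<gamma> + 5/6" k] that
    unfolding solves_on_def by (metis (no_types, lifting) add_0_right mult_zero_right)
qed

definition regular_part :: "complex \<Rightarrow> complex \<Rightarrow> (nat \<Rightarrow> complex) \<Rightarrow> complex \<Rightarrow> complex" where
  "regular_part \<gamma> k c z = amp \<gamma> z * exp ((1/2 + k) * L z) * powser c (s z ^ 2)"

lemma series_sol_powr:
  assumes "z \<in> slit_ball z0 e"
  shows "series_sol \<gamma> k c z = (z - z0) powr (1/2 + k) * regular_part \<gamma> k c z"
proof -
  have "exp ((1/2 + k) * \<Lambda> z) = (z - z0) powr (1/2 + k) * exp ((1/2 + k) * L z)"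
    using slit_ballD(2)[OF assms] by (simp add: \<Lambda>_def powr_def distrib_left exp_add)
  then show ?thesis unfolding series_sol_def regular_part_def exp_\<Lambda>_slit[OF assms] by (simp add: mult_ac)
qed

lemma s_hol: "s holomorphic_on ball z0 e"
  unfolding s_def [abs_def] by (intro holomorphic_intros L_hol)

lemma amp_hol: "amp \<gamma> holomorphic_on ball z0 e"
  unfolding amp_def [abs_def]
  by (intro holomorphic_intros h_hol s_hol) (use one_minus_s_square(2) in auto)

lemma powser_s_hol:
  assumes c: "\<And>x. norm x < R \<Longrightarrow> summable (\<lambda>n. c n * x ^ n)"
    and R: "\<And>z. z \<in> ball z0 e \<Longrightarrow> norm (s z ^ 2) < R"
  shows "(\<lambda>z. powser c (s z ^ 2)) holomorphic_on ball z0 e"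
proof -
  have "(powser c \<circ> (\<lambda>z. s z ^ 2)) holomorphic_on ball z0 e"
    by (rule holomorphic_on_compose_gen[OF _ holomorphic_powser[OF c]])
       (use R in \<open>auto intro!: holomorphic_intros s_hol\<close>)
  then show ?thesis by (simp add: o_def)
qed

lemma regular_part_hol:
  assumes c: "\<And>x. norm x < R \<Longrightarrow> summable (\<lambda>n. c n * x ^ n)"
    and R: "\<And>z. z \<in> ball z0 e \<Longrightarrow> norm (s z ^ 2) < R"
  shows "regular_part \<gamma> k c holomorphic_on ball z0 e"
  unfolding regular_part_def [abs_def]
  by (intro holomorphic_intros amp_hol L_hol powser_s_hol[OF c R]) auto

lemma regular_part_at_center: "c 0 \<noteq> 0 \<Longrightarrow> regular_part \<gamma> k c z0 \<noteq> 0"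
  by (simp add: regular_part_def amp_nonzero s_def powser_0)

text \<open>The exponents 1/2 + n/2 and 1/2 - n/2 differ by the integer \<open>n\<close>, so two
  unobstructed Frobenius series form a pair as in \<open>no_log_singularity\<close>.\<close>

lemma no_log_if_frob_ok:
  fixes n :: nat and r t :: complex
  defines "k \<equiv> of_nat n / 2"
  assumes n: "n \<ge> 1" and rt: "r + t = - 4 * \<gamma>^2" and t: "t = 1/4 - k^2"
    and ok: "frob_ok (2 * \<gamma> + 1/6) (2 * \<gamma> + 5/6) k" "frob_ok (2 * \<gamma> + 1/6) (2 * \<gamma> + 5/6) (- k)"
  shows "\<not> (local_solution (potential r t) z0 e' y \<and> has_log_singularity y z0 e')"
proof -
  let ?f = "frob (2 * \<gamma> + 1/6) (2 * \<gamma> + 5/6)"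
  obtain u' where u: "solves_on (slit_ball z0 e) (potential r t) (series_sol \<gamma> k (?f k)) u'"
    using frob_solution[OF ok(1) rt t] .
  obtain v' where v: "solves_on (slit_ball z0 e) (potential r t) (series_sol \<gamma> (- k) (?f (- k))) v'"
    using frob_solution[OF ok(2) rt, of thesis] t by auto
  have k: "1/2 + k = (1/2 + - k) + of_nat n" by (simp add: k_def)
  show ?thesis
  proof (rule no_log_singularity[where P = "regular_part \<gamma> k (?f k)" and R = "regular_part \<gamma> (- k) (?f (- k))"
        and a = "1/2 + - k", OF e_pos n _ _ _ _ u _ v])
    show "regular_part \<gamma> k (?f k) holomorphic_on ball z0 e" "regular_part \<gamma> (- k) (?f (- k)) holomorphic_on ball z0 e"
      by (rule regular_part_hol[OF frob_summable norm_s_square]; assumption)+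
    show "regular_part \<gamma> k (?f k) z0 \<noteq> 0" "regular_part \<gamma> (- k) (?f (- k)) z0 \<noteq> 0"
      by (simp_all add: regular_part_at_center)
    fix z assume z: "z \<in> slit_ball z0 e"
    show "series_sol \<gamma> k (?f k) z = (z - z0) powr (1/2 + - k + of_nat n) * regular_part \<gamma> k (?f k) z"
      unfolding k[symmetric] by (rule series_sol_powr[OF z])
    show "series_sol \<gamma> (- k) (?f (- k)) z = (z - z0) powr (1/2 + - k) * regular_part \<gamma> (- k) (?f (- k)) z"
      by (rule series_sol_powr[OF z])
  qed
qed

section \<open>From the absence of logarithms to a vanishing numerator\<close>

lemma potential_hol: "potential r t holomorphic_on ball z0 e - {z0}"
proof -
  have "E6 z \<noteq> 0" if "z \<in> ball z0 e - {z0}" for z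
    using that by (auto simp: E6_w w_nonzero s_zero_iff)
  then show ?thesis
    unfolding potential_def [abs_def]
    by (intro holomorphic_intros holomorphic_on_subset[OF holomorphic_Eisenstein(2)]
        holomorphic_on_subset[OF holomorphic_Eisenstein(3)]) (use in_H in auto)
qed

lemma s_tendsto_0: "((\<lambda>x::real. s (z0 + of_real x) ^ 2) \<longlongrightarrow> 0) (at_right 0)"
proof -
  have "isCont s z0"
    using s_hol e_pos by (auto intro: holomorphic_on_ball_isCont)
  then have "((\<lambda>x::real. s (z0 + of_real x)) \<longlongrightarrow> s z0) (at_right 0)"
    using tendsto_along_slit(2) by (rule isCont_tendsto_compose)
  from tendsto_power[OF this, of 2] show ?thesis by (simp add: s_def)
qed

text \<open>s^2 takes nonzero values arbitrarily close to 0, while the zeros of a nonzero power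
  series are isolated.\<close>

lemma powser_zero_on_chart:
  assumes c: "\<And>x. norm x < R \<Longrightarrow> summable (\<lambda>n. c n * x ^ n)" "R > 0" "c 0 = 0"
    and zero: "\<And>z. z \<in> slit_ball z0 e \<Longrightarrow> powser c (s z ^ 2) = 0"
  shows "c n = 0"
proof (rule ccontr)
  assume n: "c n \<noteq> 0"
  then have "n > 0" using c(3) by (cases n) auto
  obtain d where d: "d > 0" "\<And>x. x \<in> cball 0 d - {0} \<Longrightarrow> powser c x \<noteq> 0"
    using powser_0_nonzero[OF c(2), of 0 c "powser c" n] n \<open>n > 0\<close> c(1,3)
    by (auto simp: powser_def summable_sums)
  have "eventually (\<lambda>x::real. dist (s (z0 + of_real x) ^ 2) 0 < d) (at_right 0)"
    using s_tendsto_0 d(1) by (rule tendstoD)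
  moreover have "eventually (\<lambda>x::real. 0 < x \<and> x < e) (at_right 0)"
    using e_pos by (auto simp: eventually_at_right_field)
  ultimately have "eventually (\<lambda>x::real. False) (at_right 0)"
  proof eventually_elim
    case (elim x)
    have z: "z0 + of_real x \<in> slit_ball z0 e"
      using elim by (simp add: slit_ball_def dist_norm complex_nonpos_Reals_iff)
    have "s (z0 + of_real x) ^ 2 \<in> cball 0 d - {0}"
      using elim by (simp add: s_zero_iff)
    then show False using zero[OF z] d(2) by blast
  qed
  then show False using trivial_limit_at_right_real by (simp add: eventually_False)
qed

text \<open>The second solution is \<open>y1 * J\<close> with \<open>J' = - \<i> \<pi> / y1^2\<close>.  The logarithm in \<open>J\<close> comes from a
  single coefficient \<open>g j\<close>; if it vanishes, \<open>y1 * J\<close> is a Frobenius series with the smaller exponent,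
  and its recurrence forces the product of the numerators to vanish.\<close>

lemma log_free_imp_product_zero:
  fixes j :: nat and \<gamma> r t :: complex
  defines "\<alpha> \<equiv> 2 * \<gamma> + 1/6" and "\<beta> \<equiv> 2 * \<gamma> + 5/6"
  assumes j: "j \<ge> 1" and rt: "r + t = - 4 * \<gamma>^2" and t: "t = 1/4 - (of_nat j)^2"
    and \<rho>: "0 < \<rho>" "\<rho> \<le> 1" and Fnz: "\<And>x. norm x < \<rho> \<Longrightarrow> powser (frob \<alpha> \<beta> (of_nat j)) x \<noteq> 0"
    and s\<rho>: "\<And>z. z \<in> ball z0 e \<Longrightarrow> norm (s z ^ 2) < \<rho>"
    and no_log: "\<And>y. \<not> (local_solution (potential r t) z0 e y \<and> has_log_singularity y z0 e)"
  shows "\<exists>m<j. (2 * of_nat m + (1/2 - of_nat j) + \<alpha>) * (2 * of_nat m + (1/2 - of_nat j) + \<beta>) = 0"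
proof -
  define f where "f = frob \<alpha> \<beta> (of_nat j)"
  have f_sum: "summable (\<lambda>n. f n * x ^ n)" if "norm x < \<rho>" for x
    unfolding f_def using that \<rho> by (intro frob_summable) simp
  have "of_nat (Suc m) + of_nat j \<noteq> (0::complex)" for m
    by (metis add_Suc of_nat_add of_nat_eq_0_iff nat.distinct(1))
  then have ok: "frob_ok \<alpha> \<beta> (of_nat j)" by (rule frob_okI_not_negative_integer)
  define y1 where "y1 = series_sol \<gamma> (of_nat j) f"
  obtain y1' where y1: "solves_on (slit_ball z0 e) (potential r t) y1 y1'"
    using frob_solution[OF ok[unfolded \<alpha>_def \<beta>_def] rt t] unfolding y1_def f_def \<alpha>_def \<beta>_def .
  \<comment> \<open>By the form of the amplitude, \<open>- ip / y1 z ^ 2\<close> is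
    \<open>ldiff z\<close> times s^(-2j) \<open>G\<close> evaluated at s^2. The summand 1 in the
    exponent compensates the factor 1 - s^2 of \<open>ldiff\<close>.\<close>
  define G where "G = (\<lambda>x. exp (- (1 + 2 * \<gamma>) * Ln (1 - x)) / powser f x ^ 2)"
  have "G holomorphic_on ball 0 \<rho>"
    unfolding G_def
  proof (intro holomorphic_intros holomorphic_powser f_sum)
    fix x :: complex assume x: "x \<in> ball 0 \<rho>"
    have "Re x < 1" using x \<rho> complex_Re_le_cmod[of x] by simp
    then show "1 - x \<notin> \<real>\<^sub>\<le>\<^sub>0" by (auto simp: complex_nonpos_Reals_iff)
    show "powser f x ^ 2 \<noteq> 0" using Fnz[of x] x by (simp add: f_def)
  qed
  define g where "g = (\<lambda>n. (deriv ^^ n) G 0 / fact n)"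
  have G_sums: "(\<lambda>n. g n * x ^ n) sums G x" if "norm x < \<rho>" for x
    using holomorphic_power_series[OF \<open>G holomorphic_on ball 0 \<rho>\<close>, of x] that by (simp add: g_def)
  have g0: "g 0 = 1" by (simp add: g_def G_def powser_0 f_def)
  \<comment> \<open>Termwise integration with respect to \<Lambda>: s^(2n - 2j) has the primitive
    s^(2n - 2j) / (2n - 2j). For \<open>n = j\<close> division by zero makes the coefficient 0; that
    term integrates to \<open>g j * \<Lambda> z\<close> instead.\<close>
  define \<eta> where "\<eta> = (\<lambda>n. g n / (2 * of_nat n - 2 * of_nat j))"
  have \<eta>g: "(2 * of_nat n + (- 2 * of_nat j)) * \<eta> n = g n - (if n = j then g j else 0)" for n
    by (simp add: \<eta>_def)
  have \<eta>_sum: "summable (\<lambda>n. \<eta> n * x ^ n)" if x: "norm x < \<rho>" for x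
  proof -
    obtain x' where x': "norm x < x'" "x' < \<rho>" using dense[OF x] by blast
    then have x'0: "x' > 0" using norm_ge_zero[of x] by linarith
    have "summable (\<lambda>n. norm (g n * x ^ n))"
      by (rule powser_insidea[of g "of_real x'"]) (use x' x'0 G_sums[of "of_real x'"] in \<open>auto simp: sums_iff\<close>)
    moreover have "norm (\<eta> n * x ^ n) \<le> norm (g n * x ^ n)" for n
    proof (cases "n = j")
      case False
      have "1 \<le> \<bar>2 * real n - 2 * real j\<bar>" using False by linarith
      also have "\<dots> = norm (of_real (2 * real n - 2 * real j) :: complex)" by (simp only: norm_of_real)
      finally have "norm (2 * of_nat n - 2 * of_nat j :: complex) \<ge> 1" by simp
      then have "norm (\<eta> n) \<le> norm (g n)"
        unfolding \<eta>_def norm_divide by (simp add: divide_le_eq mult_left_le order_less_le_trans[OF zero_less_one] mult_le_cancel_left1)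
      then show ?thesis unfolding norm_mult by (intro mult_right_mono) auto
    qed (simp add: \<eta>_def)
    ultimately show ?thesis by (rule summable_comparison_test'[where N = 0])
  qed
  have \<eta>_ode: "powser (\<lambda>n. (2 * of_nat n + (- 2 * of_nat j)) * \<eta> n) x + g j * x ^ j = G x" if x: "norm x < \<rho>" for x
  proof -
    have "(\<lambda>n. (if n = j then g j * x ^ j else 0)) sums (g j * x ^ j)"
      using sums_single[of j "\<lambda>_. g j * x ^ j"] by simp
    from sums_diff[OF G_sums[OF x] this]
    have "(\<lambda>n. g n * x ^ n - (if n = j then g j * x ^ j else 0)) sums (G x - g j * x ^ j)" .
    moreover have "g n * x ^ n - (if n = j then g j * x ^ j else 0) = (2 * of_nat n + (- 2 * of_nat j)) * \<eta> n * x ^ n" for n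
      unfolding \<eta>g by (simp add: left_diff_distrib)
    ultimately show ?thesis by (simp add: powser_def sums_iff)
  qed
  define J where "J = (\<lambda>z. exp (- 2 * of_nat j * \<Lambda> z) * powser \<eta> (exp (\<Lambda> z) ^ 2) + g j * \<Lambda> z)"
  have y1_nz: "y1 z \<noteq> 0" if "z \<in> slit_ball z0 e" for z
    using Fnz[OF s\<rho>[OF slit_ballD(1)[OF that]]]
    by (simp add: y1_def series_sol_def amp_nonzero f_def exp_\<Lambda>_slit[OF that])
  have dJ: "(J has_field_derivative - ip / y1 z ^ 2) (at z)" if z: "z \<in> slit_ball z0 e" for z
  proof -
    note zb = slit_ballD(1)[OF z]
    define x where "x = s z ^ 2"
    have x: "norm x < \<rho>" using s\<rho>[OF zb] by (simp add: x_def)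
    have ex: "exp (\<Lambda> z) ^ 2 = x" by (simp add: x_def exp_\<Lambda>_slit[OF z])
    then have ex\<rho>: "norm (exp (\<Lambda> z) ^ 2) < \<rho>" using x by simp
    have "(J has_field_derivative ldiff z * (exp (- 2 * of_nat j * \<Lambda> z) *
        powser (\<lambda>n. (2 * of_nat n + (- 2 * of_nat j)) * \<eta> n) (exp (\<Lambda> z) ^ 2)) + g j * ldiff z) (at z)"
      unfolding J_def
      by (intro DERIV_add DERIV_cmult has_field_derivative_exp_powser[OF \<eta>_sum \<Lambda>_derivative'[OF z] ex\<rho>] \<Lambda>_derivative'[OF z])
    then have "(J has_field_derivative ldiff z * (exp (- 2 * of_nat j * \<Lambda> z) * G x)) (at z)"
    proof (rule DERIV_cong)
      have "exp (- 2 * of_nat j * \<Lambda> z) * x ^ j = 1"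
      proof -
        have "x ^ j = exp (2 * of_nat j * \<Lambda> z)"
          unfolding ex[symmetric] by (simp add: mult_ac flip: exp_of_nat_mult)
        then show ?thesis by (simp flip: exp_add)
      qed
      then have E: "exp (- 2 * of_nat j * \<Lambda> z) * (P + g j * x ^ j) = exp (- 2 * of_nat j * \<Lambda> z) * P + g j" for P
        by (simp only: distrib_left mult.left_commute[of _ "g j"] mult_1_right)
      then show "ldiff z * (exp (- 2 * of_nat j * \<Lambda> z) *
        powser (\<lambda>n. (2 * of_nat n + (- 2 * of_nat j)) * \<eta> n) (exp (\<Lambda> z) ^ 2)) + g j * ldiff z = ldiff z * (exp (- 2 * of_nat j * \<Lambda> z) * G x)"
        unfolding ex \<eta>_ode[OF x, symmetric] E by (simp only: distrib_left mult.commute[of "g j"])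
    qed
    also have "ldiff z * (exp (- 2 * of_nat j * \<Lambda> z) * G x) = - ip / y1 z ^ 2"
    proof -
      define F where "F = powser f x"
      have F: "F \<noteq> 0" using Fnz[OF x] by (simp add: F_def f_def)
      have "y1 z ^ 2 = exp (- h z / 2 + 2 * \<gamma> * Ln (1 - x) + (1 + 2 * of_nat j) * \<Lambda> z) * F ^ 2"
        unfolding y1_def series_sol_def ex F_def[symmetric] amp_def x_def[symmetric]
        by (simp add: power_mult_distrib algebra_simps flip: exp_double exp_add)
      then have "exp (- 2 * of_nat j * \<Lambda> z) * G x * y1 z ^ 2 =
          exp (- 2 * of_nat j * \<Lambda> z) * exp (- (1 + 2 * \<gamma>) * Ln (1 - x)) * exp (- h z / 2 + 2 * \<gamma> * Ln (1 - x) + (1 + 2 * of_nat j) * \<Lambda> z)"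
        using F unfolding G_def F_def[symmetric] by simp
      also have "\<dots> = exp (- (h z / 2)) * exp (\<Lambda> z) * exp (- Ln (1 - x))"
        unfolding exp_add[symmetric] by (rule arg_cong[of _ _ exp]) (simp add: algebra_simps)
      also have "\<dots> = s z / (w z * (1 - s z ^ 2))"
        using one_minus_s_square[OF zb] by (simp add: exp_minus exp_\<Lambda>_slit[OF z] w_def x_def field_simps)
      finally have "ldiff z * (exp (- 2 * of_nat j * \<Lambda> z) * G x) * y1 z ^ 2 = ldiff z * (s z / (w z * (1 - s z ^ 2)))"
        by (simp only: mult.assoc)
      also have "\<dots> = - ip"
        using one_minus_s_square[OF zb] w_nonzero s_zero_iff slit_ballD(2)[OF z] by (simp add: ldiff_def)
      finally show ?thesis using y1_nz[OF z] by (simp add: field_simps)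
    qed
    finally show ?thesis .
  qed
  define y2 where "y2 = (\<lambda>z. y1 z * J z)"
  define y2' where "y2' = (\<lambda>z. y1' z * J z - ip / y1 z)"
  have y2: "solves_on (slit_ball z0 e) (potential r t) y2 y2'"
    unfolding solves_on_def
  proof (intro ballI conjI)
    fix z assume z: "z \<in> slit_ball z0 e"
    have d: "(y1 has_field_derivative y1' z) (at z)" "(y1' has_field_derivative potential r t z * y1 z) (at z)"
      using y1 z by (auto simp: solves_on_def)
    show "(y2 has_field_derivative y2' z) (at z)"
      unfolding y2_def y2'_def
      by (rule DERIV_cong[OF DERIV_mult[OF d(1) dJ[OF z]]]) (use y1_nz[OF z] in \<open>simp add: power2_eq_square\<close>)
    show "(y2' has_field_derivative potential r t z * y2 z) (at z)"
      unfolding y2_def y2'_def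
      by (rule DERIV_cong[OF DERIV_diff[OF DERIV_mult[OF d(2) dJ[OF z]] DERIV_divide[OF DERIV_const d(1) y1_nz[OF z]]]])
         (use y1_nz[OF z] in \<open>simp add: power2_eq_square field_simps\<close>)
  qed
  have "g j = 0"
  proof (rule ccontr)
    assume gj: "g j \<noteq> 0"
    define B where "B = (\<lambda>z. amp \<gamma> z * exp ((1/2 - of_nat j) * L z))"
    \<comment> \<open>The power \<open>s z ^ (2 * j)\<close> makes up for the difference of the
      exponents, so that both parts of \<open>y2\<close> share the exponent 1/2 - j. The summand
      \<open>L\<close> of \<Lambda> is holomorphic and belongs to \<open>ff\<close>.\<close>
    define ff where "ff = (\<lambda>z. B z * (powser f (s z ^ 2) * powser \<eta> (s z ^ 2) + g j * s z ^ (2 * j) * powser f (s z ^ 2) * L z))"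
    define gg where "gg = (\<lambda>z. B z * (g j * s z ^ (2 * j) * powser f (s z ^ 2)))"
    have hB: "B holomorphic_on ball z0 e"
      unfolding B_def by (intro holomorphic_intros amp_hol L_hol)
    have hc: "(\<lambda>z. powser f (s z ^ 2)) holomorphic_on ball z0 e" "(\<lambda>z. powser \<eta> (s z ^ 2)) holomorphic_on ball z0 e"
      by (rule powser_s_hol[OF f_sum s\<rho>] powser_s_hol[OF \<eta>_sum s\<rho>]; assumption)+
    have hol: "ff holomorphic_on ball z0 e" "gg holomorphic_on ball z0 e"
      unfolding ff_def gg_def by (intro holomorphic_intros hB hc s_hol L_hol)+
    have "\<exists>z\<in>ball z0 e. gg z \<noteq> 0"
    proof
      let ?p = "z0 + of_real (e / 2)"
      show p: "?p \<in> ball z0 e" using e_pos by (simp add: dist_norm)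
      show "gg ?p \<noteq> 0"
        using gj Fnz[OF s\<rho>[OF p]] e_pos s_zero_iff[of ?p] by (simp add: gg_def B_def amp_nonzero f_def)
    qed
    moreover have "y2 z = (z - z0) powr (1/2 - of_nat j) * (ff z + gg z * Ln (z - z0))" if z: "z \<in> slit_ball z0 e" for z
    proof -
      define W where "W = exp ((1/2 - of_nat j) * Ln (z - z0))"
      have p: "(z - z0) powr (1/2 - of_nat j) = W"
        using slit_ballD(2)[OF z] by (simp add: W_def powr_def)
      define X where "X = exp (\<Lambda> z)"
      have X: "exp (of_nat j * 2 * \<Lambda> z) = X ^ (2 * j)"
        unfolding X_def by (simp add: mult_ac flip: exp_of_nat_mult)
      have e1: "exp ((1/2 + of_nat j) * \<Lambda> z) = W * exp ((1/2 - of_nat j) * L z) * X ^ (2 * j)"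
        unfolding X[symmetric] W_def exp_add[symmetric] \<Lambda>_def by (rule arg_cong[of _ _ exp]) (simp add: algebra_simps)
      have e2: "X ^ (2 * j) * exp (- 2 * of_nat j * \<Lambda> z) = 1"
        unfolding X[symmetric] exp_add[symmetric] by (simp add: algebra_simps)
      have sX: "s z = X" by (simp add: X_def exp_\<Lambda>_slit[OF z])
      have "y2 z = amp \<gamma> z * (W * exp ((1/2 - of_nat j) * L z) * X ^ (2 * j) * powser f (X ^ 2)) *
          (exp (- 2 * of_nat j * \<Lambda> z) * powser \<eta> (X ^ 2) + g j * (Ln (z - z0) + L z))"
        unfolding y2_def y1_def series_sol_def J_def e1 X_def[symmetric] by (simp add: \<Lambda>_def)
      also have "\<dots> = W * (B z * (powser f (X ^ 2) * powser \<eta> (X ^ 2) * (X ^ (2 * j) * exp (- 2 * of_nat j * \<Lambda> z))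
          + g j * X ^ (2 * j) * powser f (X ^ 2) * L z) + B z * (g j * X ^ (2 * j) * powser f (X ^ 2)) * Ln (z - z0))"
        unfolding B_def by (simp add: algebra_simps)
      finally show ?thesis unfolding e2 p ff_def gg_def sX by simp
    qed
    ultimately have "has_log_singularity y2 z0 e"
      unfolding has_log_singularity_def using hol by blast
    then show False
      using no_log solves_on_imp_local_solution[OF y2 e_pos potential_hol] by blast
  qed
  \<comment> \<open>Without logarithm \<open>y1 * J\<close> is a series with exponent 1/2 - j whose
    coefficients are this Cauchy product; the first one is -1 / (2j).\<close>
  define v where "v = (\<lambda>n. \<Sum>i\<le>n. f i * \<eta> (n - i))"
  have v_sums: "(\<lambda>n. v n * x ^ n) sums (powser f x * powser \<eta> x)" if x: "norm x < \<rho>" for x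
  proof -
    obtain x' where x': "norm x < x'" "x' < \<rho>" using dense[OF x] by blast
    then have x'0: "x' > 0" using norm_ge_zero[of x] by linarith
    have "summable (\<lambda>n. norm (f n * x ^ n))" "summable (\<lambda>n. norm (\<eta> n * x ^ n))"
      by (rule powser_insidea[of _ "of_real x'"]; use x' x'0 f_sum[of "of_real x'"] \<eta>_sum[of "of_real x'"] in simp)+
    from Cauchy_product_sums[OF this]
    have "(\<lambda>n. \<Sum>i\<le>n. f i * x ^ i * (\<eta> (n - i) * x ^ (n - i))) sums (powser f x * powser \<eta> x)"
      by (simp add: powser_def)
    moreover have "(\<Sum>i\<le>n. f i * x ^ i * (\<eta> (n - i) * x ^ (n - i))) = v n * x ^ n" for n
      unfolding v_def sum_distrib_right
      by (intro sum.cong refl) (simp add: mult_ac flip: power_add)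
    ultimately show ?thesis by simp
  qed
  have v_sum: "summable (\<lambda>n. v n * x ^ n)" if "norm x < \<rho>" for x using v_sums[OF that] by (rule sums_summable)
  have v0: "v 0 \<noteq> 0" using g0 j by (simp add: v_def f_def \<eta>_def)
  have y2_series: "y2 z = series_sol \<gamma> (- of_nat j) v z" if z: "z \<in> slit_ball z0 e" for z
  proof -
    define X where "X = exp (\<Lambda> z) ^ 2"
    have X: "norm X < \<rho>" using s\<rho>[OF slit_ballD(1)[OF z]] by (simp add: X_def exp_\<Lambda>_slit[OF z])
    have "powser v X = powser f X * powser \<eta> X"
      using sums_unique[OF v_sums[OF X]] by (simp add: powser_def)
    moreover have "exp ((1/2 + of_nat j) * \<Lambda> z) * exp (- 2 * of_nat j * \<Lambda> z) = exp ((1/2 + - of_nat j) * \<Lambda> z)"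
      unfolding exp_add[symmetric] by (rule arg_cong[of _ _ exp]) (simp add: algebra_simps)
    then have "a * (exp ((1/2 + of_nat j) * \<Lambda> z) * b) * (exp (- 2 * of_nat j * \<Lambda> z) * c) = a * (exp ((1/2 + - of_nat j) * \<Lambda> z) * (b * c))" for a b c
      by (simp only: flip: \<open>_ = exp ((1/2 + - of_nat j) * \<Lambda> z)\<close>) (simp only: mult_ac)
    ultimately show ?thesis
      unfolding y2_def y1_def series_sol_def J_def X_def[symmetric] \<open>g j = 0\<close> by simp
  qed
  have t': "t = 1/4 - (- of_nat j)^2" using t by simp
  obtain y3' where y3: "\<And>z. z \<in> slit_ball z0 e \<Longrightarrow> (series_sol \<gamma> (- of_nat j) v has_field_derivative y3' z) (at z)"
    "\<And>z. z \<in> slit_ball z0 e \<Longrightarrow> (y3' has_field_derivative potential r t z * series_sol \<gamma> (- of_nat j) v z +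
       amp \<gamma> z * (ldiff z ^ 2 / (1 - s z ^ 2) * (exp ((1/2 + - of_nat j) * \<Lambda> z) *
          powser (resid \<alpha> \<beta> (- of_nat j) v) (s z ^ 2)))) (at z)"
    using series_sol_derivatives[OF v_sum s\<rho> rt t'] unfolding \<alpha>_def \<beta>_def by blast
  have resid_0: "resid \<alpha> \<beta> (- of_nat j) v n = 0" for n
  proof (rule powser_zero_on_chart[OF powser_residual(1)[OF v_sum] \<rho>(1)])
    fix z assume z: "z \<in> slit_ball z0 e"
    \<comment> \<open>The series and \<open>y2\<close> are the same function; comparing the two
      expressions for its second derivative isolates the defect.\<close>
    have y3y2: "y3' z = y2' z" if "z \<in> slit_ball z0 e" for z
    proof -
      have "(series_sol \<gamma> (- of_nat j) v has_field_derivative y2' z) (at z)"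
        by (rule has_field_derivative_transform_within_open[OF _ open_slit_ball that y2_series])
           (use y2 that in \<open>auto simp: solves_on_def\<close>)
      with y3(1)[OF that] show ?thesis by (rule DERIV_unique)
    qed
    have "(y2' has_field_derivative potential r t z * y2 z) (at z)"
      using y2 z by (simp add: solves_on_def)
    then have "(y3' has_field_derivative potential r t z * y2 z) (at z)"
      by (rule has_field_derivative_transform_within_open[OF _ open_slit_ball z y3y2[symmetric]])
    from DERIV_unique[OF this y3(2)[OF z]] y2_series[OF z]
    have "amp \<gamma> z * (ldiff z ^ 2 / (1 - s z ^ 2) * (exp ((1/2 + - of_nat j) * \<Lambda> z) *
          powser (resid \<alpha> \<beta> (- of_nat j) v) (s z ^ 2))) = 0" by simp
    then show "powser (resid \<alpha> \<beta> (- of_nat j) v) (s z ^ 2) = 0"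
      using amp_nonzero ldiff_nonzero[OF z] one_minus_s_square[OF slit_ballD(1)[OF z]] by simp
  qed (simp_all add: resid_def)
  show ?thesis by (rule resid_zero_imp_product_zero[OF resid_0 v0 j])
qed

end

section \<open>Apparentness\<close>

text \<open>E4^4 / E6^2 equals w^2 / s^2, and s has the derivative -\<i> \<pi> w at the centre. The
  factor \<pi>^2 of the potential therefore cancels and a sign remains.\<close>

lemma potential_scaled_limit:
  assumes z0: "z0 \<in> \<H>" "E6 z0 = 0"
  shows "((\<lambda>z. (z - z0) ^ 2 * potential r t z) \<longlongrightarrow> - t) (at z0)"
proof -
  obtain e h L where "E6_zero_chart z0 e h L"
    using E6_zero_chart_exists[OF z0 zero_less_one] .
  then interpret E6_zero_chart z0 e h L .
  have z0b: "z0 \<in> ball z0 e" using e_pos by simp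
  have cont: "isCont f z0" if "f holomorphic_on ball z0 e" for f
    using that e_pos by (auto intro: holomorphic_on_ball_isCont)
  have "w holomorphic_on ball z0 e" unfolding w_def [abs_def] by (intro holomorphic_intros h_hol) auto
  then have w: "(w \<longlongrightarrow> w z0) (at z0)" using cont unfolding isCont_def by blast
  have L: "(L \<longlongrightarrow> L z0) (at z0)" using cont[OF L_hol] unfolding isCont_def .
  have "((\<lambda>z. of_real pi ^ 2 * ((z - z0) ^ 2 * r * w z ^ 2 + t * (w z ^ 2 * exp (- 2 * L z)))) \<longlongrightarrow>
     of_real pi ^ 2 * ((z0 - z0) ^ 2 * r * w z0 ^ 2 + t * (w z0 ^ 2 * exp (- 2 * L z0)))) (at z0)"
    by (intro tendsto_intros w L)
  moreover have "eventually (\<lambda>z. of_real pi ^ 2 * ((z - z0) ^ 2 * r * w z ^ 2 + t * (w z ^ 2 * exp (- 2 * L z))) =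
      (z - z0) ^ 2 * potential r t z) (at z0)"
    unfolding eventually_at
  proof (intro exI[of _ e] conjI ballI impI e_pos)
    fix z assume "z \<noteq> z0 \<and> dist z z0 < e"
    then have z: "z \<in> ball z0 e" "z \<noteq> z0" by (auto simp: dist_commute)
    have "(z - z0) ^ 2 * (E4 z ^ 4 / E6 z ^ 2) = w z ^ 2 * exp (- 2 * L z)"
    proof -
      have "E6 z ^ 2 = (z - z0) ^ 2 * exp (2 * L z) * w z ^ 6"
        unfolding E6_w[OF z(1)] s_def by (simp add: power_mult_distrib exp_double flip: power_mult)
      moreover have "E4 z ^ 4 = w z ^ 2 * w z ^ 6"
        unfolding E4_w[OF z(1)] by (simp flip: power_mult power_add)
      ultimately show ?thesis
        using z(2) w_nonzero[of z] by (simp add: exp_minus field_simps)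
    qed
    moreover have "a * (p * (r * b ^ 2 + t * c)) = p * (a * r * b ^ 2 + t * (a * c))" for a b c p :: complex
      by (simp add: algebra_simps)
    ultimately show "of_real pi ^ 2 * ((z - z0) ^ 2 * r * w z ^ 2 + t * (w z ^ 2 * exp (- 2 * L z))) = (z - z0) ^ 2 * potential r t z"
      unfolding potential_def by (metis E4_w[OF z(1)])
  qed
  ultimately have "((\<lambda>z. (z - z0) ^ 2 * potential r t z) \<longlongrightarrow>
     of_real pi ^ 2 * ((z0 - z0) ^ 2 * r * w z0 ^ 2 + t * (w z0 ^ 2 * exp (- 2 * L z0)))) (at z0)"
    by (rule Lim_transform_eventually)
  moreover have "of_real pi ^ 2 * ((z0 - z0) ^ 2 * r * w z0 ^ 2 + t * (w z0 ^ 2 * exp (- 2 * L z0))) = - t"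
  proof -
    have "(L has_field_derivative deriv L z0) (at z0)"
      by (rule holomorphic_derivI[OF L_hol open_ball z0b])
    then have "(s has_field_derivative exp (L z0)) (at z0)"
      unfolding s_def [abs_def] by (auto intro!: derivative_eq_intros)
    from DERIV_unique[OF this s_derivative[OF z0b]] have "exp (L z0) = - ip * w z0"
      by (simp add: s_def)
    then have "exp (2 * L z0) = - (of_real pi ^ 2 * w z0 ^ 2)"
      by (simp add: exp_double power_mult_distrib)
    then show ?thesis using w_nonzero[of z0] by (simp add: exp_minus field_simps)
  qed
  ultimately show ?thesis by simp
qed

lemma potential_isolated_singularity:
  assumes z0: "z0 \<in> \<H>" "E6 z0 = 0"
  shows "isolated_singularity_at (potential r t) z0"
proof -
  obtain e h L where "E6_zero_chart z0 e h L"
    using E6_zero_chart_exists[OF z0 zero_less_one] .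
  then interpret E6_zero_chart z0 e h L .
  have "potential r t analytic_on ball z0 e - {z0}"
    using potential_hol by (subst analytic_on_open) (auto intro: open_delete)
  then show ?thesis unfolding isolated_singularity_at_def using e_pos by blast
qed

text \<open>The exponents add up to 1 for every \<open>t\<close>; the information is in their
  product 1/4 - k^2, which must be \<open>t\<close> because the limit is \<open>-t\<close>.\<close>

lemma has_local_exponents_iff:
  assumes z0: "z0 \<in> \<H>" "E6 z0 = 0"
  shows "has_local_exponents (potential r t) z0 (1/2 - k) (1/2 + k) \<longleftrightarrow> t = 1/4 - k^2"
proof -
  have "has_local_exponents (potential r t) z0 (1/2 - k) (1/2 + k) \<longleftrightarrow>
      [:0, 1:] * [:-1, 1:] - [:- t:] = [:- (1/2 - k), 1:] * [:- (1/2 + k), 1:]"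
    (is "?l \<longleftrightarrow> ?p (- t)")
  proof
    assume ?l
    then obtain c where "((\<lambda>z. (z - z0)^2 * potential r t z) \<longlongrightarrow> c) (at z0)" "?p c"
      unfolding has_local_exponents_def by blast
    moreover from this(1) have "c = - t"
      by (rule tendsto_unique[OF at_neq_bot _ potential_scaled_limit[OF z0]])
    ultimately show "?p (- t)" by simp
  next
    assume "?p (- t)"
    then show ?l
      unfolding has_local_exponents_def
      using potential_isolated_singularity[OF z0] potential_scaled_limit[OF z0, of r t] by blast
  qed
  also have "\<dots> \<longleftrightarrow> t = 1/4 - k^2"
    by (auto simp: algebra_simps power2_eq_square)
  finally show ?thesis .
qed

lemma pole_imp_E6_zero:
  assumes z0: "z0 \<in> \<H>" and pole: "is_pole (potential r t) z0"
  shows "E6 z0 = 0"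
proof (rule ccontr)
  assume E6: "E6 z0 \<noteq> 0"
  have "isCont E4 z0" "isCont E6 z0"
    using has_field_derivative_E4[OF z0] has_field_derivative_E6[OF z0] DERIV_isCont by blast+
  then have "(potential r t \<longlongrightarrow> potential r t z0) (at z0)"
    unfolding potential_def [abs_def] isCont_def using E6 by (intro tendsto_intros) auto
  then show False
    using pole not_tendsto_and_filterlim_at_infinity[OF at_neq_bot] unfolding is_pole_def by blast
qed

lemma E6_zero_imp_pole:
  assumes z0: "z0 \<in> \<H>" "E6 z0 = 0" and t: "t \<noteq> 0"
  shows "is_pole (potential r t) z0"
proof -
  have "((\<lambda>z. (z - z0) ^ 2) \<longlongrightarrow> (z0 - z0) ^ 2) (at z0)" by (intro tendsto_intros)
  then have "filterlim (\<lambda>z. (z - z0) ^ 2) (at 0) (at z0)"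
    by (intro filterlim_atI) (auto simp: eventually_at intro: exI[of _ 1])
  from filterlim_divide_at_infinity[OF potential_scaled_limit[OF z0, of r t] this] t
  have "filterlim (\<lambda>z. (z - z0) ^ 2 * potential r t z / (z - z0) ^ 2) at_infinity (at z0)" by simp
  then show ?thesis unfolding is_pole_def
    by (rule filterlim_cong[THEN iffD1, rotated -1]) (auto simp: eventually_at intro: exI[of _ 1])
qed

section \<open>Criteria for apparentness\<close>

lemma apparent_if_frob_ok:
  fixes n :: nat and r t :: complex
  defines "k \<equiv> of_nat n / 2"
  assumes n: "n \<ge> 1" and rt: "r + t = - 4 * \<gamma>^2" and t: "t = 1/4 - k^2"
    and ok: "frob_ok (2 * \<gamma> + 1/6) (2 * \<gamma> + 5/6) k" "frob_ok (2 * \<gamma> + 1/6) (2 * \<gamma> + 5/6) (- k)"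
  shows "apparent (potential r t)"
  unfolding apparent_def
proof (intro ballI impI conjI)
  fix z0 assume z0: "z0 \<in> \<H>" and "is_pole (potential r t) z0"
  then have E6: "E6 z0 = 0" by (rule pole_imp_E6_zero)
  show "\<exists>n::nat. let \<kappa> = of_nat n / 2 in has_local_exponents (potential r t) z0 (1/2 - \<kappa>) (1/2 + \<kappa>)"
    using has_local_exponents_iff[OF z0 E6] t unfolding k_def Let_def by blast
  obtain e h L where "E6_zero_chart z0 e h L"
    using E6_zero_chart_exists[OF z0 E6 zero_less_one] .
  then interpret E6_zero_chart z0 e h L .
  show "\<nexists>y e. local_solution (potential r t) z0 e y \<and> has_log_singularity y z0 e"
    using no_log_if_frob_ok[OF n rt t[unfolded k_def] ok[unfolded k_def]] by blast
qed

text \<open>Apparentness is exploited at the pole \<open>\<i>\<close>. The chart there is shrunk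
  until the series with the larger exponent has no zero, so that the square of that solution can be
  inverted.\<close>

lemma apparent_imp_product_zero:
  fixes k :: nat
  assumes k: "k \<ge> 1" and rt: "r + t = - 4 * \<gamma>^2" and t: "t = 1/4 - (of_nat k)^2"
    and app: "apparent (potential r t)"
  shows "\<exists>m<k. (2 * of_nat m + (1/2 - of_nat k) + (2 * \<gamma> + 1/6)) * (2 * of_nat m + (1/2 - of_nat k) + (2 * \<gamma> + 5/6)) = 0"
proof -
  let ?F = "powser (frob (2 * \<gamma> + 1/6) (2 * \<gamma> + 5/6) (of_nat k))"
  have "continuous_on (ball 0 1) ?F"
    by (intro holomorphic_on_imp_continuous_on holomorphic_powser frob_summable)
  moreover have "?F 0 \<noteq> 0" by (simp add: powser_0)
  ultimately obtain d where d: "d > 0" "\<And>x. dist 0 x < d \<Longrightarrow> ?F x \<noteq> 0"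
    using continuous_on_open_avoid[of "ball 0 1" ?F 0 0] by auto
  define \<rho> where "\<rho> = min d 1"
  have \<rho>: "0 < \<rho>" "\<rho> \<le> 1" "\<And>x. norm x < \<rho> \<Longrightarrow> ?F x \<noteq> 0" using d by (auto simp: \<rho>_def)
  obtain e h L where chart: "E6_zero_chart \<i> e h L" and sm: "\<And>z. z \<in> ball \<i> e \<Longrightarrow> norm (((z - \<i>) * exp (L z)) ^ 2) < \<rho>"
    using E6_zero_chart_exists[OF i_in_upper_half_plane E6_i \<rho>(1)] by blast
  interpret E6_zero_chart \<i> e h L by (rule chart)
  \<comment> \<open>Otherwise \<open>\<i>\<close> would not be a pole; \<open>t = 0\<close> would
    mean \<open>4 * k^2 = 1\<close>.\<close>
  have "t \<noteq> 0"
  proof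
    assume "t = 0"
    then have "(of_nat (4 * k^2) :: complex) = of_nat 1" using t by (simp add: field_simps)
    then have "4 * k^2 = 1" by (simp only: of_nat_eq_iff)
    then show False by presburger
  qed
  then have "is_pole (potential r t) \<i>" by (rule E6_zero_imp_pole[OF i_in_upper_half_plane E6_i])
  then have "\<not> (local_solution (potential r t) \<i> e y \<and> has_log_singularity y \<i> e)" for y
    using app i_in_upper_half_plane unfolding apparent_def by blast
  then show ?thesis
    by (intro log_free_imp_product_zero[OF k rt t \<rho>]) (use sm in \<open>auto simp: s_def\<close>)
qed

lemma exists_gamma: "\<exists>\<gamma>. r + t = - 4 * \<gamma>^2" for r t :: complex
  by (rule exI[of _ "csqrt (- (r + t)) / 2"]) (simp add: power_divide)

lemma apparent_half_integer:
  fixes m :: nat and r :: complex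
  defines "k \<equiv> of_nat (2 * m + 1) / 2"
  shows "apparent (potential r (1/4 - k^2))"
proof -
  obtain \<gamma> where \<gamma>: "r + (1/4 - k^2) = - 4 * \<gamma>^2" using exists_gamma by blast
  \<comment> \<open>By parity: twice \<open>k\<close> is odd, twice \<open>Suc i\<close> is
    even.\<close>
  have ne: "of_nat (Suc i) + \<epsilon> * k \<noteq> 0" if "\<epsilon> = 1 \<or> \<epsilon> = - 1" for i and \<epsilon> :: complex
  proof
    assume "of_nat (Suc i) + \<epsilon> * k = 0"
    then have "of_nat (2 * Suc i) = (of_nat (2 * m + 1) :: complex) \<or> of_nat (2 * Suc i + (2 * m + 1)) = (of_nat 0 :: complex)"
      using that by (auto simp: k_def field_simps add_eq_0_iff)
    then have "2 * Suc i = 2 * m + 1 \<or> 2 * Suc i + (2 * m + 1) = 0"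
      unfolding of_nat_eq_iff .
    then show False by presburger
  qed
  have ok: "frob_ok (2 * \<gamma> + 1/6) (2 * \<gamma> + 5/6) k" "frob_ok (2 * \<gamma> + 1/6) (2 * \<gamma> + 5/6) (- k)"
    using ne[of 1] ne[of "-1"] by (auto intro!: frob_okI_not_negative_integer)
  show ?thesis
    by (rule apparent_if_frob_ok[where n = "2 * m + 1", folded k_def, OF _ \<gamma> refl ok]) simp
qed

text \<open>1/2 + 1/6 = 1 - 1/3 and 1/2 + 5/6 = 1 + 1/3, so the zeros in 2 \<gamma> lie
  symmetrically about k - 1 - 2 m.\<close>

lemma numerator_product_eq:
  fixes k m \<gamma> :: complex
  shows "(2 * m + (1/2 - k) + (2 * \<gamma> + 1/6)) * (2 * m + (1/2 - k) + (2 * \<gamma> + 5/6)) =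
    (2 * \<gamma> - (k - 1 - 2 * m + 1/3)) * (2 * \<gamma> - (k - 1 - 2 * m - 1/3))"
  by (rule arg_cong2[where f = times]) (simp_all add: algebra_simps)

lemma apparent_integer_iff:
  fixes k :: nat and r :: complex
  assumes k: "k \<ge> 1"
  defines "t \<equiv> 1/4 - (of_nat k)^2"
  shows "apparent (potential r t) \<longleftrightarrow> (\<exists>m<k. r + t = - ((of_nat k - 1 - 2 * of_nat m + 1/3)^2))"
proof
  assume app: "apparent (potential r t)"
  obtain \<gamma> where \<gamma>: "r + t = - 4 * \<gamma>^2" using exists_gamma by blast
  obtain m where m: "m < k" "(2 * of_nat m + (1/2 - of_nat k) + (2 * \<gamma> + 1/6)) * (2 * of_nat m + (1/2 - of_nat k) + (2 * \<gamma> + 5/6)) = 0"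
    using apparent_imp_product_zero[OF k \<gamma> _ app] t_def by blast
  have sq: "r + t = - ((2 * \<gamma>)^2)" using \<gamma> by (simp add: power_mult_distrib)
  from m(2) consider "2 * \<gamma> = of_nat k - 1 - 2 * of_nat m + 1/3" | "2 * \<gamma> = of_nat k - 1 - 2 * of_nat m - 1/3"
    unfolding numerator_product_eq mult_eq_0_iff right_minus_eq by blast
  then show "\<exists>m<k. r + t = - ((of_nat k - 1 - 2 * of_nat m + 1/3)^2)"
  proof cases
    case 1
    then show ?thesis using m(1) sq by metis
  next
    case 2
    \<comment> \<open>Passing from \<open>m\<close> to \<open>k - 1 - m\<close> reverses the sign of
      k - 1 - 2 m, so the zeros of the second factor are the negatives of those of the first; only
      the square of 2 \<gamma> enters \<open>r + t\<close>.\<close>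
    have "of_nat k - 1 - 2 * of_nat (k - 1 - m) + 1/3 = - (2 * \<gamma>)"
      unfolding 2 using m(1) by (simp add: of_nat_diff)
    then have "r + t = - ((of_nat k - 1 - 2 * of_nat (k - 1 - m) + 1/3)^2)" using sq by simp
    then show ?thesis using m(1) k by (intro exI[of _ "k - 1 - m"]) auto
  qed
next
  assume "\<exists>m<k. r + t = - ((of_nat k - 1 - 2 * of_nat m + 1/3)^2)"
  then obtain m where m: "m < k" "r + t = - ((of_nat k - 1 - 2 * of_nat m + 1/3)^2)" by blast
  define \<gamma> where "\<gamma> = (of_nat k - 1 - 2 * of_nat m + 1/3 :: complex) / 2"
  have rt: "r + t = - 4 * \<gamma>^2" using m(2) by (simp add: \<gamma>_def power_divide)
  have "2 * \<gamma> = of_nat k - 1 - 2 * of_nat m + 1/3" by (simp add: \<gamma>_def)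
  then have "(2 * of_nat m + (1/2 - of_nat k) + (2 * \<gamma> + 1/6)) * (2 * of_nat m + (1/2 - of_nat k) + (2 * \<gamma> + 5/6)) = 0"
    unfolding numerator_product_eq by simp
  from frob_okI_product_zero[OF m(1) this] have ok2: "frob_ok (2 * \<gamma> + 1/6) (2 * \<gamma> + 5/6) (- of_nat k)" .
  have "of_nat (Suc i) + of_nat k \<noteq> (0::complex)" for i
    by (metis add_Suc of_nat_add of_nat_eq_0_iff nat.distinct(1))
  then have ok1: "frob_ok (2 * \<gamma> + 1/6) (2 * \<gamma> + 5/6) (of_nat k)"
    by (rule frob_okI_not_negative_integer)
  show "apparent (potential r t)"
    using apparent_if_frob_ok[of "2 * k", OF _ rt] ok1 ok2 k by (simp add: t_def)
qed

section \<open>The polynomial P and its roots\<close>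

lemma map_poly_of_rat_linear_mult:
  "map_poly of_rat ([:a, 1:] * p) = [:of_rat a, 1:] * (map_poly of_rat p :: complex poly)"
proof (rule poly_eqI)
  fix n
  show "coeff (map_poly of_rat ([:a, 1:] * p)) n = coeff ([:of_rat a, 1:] * (map_poly of_rat p :: complex poly)) n"
    by (cases n) (simp_all add: coeff_map_poly of_rat_add of_rat_mult)
qed

text \<open>The product runs over indices, so coinciding values count with multiplicity and the
  degree is \<open>k\<close> in any case.\<close>

lemma rational_polynomial_with_roots:
  fixes \<rho> :: "nat \<Rightarrow> rat"
  shows "\<exists>P. degree P = k \<and> (\<forall>x::complex. poly (map_poly of_rat P) x = 0 \<longleftrightarrow> (\<exists>m<k. x = of_rat (\<rho> m)))"
proof -
  define P where "P = (\<lambda>k. \<Prod>m<k. [:- \<rho> m, 1:])"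
  have "degree (P k) = k" for k
    unfolding P_def by (subst degree_prod_eq_sum_degree) auto
  moreover have "poly (map_poly of_rat (P k)) x = 0 \<longleftrightarrow> (\<exists>m<k. x = of_rat (\<rho> m))" for k and x :: complex
  proof (induction k)
    case 0
    then show ?case by (simp add: P_def map_poly_1)
  next
    case (Suc k)
    have "P (Suc k) = [:- \<rho> k, 1:] * P k" by (simp add: P_def mult.commute)
    then show ?case using Suc
      by (simp only: map_poly_of_rat_linear_mult poly_mult) (auto simp: of_rat_minus less_Suc_eq)
  qed
  ultimately show ?thesis by blast
qed

text \<open>For m < k the numbers k - 1 - 2 m run from k - 1 down to -(k - 1) in steps of 2. A
  negative one, -l, contributes (-l + 1/3)^2 = (l - 1/3)^2, which is the other choice of
  sign.\<close>

lemma root_index_iff: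
  fixes k :: nat and x :: complex
  assumes "k \<ge> 1"
  shows "(\<exists>m<k. x = - ((of_nat k - 1 - 2 * of_nat m + 1/3)^2)) \<longleftrightarrow>
    (\<exists>l<k. (if odd k then even l else odd l) \<and> (x = - ((of_nat l + 1/3)^2) \<or> x = - ((of_nat l - 1/3)^2)))"
proof
  assume "\<exists>m<k. x = - ((of_nat k - 1 - 2 * of_nat m + 1/3)^2)"
  then obtain m where m: "m < k" "x = - ((of_nat k - 1 - 2 * of_nat m + 1/3)^2)" by blast
  show "\<exists>l<k. (if odd k then even l else odd l) \<and> (x = - ((of_nat l + 1/3)^2) \<or> x = - ((of_nat l - 1/3)^2))"
  proof (cases "2 * m \<le> k - 1")
    case True
    define l where "l = k - 1 - 2 * m"
    have k: "k = l + 1 + 2 * m" using True assms by (simp add: l_def)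
    then have "of_nat k - 1 - 2 * of_nat m = (of_nat l :: complex)" by simp
    moreover have "l < k" "if odd k then even l else odd l" unfolding k by auto
    ultimately show ?thesis using m(2) by metis
  next
    case False
    define l where "l = 2 * m - (k - 1)"
    have k: "k + l = 2 * m + 1" using False assms by (simp add: l_def)
    then have "of_nat (k + l) = (of_nat (2 * m + 1) :: complex)" by simp
    then have "of_nat k - 1 - 2 * of_nat m + 1/3 = - (of_nat l - 1/3 :: complex)" by (simp add: algebra_simps)
    moreover have "l < k" using m(1) k by linarith
    moreover have "if odd k then even l else odd l" using k by (metis even_add even_mult_iff even_plus_one_iff dvd_refl)
    ultimately show ?thesis using m(2) by (metis power2_minus)
  qed
next
  assume "\<exists>l<k. (if odd k then even l else odd l) \<and> (x = - ((of_nat l + 1/3)^2) \<or> x = - ((of_nat l - 1/3)^2))"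
  then obtain l where l: "l < k" "if odd k then even l else odd l" "x = - ((of_nat l + 1/3)^2) \<or> x = - ((of_nat l - 1/3)^2)" by blast
  have "odd (k + l)" using l(2) by (auto split: if_splits)
  then obtain q where q: "k + l = 2 * q + 1" by (rule oddE)
  have "odd (k - l)" using \<open>odd (k + l)\<close> l(1) by simp
  then obtain p where p: "k - l = 2 * p + 1" by (rule oddE)
  from l(3) show "\<exists>m<k. x = - ((of_nat k - 1 - 2 * of_nat m + 1/3)^2)"
  proof
    assume x: "x = - ((of_nat l + 1/3)^2)"
    have "k = l + 2 * p + 1" using p l(1) by linarith
    then have "of_nat k - 1 - 2 * of_nat p = (of_nat l :: complex)" "p < k" by auto
    then show ?thesis using x by metis
  next
    assume x: "x = - ((of_nat l - 1/3)^2)"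
    have "of_nat (k + l) = (of_nat (2 * q + 1) :: complex)" using q by simp
    then have "of_nat k - 1 - 2 * of_nat q + 1/3 = - (of_nat l - 1/3 :: complex)" by (simp add: algebra_simps)
    moreover have "q < k" using q l(1) by linarith
    ultimately show ?thesis using x by (metis power2_minus)
  qed
qed

theorem theorem1p8:
  fixes \<kappa> :: real
  assumes "\<exists>n::nat. n \<ge> 1 \<and> \<kappa> = real n / 2"
  shows
    "((\<exists>m::nat. \<kappa> = 1/2 + real m) \<longrightarrow>
        (\<forall>r t :: complex.
           has_local_exponents (potential r t) \<i> (1/2 - of_real \<kappa>) (1/2 + of_real \<kappa>) \<and>
           apparent (potential r t) \<longleftrightarrow> t = t_of \<kappa>)) \<and>
     (\<forall>k::nat. \<kappa> = real k \<longrightarrow>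
        (\<exists>P :: rat poly. degree P = k \<and>
           (\<forall>r :: complex. apparent (potential r (t_of \<kappa>)) \<longleftrightarrow> poly (map_poly of_rat P) r = 0) \<and>
           {r :: complex. poly (map_poly of_rat P) r = 0} =
             {r. \<exists>l<k. (if odd k then even l else odd l) \<and>
                (r + t_of \<kappa> = - ((of_nat l + 1/3)^2) \<or> r + t_of \<kappa> = - ((of_nat l - 1/3)^2))}))"
proof (intro conjI impI allI)
  fix r t :: complex
  assume "\<exists>m::nat. \<kappa> = 1/2 + real m"
  then obtain m :: nat where m: "\<kappa> = 1/2 + real m" by blast
  have k: "of_real \<kappa> = (of_nat (2 * m + 1) / 2 :: complex)" unfolding m by (simp add: field_simps)
  have t_of: "t_of \<kappa> = 1/4 - (of_real \<kappa>)^2" by (simp add: t_of_def field_simps)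
  \<comment> \<open>The exponents at \<open>\<i>\<close> alone determine \<open>t\<close>;
    apparentness then holds for every \<open>r\<close>.\<close>
  show "has_local_exponents (potential r t) \<i> (1/2 - of_real \<kappa>) (1/2 + of_real \<kappa>) \<and>
           apparent (potential r t) \<longleftrightarrow> t = t_of \<kappa>"
    unfolding has_local_exponents_iff[OF i_in_upper_half_plane E6_i] t_of
    using apparent_half_integer[of r m] unfolding k by blast
next
  fix k :: nat
  assume \<kappa>: "\<kappa> = real k"
  have k: "k \<ge> 1" using assms \<kappa> by (cases k) auto
  have t_of: "t_of \<kappa> = 1/4 - (of_nat k)^2" by (simp add: t_of_def \<kappa> field_simps)
  \<comment> \<open>The condition on \<open>r + t_of \<kappa>\<close> solved for \<open>r\<close>;
    the result is rational because \<open>t_of \<kappa>\<close> is.\<close>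
  define \<rho> :: "nat \<Rightarrow> rat" where
    "\<rho> = (\<lambda>m. - ((of_nat k - 1 - 2 * of_nat m + 1/3)^2) - (1/4 - (of_nat k)^2))"
  have \<rho>: "of_rat (\<rho> m) = - ((of_nat k - 1 - 2 * of_nat m + 1/3)^2) - (1/4 - (of_nat k)^2 :: complex)" for m
    unfolding \<rho>_def by (simp add: of_rat_diff of_rat_minus of_rat_power of_rat_add of_rat_mult of_rat_divide)
  obtain P where P: "degree P = k"
    "\<And>x::complex. poly (map_poly of_rat P) x = 0 \<longleftrightarrow> (\<exists>m<k. x = of_rat (\<rho> m))"
    using rational_polynomial_with_roots[of k \<rho>] by blast
  have P': "poly (map_poly of_rat P) r = 0 \<longleftrightarrow> (\<exists>m<k. r + t_of \<kappa> = - ((of_nat k - 1 - 2 * of_nat m + 1/3)^2))" for r :: complex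
    unfolding P(2) \<rho> t_of by (simp add: eq_diff_eq)
  show "\<exists>P :: rat poly. degree P = k \<and>
           (\<forall>r :: complex. apparent (potential r (t_of \<kappa>)) \<longleftrightarrow> poly (map_poly of_rat P) r = 0) \<and>
           {r :: complex. poly (map_poly of_rat P) r = 0} =
             {r. \<exists>l<k. (if odd k then even l else odd l) \<and>
                (r + t_of \<kappa> = - ((of_nat l + 1/3)^2) \<or> r + t_of \<kappa> = - ((of_nat l - 1/3)^2))}"
  proof (intro exI[of _ P] conjI allI P(1))
    show "apparent (potential r (t_of \<kappa>)) \<longleftrightarrow> poly (map_poly of_rat P) r = 0" for r
      unfolding P' unfolding t_of by (rule apparent_integer_iff[OF k])
    show "{r :: complex. poly (map_poly of_rat P) r = 0} =
             {r. \<exists>l<k. (if odd k then even l else odd l) \<and>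
                (r + t_of \<kappa> = - ((of_nat l + 1/3)^2) \<or> r + t_of \<kappa> = - ((of_nat l - 1/3)^2))}"
      unfolding P' root_index_iff[OF k] ..
  qed
qed

end
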